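(* Let $(M',J,g')$ be a Kähler manifold with Norden metric, $\dim M'=2n+2\ge 4$, of constant totally real sectional curvatures $\nu'$ and $\widetilde{\nu'}$, and let $(M,\varphi,\xi,\eta,g)$, $\dim M=2n+1$, be a real time-like hypersurface of it, with unit normal $N$, function $t$ and second fundamental tensor $A$. Then for all $x,y,z,u\in T_pM$, $p\in M$, $$R(x,y,z,u)=\left\{\nu'[\pi_1-\pi_2-\tan t\,\pi_5]+\widetilde{\nu'}[\pi_3-\tan t\,\pi_4]\right\}(x,y,z,u)-\pi_1(Ax,Ay,z,u),$$ $$\tau=4n^2\nu'-4n\widetilde{\nu'}\tan t-(\mathrm{tr}A)^2+\mathrm{tr}A^2,$$ $$\widetilde\tau=2n\nu'\tan t+2n(2n-1)\widetilde{\nu'}-\mathrm{tr}A\,\mathrm{tr}(A\circ\varphi)+\mathrm{tr}(A^2\circ\varphi).$$ Moreover, for every nondegenerate $\xi$-section with basis $\{\xi,x\}$, $$k(\xi,x)=\nu'-\widetilde{\nu'}\tan t-[\nu'\tan t+\widetilde{\nu'}]\frac{g(x,\varphi x)}{g(x,x)-\eta(x)^2}-\frac{\pi_1(A\xi,Ax,x,\xi)}{g(x,x)-\eta(x)^2};$$ for every nondegenerate $\varphi$-holomorphic section with basis $\{\varphi x,\varphi^2x\}$, $$k(\varphi x,\varphi^2x)=-\frac{\pi_1(A\varphi x,A\varphi^2x,\varphi^2x,\varphi x)}{\pi_1(\varphi x,\varphi^2x,\varphi^2x,\varphi x)};$$ and for every nondegenerate totally real section orthogonal to $\xi$ with basis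 $\{x,y\}$, $$k(x,y)=\nu'-\frac{\pi_1(Ax,Ay,y,x)}{\pi_1(x,y,y,x)}.$$
   Context: Kähler manifold with Norden metric: a $(2n+2)$-dimensional manifold $M'$ with an almost complex structure $J$ ($J^2=-\mathrm{id}$) and a pseudo-Riemannian metric $g'$ such that $g'(JX,JY)=-g'(X,Y)$ and $\nabla'J=0$, where $\nabla'$ is the Levi-Civita connection of $g'$. The signature of $g'$ is neutral. Curvature tensor: $R'(X,Y)Z=\nabla'_X\nabla'_YZ-\nabla'_Y\nabla'_XZ-\nabla'_{[X,Y]}Z$, $R'(X,Y,Z,U)=g'(R'(X,Y)Z,U)$, and $\widetilde{R'}(X,Y,Z,U)=R'(X,Y,Z,JU)$. Put $\pi_1'(x,y,z,u)=g'(y,z)g'(x,u)-g'(x,z)g'(y,u)$. A 2-plane (section) with basis $\{x,y\}$ is nondegenerate if $\pi_1'(x,y,y,x)\ne0$. $M'$ is of constant totally real sectional curvatures $\nu'$, $\widetilde{\nu'}$ (functions on $M'$) if for every $p'\in M'$ and every nondegenerate section $\alpha'\subset T_{p'}M'$ with $J\alpha'\perp\alpha'$ and basis $\{x,y\}$, $R'(x,y,y,x)/\pi_1'(x,y,y,x)=\nu'(p')$ and $\widetilde{R'}(x,y,y,x)/\pi_1'(x,y,y,x)=\widetilde{\nu'}(p')$. Real time-like hypersurface: a hypersurface $M$ of $M'$ with unit normal field $N$, $g'(N,N)=-1$, equipped with the structure $$\varphi=J+\cos t\,g'(\cdot,JN)\{\cos t\,N-\sin t\,JN\},\quad \xi=\sin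 t\,N+\cos t\,JN,\quad \eta=\cos t\,g'(\cdot,JN),\quad g=g'|_M,$$ where $t=\arctan\{g'(N,JN)\}\in(-\pi/2,\pi/2)$. This is an almost contact structure with Norden metric: $\varphi^2X=-X+\eta(X)\xi$, $\eta(\xi)=1$, $g(\varphi X,\varphi Y)=-g(X,Y)+\eta(X)\eta(Y)$. The second fundamental tensor $A$ is given by $\nabla'_XY=\nabla_XY-g(AX,Y)N$, $\nabla'_XN=-AX$, where $\nabla$ is the Levi-Civita connection of $g$. $R$ is the curvature tensor of $\nabla$, with the same conventions as for $R'$: $R(x,y,z,u)=g(R(x,y)z,u)$. Along $M$, $\nu'$ and $\widetilde{\nu'}$ denote their restrictions. Tensors on $M$: $\pi_1(x,y,z,u)=g(y,z)g(x,u)-g(x,z)g(y,u)$; $\pi_2(x,y,z,u)=g(y,\varphi z)g(x,\varphi u)-g(x,\varphi z)g(y,\varphi u)$; $\pi_3(x,y,z,u)=-g(y,z)g(x,\varphi u)+g(x,z)g(y,\varphi u)-g(y,\varphi z)g(x,u)+g(x,\varphi z)g(y,u)$; $\pi_4(x,y,z,u)=\eta(y)\eta(z)g(x,u)-\eta(x)\eta(z)g(y,u)+\eta(x)\eta(u)g(y,z)-\eta(y)\eta(u)g(x,z)$; $\pi_5(x,y,z,u)=\eta(y)\eta(z)g(x,\varphi u)-\eta(x)\eta(z)g(y,\varphi u)+\eta(x)\eta(u)g(y,\varphi z)-\eta(y)\eta(u)g(x,\varphi z)$. For a section $\alpha\subset T_pM$ with basis $\{x,y\}$, nondegenerate means $\pi_1(x,y,y,x)\neq0$,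 and $k(x,y)=R(x,y,y,x)/\pi_1(x,y,y,x)$. $\alpha$ is a $\xi$-section if $\xi\in\alpha$, $\varphi$-holomorphic if $\varphi\alpha=\alpha$, totally real if $\alpha\perp\varphi\alpha$. For any basis $(f_a)$ of $T_pM$ with $(g^{ab})$ the inverse of $(g(f_a,f_b))$: $\tau=g^{ad}g^{bc}R(f_a,f_b,f_c,f_d)$ and $\widetilde\tau=g^{ad}g^{bc}\widetilde R(f_a,f_b,f_c,f_d)$, where $\widetilde R(x,y,z,u)=R(x,y,z,\varphi u)$. *)

theory Defs
  imports "HOL-Analysis.Analysis"
begin

section \<open>Smooth manifolds\<close>

text \<open>
  Manifolds are modelled on a Euclidean space. The tangent space at a point \<open>p\<close> is the model
  space itself, a vector being identified with its components in the chart \<open>chart_at M p\<close>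
  chosen at \<open>p\<close>; \<open>tcoord M c p v\<close> are the components of \<open>v\<close> in any other chart \<open>c\<close> around \<open>p\<close>.
  The chosen chart may jump from point to point, so smoothness of fields is always expressed
  through the components in a fixed chart.
\<close>

fun Ck_on :: "nat \<Rightarrow> 'e::euclidean_space set \<Rightarrow> ('e \<Rightarrow> 'v::real_normed_vector) \<Rightarrow> bool" where
  "Ck_on 0 S f \<longleftrightarrow> continuous_on S f"
| "Ck_on (Suc k) S f \<longleftrightarrow>
     (\<forall>x\<in>S. f differentiable (at x)) \<and> (\<forall>v. Ck_on k S (\<lambda>x. frechet_derivative f (at x) v))"

text \<open>Only used for open \<open>S\<close>.\<close>
definition smooth_on :: "'e::euclidean_space set \<Rightarrow> ('e \<Rightarrow> 'v::real_normed_vector) \<Rightarrow> bool" where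
  "smooth_on S f \<longleftrightarrow> (\<forall>k. Ck_on k S f)"

type_synonym ('a, 'e) chart = "'a set \<times> ('a \<Rightarrow> 'e)"

record ('a, 'e) manifold =
  mtop :: "'a topology"
  atlas :: "('a, 'e) chart set"

definition chart_inv :: "('a, 'e) chart \<Rightarrow> 'e \<Rightarrow> 'a" where
  "chart_inv c = inv_into (fst c) (snd c)"

definition smooth_manifold :: "('a, 'e::euclidean_space) manifold \<Rightarrow> bool" where
  "smooth_manifold M \<longleftrightarrow>
     Hausdorff_space (mtop M) \<and> second_countable (mtop M) \<and>
     (\<Union>c\<in>atlas M. fst c) = topspace (mtop M) \<and>
     (\<forall>c\<in>atlas M. openin (mtop M) (fst c) \<and> open (snd c ` fst c) \<and>
        homeomorphic_map (subtopology (mtop M) (fst c)) (top_of_set (snd c ` fst c)) (snd c)) \<and>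
     (\<forall>c\<in>atlas M. \<forall>d\<in>atlas M. smooth_on (snd c ` (fst c \<inter> fst d)) (snd d \<circ> chart_inv c))"

definition chart_at :: "('a, 'e) manifold \<Rightarrow> 'a \<Rightarrow> ('a, 'e) chart" where
  "chart_at M p = (SOME c. c \<in> atlas M \<and> p \<in> fst c)"

definition smooth_fun_on ::
  "('a, 'e::euclidean_space) manifold \<Rightarrow> 'a set \<Rightarrow> ('a \<Rightarrow> 'v::real_normed_vector) \<Rightarrow> bool" where
  "smooth_fun_on M W f \<longleftrightarrow>
     openin (mtop M) W \<and> (\<forall>c\<in>atlas M. smooth_on (snd c ` (fst c \<inter> W)) (f \<circ> chart_inv c))"

text \<open>The derivative \<open>x f\<close> of a function \<open>f\<close>, smooth near \<open>p\<close>, along a tangent vector \<open>x\<close> at \<open>p\<close>.\<close>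
definition dir_deriv ::
  "('a, 'e::euclidean_space) manifold \<Rightarrow> 'a \<Rightarrow> 'e \<Rightarrow> ('a \<Rightarrow> 'v::real_normed_vector) \<Rightarrow> 'v" where
  "dir_deriv M p x f =
     frechet_derivative (f \<circ> chart_inv (chart_at M p)) (at (snd (chart_at M p) p)) x"

definition tcoord ::
  "('a, 'e::euclidean_space) manifold \<Rightarrow> ('a, 'e) chart \<Rightarrow> 'a \<Rightarrow> 'e \<Rightarrow> 'e" where
  "tcoord M c p v = dir_deriv M p v (snd c)"

text \<open>The local vector field on the domain of \<open>c\<close> with constant components \<open>b\<close> in the chart \<open>c\<close>.\<close>
definition coord_field ::
  "('a, 'e::euclidean_space) manifold \<Rightarrow> ('a, 'e) chart \<Rightarrow> 'e \<Rightarrow> 'a \<Rightarrow> 'e" where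
  "coord_field M c b q = frechet_derivative (snd (chart_at M q) \<circ> chart_inv c) (at (snd c q)) b"

definition smooth_map ::
  "('a, 'e::euclidean_space) manifold \<Rightarrow> ('b, 'f::euclidean_space) manifold \<Rightarrow> ('a \<Rightarrow> 'b) \<Rightarrow> bool"
where
  "smooth_map M M' F \<longleftrightarrow>
     continuous_map (mtop M) (mtop M') F \<and>
     (\<forall>d\<in>atlas M'. smooth_fun_on M {q \<in> topspace (mtop M). F q \<in> fst d} (snd d \<circ> F))"

definition differential ::
  "('a, 'e::euclidean_space) manifold \<Rightarrow> ('b, 'f::euclidean_space) manifold \<Rightarrow>
   ('a \<Rightarrow> 'b) \<Rightarrow> 'a \<Rightarrow> 'e \<Rightarrow> 'f" where
  "differential M M' F p x = dir_deriv M p x (snd (chart_at M' (F p)) \<circ> F)"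

definition vector_field_on ::
  "('a, 'e::euclidean_space) manifold \<Rightarrow> 'a set \<Rightarrow> ('a \<Rightarrow> 'e) \<Rightarrow> bool" where
  "vector_field_on M W X \<longleftrightarrow> openin (mtop M) W \<and>
     (\<forall>c\<in>atlas M. smooth_fun_on M (W \<inter> fst c) (\<lambda>q. tcoord M c q (X q)))"

definition vector_field_along ::
  "('b, 'f::euclidean_space) manifold \<Rightarrow> ('a, 'e::euclidean_space) manifold \<Rightarrow>
   ('b \<Rightarrow> 'a) \<Rightarrow> ('b \<Rightarrow> 'e) \<Rightarrow> bool" where
  "vector_field_along M M' F V \<longleftrightarrow>
     (\<forall>c\<in>atlas M'. smooth_fun_on M {q \<in> topspace (mtop M). F q \<in> fst c}
        (\<lambda>q. tcoord M' c (F q) (V q)))"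

text \<open>At \<open>p\<close> the components in \<open>chart_at M p\<close> are the vector itself, so this is the usual
  coordinate expression \<open>X(Y\<^sup>i) - Y(X\<^sup>i)\<close> of the bracket.\<close>
definition lie_bracket ::
  "('a, 'e::euclidean_space) manifold \<Rightarrow> ('a \<Rightarrow> 'e) \<Rightarrow> ('a \<Rightarrow> 'e) \<Rightarrow> 'a \<Rightarrow> 'e" where
  "lie_bracket M X Y p =
     dir_deriv M p (X p) (\<lambda>q. tcoord M (chart_at M p) q (Y q))
   - dir_deriv M p (Y p) (\<lambda>q. tcoord M (chart_at M p) q (X q))"


section \<open>Connections and curvature\<close>

definition pseudo_riemannian ::
  "('a, 'e::euclidean_space) manifold \<Rightarrow> ('a \<Rightarrow> 'e \<Rightarrow> 'e \<Rightarrow> real) \<Rightarrow> bool" where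
  "pseudo_riemannian M g \<longleftrightarrow>
     (\<forall>p\<in>topspace (mtop M).
        bilinear (g p) \<and> (\<forall>x y. g p x y = g p y x) \<and> (\<forall>x. (\<forall>y. g p x y = 0) \<longrightarrow> x = 0)) \<and>
     (\<forall>W X Y. vector_field_on M W X \<and> vector_field_on M W Y \<longrightarrow>
        smooth_fun_on M W (\<lambda>q. g q (X q) (Y q)))"

text \<open>
  \<open>nabla p x Y\<close> is the covariant derivative at \<open>p\<close>, in the direction \<open>x\<close> of the tangent space
  at \<open>p\<close>, of a vector field \<open>Y\<close> defined near \<open>p\<close>. Fields are total functions of which only the
  restriction to \<open>W\<close> matters: independence of the values of \<open>Y\<close> off \<open>W\<close> is the Leibniz rule for
  the indicator function of \<open>W\<close>.
\<close>
definition affine_connection ::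
  "('a, 'e::euclidean_space) manifold \<Rightarrow> ('a \<Rightarrow> 'e \<Rightarrow> ('a \<Rightarrow> 'e) \<Rightarrow> 'e) \<Rightarrow> bool" where
  "affine_connection M nabla \<longleftrightarrow>
     (\<forall>W Y. vector_field_on M W Y \<longrightarrow>
        (\<forall>p\<in>W. linear (\<lambda>x. nabla p x Y)) \<and>
        (\<forall>X. vector_field_on M W X \<longrightarrow> vector_field_on M W (\<lambda>q. nabla q (X q) Y)) \<and>
        (\<forall>Z. vector_field_on M W Z \<longrightarrow>
           (\<forall>p\<in>W. \<forall>x. nabla p x (\<lambda>q. Y q + Z q) = nabla p x Y + nabla p x Z)) \<and>
        (\<forall>f. smooth_fun_on M W f \<longrightarrow>
           (\<forall>p\<in>W. \<forall>x. nabla p x (\<lambda>q. f q *\<^sub>R Y q) =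
              dir_deriv M p x f *\<^sub>R Y p + f p *\<^sub>R nabla p x Y)))"

definition levi_civita ::
  "('a, 'e::euclidean_space) manifold \<Rightarrow> ('a \<Rightarrow> 'e \<Rightarrow> 'e \<Rightarrow> real) \<Rightarrow>
   ('a \<Rightarrow> 'e \<Rightarrow> ('a \<Rightarrow> 'e) \<Rightarrow> 'e) \<Rightarrow> bool" where
  "levi_civita M g nabla \<longleftrightarrow> affine_connection M nabla \<and>
     (\<forall>W X Y. vector_field_on M W X \<and> vector_field_on M W Y \<longrightarrow>
        (\<forall>p\<in>W. nabla p (X p) Y - nabla p (Y p) X = lie_bracket M X Y p) \<and>
        (\<forall>p\<in>W. \<forall>z. dir_deriv M p z (\<lambda>q. g q (X q) (Y q)) =
           g p (nabla p z X) (Y p) + g p (X p) (nabla p z Y)))"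

text \<open>\<open>R(x,y)z\<close>, evaluated on arbitrary local extensions of \<open>x\<close>, \<open>y\<close>, \<open>z\<close> to vector fields.\<close>
definition curvature ::
  "('a, 'e::euclidean_space) manifold \<Rightarrow> ('a \<Rightarrow> 'e \<Rightarrow> ('a \<Rightarrow> 'e) \<Rightarrow> 'e) \<Rightarrow>
   'a \<Rightarrow> 'e \<Rightarrow> 'e \<Rightarrow> 'e \<Rightarrow> 'e" where
  "curvature M nabla p x y z = (THE w. \<forall>W X Y Z.
     p \<in> W \<and> vector_field_on M W X \<and> vector_field_on M W Y \<and> vector_field_on M W Z \<and>
     X p = x \<and> Y p = y \<and> Z p = z \<longrightarrow>
     w = nabla p (X p) (\<lambda>q. nabla q (Y q) Z) - nabla p (Y p) (\<lambda>q. nabla q (X q) Z)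
         - nabla p (lie_bracket M X Y p) Z)"

definition curvature_tensor ::
  "('a, 'e::euclidean_space) manifold \<Rightarrow> ('a \<Rightarrow> 'e \<Rightarrow> 'e \<Rightarrow> real) \<Rightarrow>
   ('a \<Rightarrow> 'e \<Rightarrow> ('a \<Rightarrow> 'e) \<Rightarrow> 'e) \<Rightarrow> 'a \<Rightarrow> 'e \<Rightarrow> 'e \<Rightarrow> 'e \<Rightarrow> 'e \<Rightarrow> real" where
  "curvature_tensor M g nabla p x y z u = g p (curvature M nabla p x y z) u"

text \<open>
  The covariant derivative along a map \<open>F\<close> from \<open>M\<close> to \<open>M'\<close> of a field \<open>V\<close> along \<open>F\<close>. With
  the coordinate frame \<open>E\<^sub>b\<close> of a chart around \<open>F p\<close> and \<open>V = \<Sum> V\<^sup>b (E\<^sub>b \<circ> F)\<close> it is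
  \<open>\<Sum> (x V\<^sup>b) E\<^sub>b + V\<^sup>b \<nabla>'\<^bsub>dF x\<^esub> E\<^sub>b\<close>.
\<close>
definition cov_deriv_along ::
  "('b, 'f::euclidean_space) manifold \<Rightarrow> ('a, 'e::euclidean_space) manifold \<Rightarrow>
   ('a \<Rightarrow> 'e \<Rightarrow> ('a \<Rightarrow> 'e) \<Rightarrow> 'e) \<Rightarrow> ('b \<Rightarrow> 'a) \<Rightarrow> 'b \<Rightarrow> 'f \<Rightarrow> ('b \<Rightarrow> 'e) \<Rightarrow> 'e" where
  "cov_deriv_along M M' nabla' F p x V =
     (let c = chart_at M' (F p); comp = (\<lambda>b q. tcoord M' c (F q) (V q) \<bullet> b)
      in \<Sum>b\<in>Basis. dir_deriv M p x (comp b) *\<^sub>R coord_field M' c b (F p)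
           + comp b p *\<^sub>R nabla' (F p) (differential M M' F p x) (coord_field M' c b))"


section \<open>Curvature-like tensors and sections\<close>

definition pi1 :: "('v \<Rightarrow> 'v \<Rightarrow> real) \<Rightarrow> 'v \<Rightarrow> 'v \<Rightarrow> 'v \<Rightarrow> 'v \<Rightarrow> real" where
  "pi1 g x y z u = g y z * g x u - g x z * g y u"

definition pi2 :: "('v \<Rightarrow> 'v \<Rightarrow> real) \<Rightarrow> ('v \<Rightarrow> 'v) \<Rightarrow> 'v \<Rightarrow> 'v \<Rightarrow> 'v \<Rightarrow> 'v \<Rightarrow> real" where
  "pi2 g \<phi> x y z u = g y (\<phi> z) * g x (\<phi> u) - g x (\<phi> z) * g y (\<phi> u)"

definition pi3 :: "('v \<Rightarrow> 'v \<Rightarrow> real) \<Rightarrow> ('v \<Rightarrow> 'v) \<Rightarrow> 'v \<Rightarrow> 'v \<Rightarrow> 'v \<Rightarrow> 'v \<Rightarrow> real" where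
  "pi3 g \<phi> x y z u =
     - g y z * g x (\<phi> u) + g x z * g y (\<phi> u) - g y (\<phi> z) * g x u + g x (\<phi> z) * g y u"

definition pi4 :: "('v \<Rightarrow> 'v \<Rightarrow> real) \<Rightarrow> ('v \<Rightarrow> real) \<Rightarrow> 'v \<Rightarrow> 'v \<Rightarrow> 'v \<Rightarrow> 'v \<Rightarrow> real" where
  "pi4 g \<eta> x y z u =
     \<eta> y * \<eta> z * g x u - \<eta> x * \<eta> z * g y u + \<eta> x * \<eta> u * g y z - \<eta> y * \<eta> u * g x z"

definition pi5 ::
  "('v \<Rightarrow> 'v \<Rightarrow> real) \<Rightarrow> ('v \<Rightarrow> 'v) \<Rightarrow> ('v \<Rightarrow> real) \<Rightarrow> 'v \<Rightarrow> 'v \<Rightarrow> 'v \<Rightarrow> 'v \<Rightarrow> real" where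
  "pi5 g \<phi> \<eta> x y z u =
     \<eta> y * \<eta> z * g x (\<phi> u) - \<eta> x * \<eta> z * g y (\<phi> u)
     + \<eta> x * \<eta> u * g y (\<phi> z) - \<eta> y * \<eta> u * g x (\<phi> z)"

definition plane_basis :: "'v::real_vector set \<Rightarrow> 'v \<Rightarrow> 'v \<Rightarrow> bool" where
  "plane_basis \<alpha> x y \<longleftrightarrow> x \<noteq> y \<and> independent {x, y} \<and> \<alpha> = span {x, y}"

definition nondegenerate_basis :: "('v \<Rightarrow> 'v \<Rightarrow> real) \<Rightarrow> 'v \<Rightarrow> 'v \<Rightarrow> bool" where
  "nondegenerate_basis g x y \<longleftrightarrow> pi1 g x y y x \<noteq> 0"

definition perp :: "('v \<Rightarrow> 'v \<Rightarrow> real) \<Rightarrow> 'v set \<Rightarrow> 'v set \<Rightarrow> bool" where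
  "perp g A B \<longleftrightarrow> (\<forall>a\<in>A. \<forall>b\<in>B. g a b = 0)"

definition xi_section :: "'v \<Rightarrow> 'v set \<Rightarrow> bool" where
  "xi_section \<xi> \<alpha> \<longleftrightarrow> \<xi> \<in> \<alpha>"

definition holomorphic_section :: "('v \<Rightarrow> 'v) \<Rightarrow> 'v set \<Rightarrow> bool" where
  "holomorphic_section \<phi> \<alpha> \<longleftrightarrow> \<phi> ` \<alpha> = \<alpha>"

definition totally_real_section :: "('v \<Rightarrow> 'v \<Rightarrow> real) \<Rightarrow> ('v \<Rightarrow> 'v) \<Rightarrow> 'v set \<Rightarrow> bool" where
  "totally_real_section g \<phi> \<alpha> \<longleftrightarrow> perp g \<alpha> (\<phi> ` \<alpha>)"

definition sectional_curvature ::
  "('v \<Rightarrow> 'v \<Rightarrow> real) \<Rightarrow> ('v \<Rightarrow> 'v \<Rightarrow> 'v \<Rightarrow> 'v \<Rightarrow> real) \<Rightarrow> 'v \<Rightarrow> 'v \<Rightarrow> real" where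
  "sectional_curvature g R x y = R x y y x / pi1 g x y y x"

definition associated :: "('v \<Rightarrow> 'v) \<Rightarrow> ('v \<Rightarrow> 'v \<Rightarrow> 'v \<Rightarrow> 'v \<Rightarrow> real) \<Rightarrow> 'v \<Rightarrow> 'v \<Rightarrow> 'v \<Rightarrow> 'v \<Rightarrow> real"
where
  "associated \<phi> R x y z u = R x y z (\<phi> u)"

text \<open>A basis \<open>B\<close> (indexed by its own elements) together with the inverse \<open>ginv\<close> of its Gram
  matrix; \<open>B\<close> is finite because the space is finite-dimensional.\<close>
definition basis_with_inverse_metric ::
  "('v::euclidean_space \<Rightarrow> 'v \<Rightarrow> real) \<Rightarrow> 'v set \<Rightarrow> ('v \<Rightarrow> 'v \<Rightarrow> real) \<Rightarrow> bool" where
  "basis_with_inverse_metric g B ginv \<longleftrightarrow> independent B \<and> span B = UNIV \<and>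
     (\<forall>a\<in>B. \<forall>c\<in>B. (\<Sum>b\<in>B. ginv a b * g b c) = (if a = c then 1 else 0))"

definition scalar_contraction ::
  "'v set \<Rightarrow> ('v \<Rightarrow> 'v \<Rightarrow> real) \<Rightarrow> ('v \<Rightarrow> 'v \<Rightarrow> 'v \<Rightarrow> 'v \<Rightarrow> real) \<Rightarrow> real" where
  "scalar_contraction B ginv T =
     (\<Sum>a\<in>B. \<Sum>b\<in>B. \<Sum>c\<in>B. \<Sum>d\<in>B. ginv a d * ginv b c * T a b c d)"


section \<open>Kaehler manifolds with Norden metric\<close>

definition kaehler_norden ::
  "('a, 'e::euclidean_space) manifold \<Rightarrow> ('a \<Rightarrow> 'e \<Rightarrow> 'e) \<Rightarrow> ('a \<Rightarrow> 'e \<Rightarrow> 'e \<Rightarrow> real) \<Rightarrow>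
   ('a \<Rightarrow> 'e \<Rightarrow> ('a \<Rightarrow> 'e) \<Rightarrow> 'e) \<Rightarrow> bool" where
  "kaehler_norden M J g nabla \<longleftrightarrow>
     smooth_manifold M \<and> pseudo_riemannian M g \<and> levi_civita M g nabla \<and>
     (\<forall>p\<in>topspace (mtop M). linear (J p) \<and> (\<forall>x. J p (J p x) = - x) \<and>
        (\<forall>x y. g p (J p x) (J p y) = - g p x y)) \<and>
     (\<forall>W Y. vector_field_on M W Y \<longrightarrow> vector_field_on M W (\<lambda>q. J q (Y q)) \<and>
        (\<forall>p\<in>W. \<forall>x. nabla p x (\<lambda>q. J q (Y q)) - J p (nabla p x Y) = 0))"

definition constant_totally_real_curvatures ::
  "('a, 'e::euclidean_space) manifold \<Rightarrow> ('a \<Rightarrow> 'e \<Rightarrow> 'e) \<Rightarrow> ('a \<Rightarrow> 'e \<Rightarrow> 'e \<Rightarrow> real) \<Rightarrow>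
   ('a \<Rightarrow> 'e \<Rightarrow> ('a \<Rightarrow> 'e) \<Rightarrow> 'e) \<Rightarrow> ('a \<Rightarrow> real) \<Rightarrow> ('a \<Rightarrow> real) \<Rightarrow> bool" where
  "constant_totally_real_curvatures M J g nabla \<nu> \<nu>t \<longleftrightarrow>
     (\<forall>p\<in>topspace (mtop M). \<forall>\<alpha> x y.
        plane_basis \<alpha> x y \<and> nondegenerate_basis (g p) x y \<and>
        totally_real_section (g p) (J p) \<alpha> \<longrightarrow>
          sectional_curvature (g p) (curvature_tensor M g nabla p) x y = \<nu> p \<and>
          sectional_curvature (g p) (associated (J p) (curvature_tensor M g nabla p)) x y = \<nu>t p)"


section \<open>Real time-like hypersurfaces\<close>

text \<open>A hypersurface is given by an immersion \<open>\<iota>\<close> of codimension one; the tangent space of \<open>M\<close>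
  at \<open>p\<close> is identified with its image under the differential of \<open>\<iota>\<close>.\<close>
definition timelike_hypersurface ::
  "('a, 'e::euclidean_space) manifold \<Rightarrow> ('a \<Rightarrow> 'e \<Rightarrow> 'e \<Rightarrow> real) \<Rightarrow>
   ('b, 'f::euclidean_space) manifold \<Rightarrow> ('b \<Rightarrow> 'a) \<Rightarrow> ('b \<Rightarrow> 'e) \<Rightarrow> bool" where
  "timelike_hypersurface M' g' M \<iota> N \<longleftrightarrow>
     smooth_manifold M \<and> DIM('e) = DIM('f) + 1 \<and> smooth_map M M' \<iota> \<and>
     vector_field_along M M' \<iota> N \<and>
     (\<forall>p\<in>topspace (mtop M). inj (differential M M' \<iota> p) \<and>
        (\<forall>x. g' (\<iota> p) (N p) (differential M M' \<iota> p x) = 0) \<and> g' (\<iota> p) (N p) (N p) = -1)"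

definition tangent_part ::
  "('a, 'e::euclidean_space) manifold \<Rightarrow> ('b, 'f::euclidean_space) manifold \<Rightarrow> ('b \<Rightarrow> 'a) \<Rightarrow>
   'b \<Rightarrow> 'e \<Rightarrow> 'f" where
  "tangent_part M' M \<iota> p v = (THE x. differential M M' \<iota> p x = v)"

definition induced_metric ::
  "('a, 'e::euclidean_space) manifold \<Rightarrow> ('a \<Rightarrow> 'e \<Rightarrow> 'e \<Rightarrow> real) \<Rightarrow>
   ('b, 'f::euclidean_space) manifold \<Rightarrow> ('b \<Rightarrow> 'a) \<Rightarrow> 'b \<Rightarrow> 'f \<Rightarrow> 'f \<Rightarrow> real" where
  "induced_metric M' g' M \<iota> p x y =
     g' (\<iota> p) (differential M M' \<iota> p x) (differential M M' \<iota> p y)"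

definition hyp_t ::
  "('a \<Rightarrow> 'e \<Rightarrow> 'e) \<Rightarrow> ('a \<Rightarrow> 'e \<Rightarrow> 'e \<Rightarrow> real) \<Rightarrow> ('b \<Rightarrow> 'a) \<Rightarrow> ('b \<Rightarrow> 'e) \<Rightarrow> 'b \<Rightarrow> real" where
  "hyp_t J g' \<iota> N p = arctan (g' (\<iota> p) (N p) (J (\<iota> p) (N p)))"

definition hyp_phi ::
  "('a, 'e::euclidean_space) manifold \<Rightarrow> ('a \<Rightarrow> 'e \<Rightarrow> 'e) \<Rightarrow> ('a \<Rightarrow> 'e \<Rightarrow> 'e \<Rightarrow> real) \<Rightarrow>
   ('b, 'f::euclidean_space) manifold \<Rightarrow> ('b \<Rightarrow> 'a) \<Rightarrow> ('b \<Rightarrow> 'e) \<Rightarrow> 'b \<Rightarrow> 'f \<Rightarrow> 'f" where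
  "hyp_phi M' J g' M \<iota> N p x =
     (let t = hyp_t J g' \<iota> N p; JN = J (\<iota> p) (N p); x' = differential M M' \<iota> p x
      in tangent_part M' M \<iota> p
           (J (\<iota> p) x' + (cos t * g' (\<iota> p) x' JN) *\<^sub>R (cos t *\<^sub>R N p - sin t *\<^sub>R JN)))"

definition hyp_xi ::
  "('a, 'e::euclidean_space) manifold \<Rightarrow> ('a \<Rightarrow> 'e \<Rightarrow> 'e) \<Rightarrow> ('a \<Rightarrow> 'e \<Rightarrow> 'e \<Rightarrow> real) \<Rightarrow>
   ('b, 'f::euclidean_space) manifold \<Rightarrow> ('b \<Rightarrow> 'a) \<Rightarrow> ('b \<Rightarrow> 'e) \<Rightarrow> 'b \<Rightarrow> 'f" where
  "hyp_xi M' J g' M \<iota> N p =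
     (let t = hyp_t J g' \<iota> N p
      in tangent_part M' M \<iota> p (sin t *\<^sub>R N p + cos t *\<^sub>R J (\<iota> p) (N p)))"

definition hyp_eta ::
  "('a, 'e::euclidean_space) manifold \<Rightarrow> ('a \<Rightarrow> 'e \<Rightarrow> 'e) \<Rightarrow> ('a \<Rightarrow> 'e \<Rightarrow> 'e \<Rightarrow> real) \<Rightarrow>
   ('b, 'f::euclidean_space) manifold \<Rightarrow> ('b \<Rightarrow> 'a) \<Rightarrow> ('b \<Rightarrow> 'e) \<Rightarrow> 'b \<Rightarrow> 'f \<Rightarrow> real" where
  "hyp_eta M' J g' M \<iota> N p x =
     cos (hyp_t J g' \<iota> N p) * g' (\<iota> p) (differential M M' \<iota> p x) (J (\<iota> p) (N p))"

text \<open>Weingarten's formula \<open>\<nabla>'\<^sub>x N = - A x\<close>; it determines \<open>A\<close>, and the formula of Gauss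
  \<open>\<nabla>'\<^sub>X Y = \<nabla>\<^sub>X Y - g(AX, Y) N\<close> is a consequence.\<close>
definition second_fundamental_tensor ::
  "('a, 'e::euclidean_space) manifold \<Rightarrow> ('a \<Rightarrow> 'e \<Rightarrow> ('a \<Rightarrow> 'e) \<Rightarrow> 'e) \<Rightarrow>
   ('b, 'f::euclidean_space) manifold \<Rightarrow> ('b \<Rightarrow> 'a) \<Rightarrow> ('b \<Rightarrow> 'e) \<Rightarrow> 'b \<Rightarrow> 'f \<Rightarrow> 'f" where
  "second_fundamental_tensor M' nabla' M \<iota> N p x =
     tangent_part M' M \<iota> p (- cov_deriv_along M M' nabla' \<iota> p x N)"

end

theory Submission
  imports Defs
begin

text \<open>
  In charts around \<open>p\<close> and \<open>\<iota> p\<close> both connections are given by Christoffel symbols, and the curvature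
  by the classical formula in them. The Levi-Civita connection of the induced metric is the tangential
  part of the ambient one; differentiating this relation gives the equation of Gauss
  \<open>R(x,y,z,u) = R'(x,y,z,u) - \<pi>\<^sub>1(Ax,Ay,z,u)\<close>.

  The tensor \<open>R'\<close> is complex multilinear for \<open>J\<close>: with \<open>G(x,y) = g'(x,y) - i g'(x,Jy)\<close> it is the real
  part of a complex curvature tensor. A complex plane on which \<open>G\<close> is nondegenerate has a
  \<open>G\<close>-orthonormal basis, which spans a totally real section. Constancy of the totally real
  curvatures thus fixes the complex sectional curvature on generic planes, hence everywhere, and
  \<open>R' = \<nu>'(\<pi>\<^sub>1' - \<pi>\<^sub>2') + \<nu>t' \<pi>\<^sub>3'\<close>. On tangent vectors \<open>g'(x,Jy) = g(x,\<phi>y) + tan t \<eta>(x) \<eta>(y)\<close>,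
  which turns this into the formula for \<open>R\<close>. The remaining identities are contractions and
  special values of it.
\<close>

section \<open>Calculus of smooth functions\<close>

text \<open>The data are given implicitly: \<open>curvature\<close> is a definite description over
  all extensions to fields, and a connection is an operator on fields defined near a point. They
  become computable only in components, where the tools are the product rule, the chain rule and the
  symmetry of second derivatives. Fields on the image of \<iota> have no canonical extension to M',
  so covariant differentiation along a map takes the place of extensions. The minus sign of the term
  in A comes from g'(N,N) = -1: products of normal components enter with the opposite sign.

  Totally real planes satisfy closed conditions among real planes, so a density argument over the
  reals does not reach the others. Over the complex numbers every vector with G(x,x) nonzero can be
  rescaled to length 1, signs being no obstruction, and each generic complex plane meets the
  hypothesis. That dim M' is at least 4 provides one such plane, from which all others are reached.

  The constants in n come from four traces: 2n+1 for the identity, 0 for \<phi>, -2n for \<phi>^2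
  and 1 for \<eta> tensor \<xi>.\<close>

lemma Ck_on_cong:
  assumes "open S" "\<And>x. x \<in> S \<Longrightarrow> f x = g x" "Ck_on k S f"
  shows "Ck_on k S g"
  using assms(2,3)
proof (induction k arbitrary: f g)
  case 0
  then show ?case by (metis Ck_on.simps(1) continuous_on_cong)
next
  case (Suc k)
  have d: "g differentiable (at x)" "frechet_derivative f (at x) = frechet_derivative g (at x)"
    if "x \<in> S" for x
  proof -
    have f: "f differentiable (at x)" using Suc.prems that by simp
    show "frechet_derivative f (at x) = frechet_derivative g (at x)"
      using frechet_derivative_transform_within_open[OF f assms(1) that] Suc.prems(1) by metis
    show "g differentiable (at x)"
      using f[unfolded differentiable_def] has_derivative_transform_within_open[OF _ assms(1) that] Suc.prems(1)
      unfolding differentiable_def by metis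
  qed
  have "Ck_on k S (\<lambda>x. frechet_derivative g (at x) v)" for v
    by (rule Suc.IH[of "\<lambda>x. frechet_derivative f (at x) v"]) (use d Suc.prems in auto)
  then show ?case using d by simp
qed

lemma Ck_on_subset: "Ck_on k S f \<Longrightarrow> T \<subseteq> S \<Longrightarrow> Ck_on k T f"
proof (induction k arbitrary: f)
  case 0
  then show ?case using continuous_on_subset by auto
next
  case (Suc k)
  then show ?case by auto
qed

lemma Ck_on_Suc_imp: "Ck_on (Suc k) S f \<Longrightarrow> Ck_on k S f"
proof (induction k arbitrary: f)
  case 0
  then show ?case
    by (simp add: continuous_at_imp_continuous_on differentiable_imp_continuous_within)
next
  case (Suc k)
  then show ?case by (metis Ck_on.simps(2))
qed

text \<open>\<open>frechet_derivative\<close> is a choice operator, whereas the differentiation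
  rules produce explicit derivatives. Uniqueness of the derivative at the points of S lets the
  inductions below work with the explicit ones.\<close>

lemma Ck_on_SucI:
  assumes "open S" and D: "\<And>x. x \<in> S \<Longrightarrow> (f has_derivative D x) (at x)"
    and "\<And>v. Ck_on k S (\<lambda>x. D x v)"
  shows "Ck_on (Suc k) S f"
proof -
  have "D x v = frechet_derivative f (at x) v" if "x \<in> S" for x v
    using frechet_derivative_at[OF D[OF that]] by simp
  then have "Ck_on k S (\<lambda>x. frechet_derivative f (at x) v)" for v
    by (intro Ck_on_cong[OF assms(1) _ assms(3)])
  then show ?thesis using D by (auto simp: differentiable_def)
qed

lemma Ck_on_const: "Ck_on k S (\<lambda>x. c)"
  by (induction k arbitrary: c) auto

lemma Ck_on_add:
  assumes "open S" "Ck_on k S f" "Ck_on k S g"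
  shows "Ck_on k S (\<lambda>x. f x + g x)"
  using assms(2,3)
proof (induction k arbitrary: f g)
  case 0
  then show ?case by (simp add: continuous_on_add)
next
  case (Suc k)
  have "Ck_on k S (\<lambda>x. frechet_derivative f (at x) v + frechet_derivative g (at x) v)" for v
    using Suc by auto
  moreover have D: "((\<lambda>x. f x + g x) has_derivative
      (\<lambda>v. frechet_derivative f (at x) v + frechet_derivative g (at x) v)) (at x)" if "x \<in> S" for x
    using that Suc.prems by (intro has_derivative_add) (auto simp: frechet_derivative_works[symmetric])
  ultimately show ?case using Ck_on_SucI[OF assms(1) D] by blast
qed

lemma Ck_on_bilinear:
  assumes "open S" "bounded_bilinear B" "Ck_on k S f" "Ck_on k S g"
  shows "Ck_on k S (\<lambda>x. B (f x) (g x))"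
  using assms(3,4)
proof (induction k arbitrary: f g)
  case 0
  then show ?case using bounded_bilinear.continuous_on[OF assms(2)] by auto
next
  case (Suc k)
  have "Ck_on k S f" "Ck_on k S g" using Suc.prems Ck_on_Suc_imp by auto
  then have "Ck_on k S (\<lambda>x. B (f x) (frechet_derivative g (at x) v) + B (frechet_derivative f (at x) v) (g x))" for v
    using Suc by (intro Ck_on_add assms(1)) auto
  moreover have D: "((\<lambda>x. B (f x) (g x)) has_derivative
      (\<lambda>v. B (f x) (frechet_derivative g (at x) v) + B (frechet_derivative f (at x) v) (g x))) (at x)"
    if "x \<in> S" for x
    using that Suc.prems by (intro bounded_bilinear.FDERIV[OF assms(2)]) (auto simp: frechet_derivative_works[symmetric])
  ultimately show ?case using Ck_on_SucI[OF assms(1) D] by blast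
qed

lemma Ck_on_bounded_linear:
  assumes "open S" "bounded_linear L" "Ck_on k S f"
  shows "Ck_on k S (\<lambda>x. L (f x))"
  using assms(3)
proof (induction k arbitrary: f)
  case 0
  then show ?case using bounded_linear.continuous_on[OF assms(2)] by auto
next
  case (Suc k)
  have "Ck_on k S (\<lambda>x. L (frechet_derivative f (at x) v))" for v
    using Suc by auto
  moreover have D: "((\<lambda>x. L (f x)) has_derivative (\<lambda>v. L (frechet_derivative f (at x) v))) (at x)"
    if "x \<in> S" for x
    using that Suc.prems by (intro bounded_linear.has_derivative[OF assms(2)]) (auto simp: frechet_derivative_works[symmetric])
  ultimately show ?case using Ck_on_SucI[OF assms(1) D] by blast
qed

lemma Ck_on_sum:
  assumes "open S" "\<And>i. i \<in> I \<Longrightarrow> Ck_on k S (f i)"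
  shows "Ck_on k S (\<lambda>x. \<Sum>i\<in>I. f i x)"
  using assms(2)
  by (induction I rule: infinite_finite_induct) (auto simp: Ck_on_const intro: Ck_on_add[OF assms(1)])

lemma linear_apply_basis:
  fixes L :: "'e::euclidean_space \<Rightarrow> 'v::real_vector"
  assumes "linear L"
  shows "L x = (\<Sum>b\<in>Basis. (x \<bullet> b) *\<^sub>R L b)"
proof -
  have "L x = L (\<Sum>b\<in>Basis. (x \<bullet> b) *\<^sub>R b)" by (simp add: euclidean_representation)
  also have "\<dots> = (\<Sum>b\<in>Basis. (x \<bullet> b) *\<^sub>R L b)"
    by (simp add: linear_sum[OF assms] linear_scale[OF assms])
  finally show ?thesis .
qed

text \<open>\<open>Ck_on\<close> speaks of derivatives in a fixed direction, but the chain rule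
  feeds a varying direction into the derivative of g. Expanding that direction in the standard basis
  leaves a sum of products with fixed directions, to which the induction hypothesis applies.\<close>

lemma Ck_on_compose:
  fixes f :: "'e::euclidean_space \<Rightarrow> 'g::euclidean_space" and g :: "'g \<Rightarrow> 'v::real_normed_vector"
  assumes "open S" "open T" "f ` S \<subseteq> T" "Ck_on k S f" "Ck_on k T g"
  shows "Ck_on k S (\<lambda>x. g (f x))"
  using assms(4,5)
proof (induction k arbitrary: g)
  case 0
  then show ?case using assms(3) continuous_on_compose2 by (metis Ck_on.simps(1))
next
  case (Suc k)
  have fk: "Ck_on k S f" using Suc.prems Ck_on_Suc_imp by auto
  have "Ck_on k S (\<lambda>x. frechet_derivative g (at (f x)) b)" for b
    using Suc.IH[of "\<lambda>y. frechet_derivative g (at y) b"] fk Suc.prems by auto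
  moreover have "Ck_on k S (\<lambda>x. frechet_derivative f (at x) v \<bullet> b)" for b v
    using Ck_on_bounded_linear[OF assms(1) bounded_linear_inner_left[of b]] Suc.prems by auto
  ultimately have C: "Ck_on k S (\<lambda>x. \<Sum>b\<in>Basis. (frechet_derivative f (at x) v \<bullet> b) *\<^sub>R frechet_derivative g (at (f x)) b)" for v
    by (intro Ck_on_sum Ck_on_bilinear[OF _ bounded_bilinear_scaleR] assms(1)) auto
  have D: "((\<lambda>x. g (f x)) has_derivative
       (\<lambda>v. frechet_derivative g (at (f x)) (frechet_derivative f (at x) v))) (at x)" if "x \<in> S" for x
    using that Suc.prems assms(3)
    by (intro has_derivative_compose[of f _ x UNIV g, simplified]) (auto simp: frechet_derivative_works[symmetric])
  have "(\<Sum>b\<in>Basis. (frechet_derivative f (at x) v \<bullet> b) *\<^sub>R frechet_derivative g (at (f x)) b)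
     = frechet_derivative g (at (f x)) (frechet_derivative f (at x) v)" if "x \<in> S" for x v
  proof -
    have "linear (frechet_derivative g (at (f x)))"
      using Suc.prems that assms(3) by (intro linear_frechet_derivative) auto
    from linear_apply_basis[OF this, of "frechet_derivative f (at x) v"]
    show ?thesis by simp
  qed
  then have "Ck_on k S (\<lambda>x. frechet_derivative g (at (f x)) (frechet_derivative f (at x) v))" for v
    by (intro Ck_on_cong[OF assms(1) _ C])
  then show ?case using Ck_on_SucI[OF assms(1) D] by blast
qed

lemma smooth_on_cong:
  "open S \<Longrightarrow> smooth_on S f \<Longrightarrow> (\<And>x. x \<in> S \<Longrightarrow> f x = g x) \<Longrightarrow> smooth_on S g"
  unfolding smooth_on_def using Ck_on_cong by blast

lemma smooth_on_subset: "smooth_on S f \<Longrightarrow> T \<subseteq> S \<Longrightarrow> smooth_on T f"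
  unfolding smooth_on_def using Ck_on_subset by blast

lemma smooth_on_const: "smooth_on S (\<lambda>x. c)"
  unfolding smooth_on_def using Ck_on_const by blast

lemma smooth_on_ident: "smooth_on S (\<lambda>x. x)"
  unfolding smooth_on_def
proof
  show "Ck_on k S (\<lambda>x. x)" for k
    by (cases k) (simp_all add: Ck_on_const continuous_on_id)
qed

lemma smooth_on_add:
  "open S \<Longrightarrow> smooth_on S f \<Longrightarrow> smooth_on S g \<Longrightarrow> smooth_on S (\<lambda>x. f x + g x)"
  unfolding smooth_on_def using Ck_on_add by blast

lemma smooth_on_sum:
  "open S \<Longrightarrow> (\<And>i. i \<in> I \<Longrightarrow> smooth_on S (f i)) \<Longrightarrow> smooth_on S (\<lambda>x. \<Sum>i\<in>I. f i x)"
  unfolding smooth_on_def by (intro allI Ck_on_sum) auto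

lemma smooth_on_scaleR:
  "open S \<Longrightarrow> smooth_on S f \<Longrightarrow> smooth_on S g \<Longrightarrow> smooth_on S (\<lambda>x. f x *\<^sub>R g x)"
  unfolding smooth_on_def using Ck_on_bilinear[OF _ bounded_bilinear_scaleR] by blast

lemma smooth_on_bounded_linear:
  "open S \<Longrightarrow> bounded_linear L \<Longrightarrow> smooth_on S f \<Longrightarrow> smooth_on S (\<lambda>x. L (f x))"
  unfolding smooth_on_def using Ck_on_bounded_linear by blast

lemma smooth_on_compose:
  fixes f :: "'e::euclidean_space \<Rightarrow> 'g::euclidean_space" and g :: "'g \<Rightarrow> 'v::real_normed_vector"
  shows "open S \<Longrightarrow> open T \<Longrightarrow> f ` S \<subseteq> T \<Longrightarrow> smooth_on S f \<Longrightarrow> smooth_on T g \<Longrightarrow> smooth_on S (\<lambda>x. g (f x))"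
  unfolding smooth_on_def using Ck_on_compose by blast

lemma smooth_on_frechet: "smooth_on S f \<Longrightarrow> smooth_on S (\<lambda>x. frechet_derivative f (at x) v)"
  unfolding smooth_on_def by (metis Ck_on.simps(2))

lemma smooth_on_differentiable: "smooth_on S f \<Longrightarrow> x \<in> S \<Longrightarrow> f differentiable (at x)"
  unfolding smooth_on_def by (metis Ck_on.simps(2))

lemma smooth_on_has_derivative:
  "smooth_on S f \<Longrightarrow> x \<in> S \<Longrightarrow> (f has_derivative frechet_derivative f (at x)) (at x)"
  using smooth_on_differentiable frechet_derivative_works by blast

lemma smooth_on_continuous: "smooth_on S f \<Longrightarrow> continuous_on S f"
  unfolding smooth_on_def by (metis Ck_on.simps(1))

section \<open>Symmetry of second derivatives\<close>

lemma has_real_derivative_line: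
  fixes f :: "'e::real_normed_vector \<Rightarrow> real"
  assumes "(f has_derivative D) (at (a + s *\<^sub>R u))"
  shows "((\<lambda>s. f (a + s *\<^sub>R u)) has_real_derivative D u) (at s)"
proof -
  have "((\<lambda>s. a + s *\<^sub>R u) has_derivative (\<lambda>r. r *\<^sub>R u)) (at s)"
    by (auto intro!: derivative_eq_intros)
  from has_derivative_compose[where g = f, OF this assms]
  have "((\<lambda>s. f (a + s *\<^sub>R u)) has_derivative (\<lambda>r. D (r *\<^sub>R u))) (at s)" .
  moreover have "(\<lambda>r. D (r *\<^sub>R u)) = (*) (D u)"
    using linear_scale[OF has_derivative_linear[OF assms]] by (auto simp: mult.commute)
  ultimately show ?thesis by (simp add: has_field_derivative_def)
qed

text \<open>The left side does not change when u and v are exchanged, which is what forces mixed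
  derivatives to agree. Two mean value theorems evaluate it: along u for the increment under the
  shift by h v, then along v for the derivative in direction u.\<close>

lemma second_difference_mvt:
  fixes f :: "'e::real_normed_vector \<Rightarrow> real"
  assumes h: "h > 0"
    and S: "\<And>s t. 0 \<le> s \<Longrightarrow> s \<le> h \<Longrightarrow> 0 \<le> t \<Longrightarrow> t \<le> h \<Longrightarrow> x + s *\<^sub>R u + t *\<^sub>R v \<in> S"
    and f: "\<And>y. y \<in> S \<Longrightarrow> (f has_derivative Df y) (at y)"
    and Df: "\<And>y. y \<in> S \<Longrightarrow> ((\<lambda>y. Df y u) has_derivative Du y) (at y)"
  obtains s t where "0 < s" "s < h" "0 < t" "t < h"
    "f (x + h *\<^sub>R u + h *\<^sub>R v) - f (x + h *\<^sub>R u) - f (x + h *\<^sub>R v) + f x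
       = h * h * Du (x + s *\<^sub>R u + t *\<^sub>R v) v"
proof -
  define w where "w s = f ((x + h *\<^sub>R v) + s *\<^sub>R u) - f (x + s *\<^sub>R u)" for s
  have "\<exists>s>0. s < h \<and> w h - w 0 = (h - 0) * (Df ((x + h *\<^sub>R v) + s *\<^sub>R u) u - Df (x + s *\<^sub>R u) u)"
  proof (rule MVT2[OF h])
    fix s assume s: "0 \<le> s" "s \<le> h"
    have a: "(x + h *\<^sub>R v) + s *\<^sub>R u \<in> S" "x + s *\<^sub>R u \<in> S"
      using S[of s h] S[of s 0] s h by (auto simp: algebra_simps)
    show "(w has_real_derivative (Df ((x + h *\<^sub>R v) + s *\<^sub>R u) u - Df (x + s *\<^sub>R u) u)) (at s)"
      unfolding w_def by (intro DERIV_diff has_real_derivative_line f a)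
  qed
  then obtain s where s: "0 < s" "s < h"
    and ws: "w h - w 0 = h * (Df (x + s *\<^sub>R u + h *\<^sub>R v) u - Df (x + s *\<^sub>R u) u)"
    by (auto simp: algebra_simps)
  have "\<exists>t>0. t < h \<and> (\<lambda>t. Df (x + s *\<^sub>R u + t *\<^sub>R v) u) h - (\<lambda>t. Df (x + s *\<^sub>R u + t *\<^sub>R v) u) 0
      = (h - 0) * Du (x + s *\<^sub>R u + t *\<^sub>R v) v"
    by (rule MVT2[OF h], rule has_real_derivative_line[of "\<lambda>y. Df y u"], rule Df) (use S s in auto)
  then obtain t where t: "0 < t" "t < h"
    "Df (x + s *\<^sub>R u + h *\<^sub>R v) u - Df (x + s *\<^sub>R u) u = h * Du (x + s *\<^sub>R u + t *\<^sub>R v) v" by auto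
  show ?thesis using that[OF s t(1,2)] ws t(3) by (auto simp: w_def algebra_simps)
qed

text \<open>Evaluating one second difference in both orders gives equal mixed derivatives at two
  points close to x. Continuity at x carries the equality over to x.\<close>

lemma symmetric_second_derivative_real:
  fixes f :: "'e::real_normed_vector \<Rightarrow> real"
  assumes S: "open S" "x \<in> S"
    and f: "\<And>y. y \<in> S \<Longrightarrow> (f has_derivative Df y) (at y)"
    and Du: "\<And>y. y \<in> S \<Longrightarrow> ((\<lambda>y. Df y u) has_derivative Du y) (at y)"
    and Dv: "\<And>y. y \<in> S \<Longrightarrow> ((\<lambda>y. Df y v) has_derivative Dv y) (at y)"
    and cu: "continuous (at x) (\<lambda>y. Du y v)" and cv: "continuous (at x) (\<lambda>y. Dv y u)"
  shows "Du x v = Dv x u"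
proof (rule ccontr)
  assume "Du x v \<noteq> Dv x u"
  \<comment> \<open>Half the gap, so that the \<epsilon>-neighbourhoods of the two values are
    disjoint.\<close>
  define \<epsilon> where "\<epsilon> = \<bar>Du x v - Dv x u\<bar> / 2"
  have \<epsilon>: "\<epsilon> > 0" using \<open>Du x v \<noteq> Dv x u\<close> by (simp add: \<epsilon>_def)
  obtain d1 where d1: "d1 > 0" "\<And>y. dist y x < d1 \<Longrightarrow> dist (Du y v) (Du x v) < \<epsilon>"
    using cu \<epsilon> by (auto simp: continuous_at_eps_delta dist_norm)
  obtain d2 where d2: "d2 > 0" "\<And>y. dist y x < d2 \<Longrightarrow> dist (Dv y u) (Dv x u) < \<epsilon>"
    using cv \<epsilon> by (auto simp: continuous_at_eps_delta dist_norm)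
  obtain d3 where d3: "d3 > 0" "ball x d3 \<subseteq> S" using S open_contains_ball by blast
  define d where "d = min d1 (min d2 d3)"
  \<comment> \<open>Small enough for the whole parallelogram with sides h u and h v to lie within
    distance d of x; the summand 1 keeps the denominator positive when u = v = 0.\<close>
  define h where "h = d / (2 * (norm u + norm v + 1))"
  have d: "d > 0" using d1 d2 d3 by (simp add: d_def)
  have nn: "norm u + norm v + 1 > 0" by (smt (verit) norm_ge_zero)
  have h: "h > 0" using d nn by (simp add: h_def)
  have near: "dist (x + s *\<^sub>R u + t *\<^sub>R v) x < d" if "0 \<le> s" "s \<le> h" "0 \<le> t" "t \<le> h" for s t
  proof -
    have "dist (x + s *\<^sub>R u + t *\<^sub>R v) x = norm (s *\<^sub>R u + t *\<^sub>R v)" by (simp add: dist_norm)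
    also have "\<dots> \<le> s * norm u + t * norm v"
      using norm_triangle_ineq[of "s *\<^sub>R u" "t *\<^sub>R v"] that by simp
    also have "\<dots> \<le> h * norm u + h * norm v" using that by (intro add_mono mult_right_mono) auto
    also have "\<dots> < h * (2 * (norm u + norm v + 1))" using h nn by (simp add: algebra_simps add_strict_increasing2)
    also have "\<dots> = d" using nn by (simp add: h_def)
    finally show ?thesis .
  qed
  have inS: "x + s *\<^sub>R u + t *\<^sub>R v \<in> S" "x + t *\<^sub>R v + s *\<^sub>R u \<in> S" if "0 \<le> s" "s \<le> h" "0 \<le> t" "t \<le> h" for s t
    using near[OF that] d3 by (auto simp: d_def dist_commute subset_iff algebra_simps)
  obtain s t where st: "0 < s" "s < h" "0 < t" "t < h"
    "f (x + h *\<^sub>R u + h *\<^sub>R v) - f (x + h *\<^sub>R u) - f (x + h *\<^sub>R v) + f x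
       = h * h * Du (x + s *\<^sub>R u + t *\<^sub>R v) v"
    by (rule second_difference_mvt[OF h inS(1) f Du]) auto
  obtain s' t' where st': "0 < s'" "s' < h" "0 < t'" "t' < h"
    "f (x + h *\<^sub>R v + h *\<^sub>R u) - f (x + h *\<^sub>R v) - f (x + h *\<^sub>R u) + f x
       = h * h * Dv (x + s' *\<^sub>R v + t' *\<^sub>R u) u"
    by (rule second_difference_mvt[OF h inS(2) f Dv]) auto
  have "h * h * Du (x + s *\<^sub>R u + t *\<^sub>R v) v = h * h * Dv (x + s' *\<^sub>R v + t' *\<^sub>R u) u"
    using st(5) st'(5) by (simp add: algebra_simps)
  then have eq: "Du (x + s *\<^sub>R u + t *\<^sub>R v) v = Dv (x + s' *\<^sub>R v + t' *\<^sub>R u) u" using h by simp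
  have "dist (Du (x + s *\<^sub>R u + t *\<^sub>R v) v) (Du x v) < \<epsilon>"
    using d1(2) near[of s t] st by (auto simp: d_def)
  moreover have "dist (Dv (x + s' *\<^sub>R v + t' *\<^sub>R u) u) (Dv x u) < \<epsilon>"
    using d2(2) near[of t' s'] st' by (auto simp: d_def algebra_simps)
  ultimately show False using eq by (auto simp: \<epsilon>_def dist_real_def abs_if split: if_splits)
qed

lemma frechet_derivative_inner:
  assumes "f differentiable (at x)"
  shows "frechet_derivative (\<lambda>y. f y \<bullet> b) (at x) v = frechet_derivative f (at x) v \<bullet> b"
proof -
  have "((\<lambda>y. f y \<bullet> b) has_derivative (\<lambda>v. frechet_derivative f (at x) v \<bullet> b)) (at x)"
    using assms by (intro has_derivative_inner_left) (simp add: frechet_derivative_works[symmetric])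
  from frechet_derivative_at[OF this] show ?thesis by metis
qed

lemma smooth_on_symmetric:
  fixes f :: "'e::euclidean_space \<Rightarrow> 'v::euclidean_space"
  assumes S: "open S" "x \<in> S" and f: "smooth_on S f"
  shows "frechet_derivative (\<lambda>y. frechet_derivative f (at y) u) (at x) v
       = frechet_derivative (\<lambda>y. frechet_derivative f (at y) v) (at x) u"
proof (rule euclidean_eqI)
  fix b :: 'v assume "b \<in> Basis"
  define D where "D = (\<lambda>y w. frechet_derivative f (at y) w \<bullet> b)"
  have sD: "smooth_on S (\<lambda>y. frechet_derivative f (at y) w)" for w
    by (rule smooth_on_frechet[OF f])
  have D: "((\<lambda>y. D y w) has_derivative (\<lambda>z. frechet_derivative (\<lambda>y. frechet_derivative f (at y) w) (at y) z \<bullet> b)) (at y)"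
    if "y \<in> S" for y w
    unfolding D_def by (intro has_derivative_inner_left smooth_on_has_derivative[OF sD that])
  have f': "((\<lambda>y. f y \<bullet> b) has_derivative D y) (at y)" if "y \<in> S" for y
    unfolding D_def by (intro has_derivative_inner_left smooth_on_has_derivative[OF f that])
  have c: "continuous (at x) (\<lambda>y. frechet_derivative (\<lambda>y. frechet_derivative f (at y) w) (at y) z \<bullet> b)" for w z
    using smooth_on_continuous[OF smooth_on_frechet[OF sD[of w], of z]] S
    by (intro continuous_intros) (simp add: continuous_on_eq_continuous_at)
  show "frechet_derivative (\<lambda>y. frechet_derivative f (at y) u) (at x) v \<bullet> b
      = frechet_derivative (\<lambda>y. frechet_derivative f (at y) v) (at x) u \<bullet> b"
    by (rule symmetric_second_derivative_real[OF S f' D D c c])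
qed

section \<open>Connections in coordinates\<close>

lemma bilinear_apply_basis:
  fixes B :: "'a::euclidean_space \<Rightarrow> 'b::euclidean_space \<Rightarrow> 'v::real_vector"
  assumes "bilinear B"
  shows "B x y = (\<Sum>i\<in>Basis. \<Sum>j\<in>Basis. ((x \<bullet> i) * (y \<bullet> j)) *\<^sub>R B i j)"
proof -
  have l: "linear (B z)" "linear (\<lambda>x. B x w)" for z w using assms by (auto simp: bilinear_def)
  have "B x y = (\<Sum>i\<in>Basis. (x \<bullet> i) *\<^sub>R B i y)" using linear_apply_basis[OF l(2)] .
  also have "\<dots> = (\<Sum>i\<in>Basis. (x \<bullet> i) *\<^sub>R (\<Sum>j\<in>Basis. (y \<bullet> j) *\<^sub>R B i j))"
    using linear_apply_basis[OF l(1)] by metis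
  finally show ?thesis by (simp add: scaleR_sum_right)
qed

text \<open>Product rule for a form whose base point varies together with its arguments.
  Differentiability of B is given for fixed vectors only, so B is expanded in basis vectors, which
  makes the base point the only variable inside B.\<close>

lemma bilinear_family_has_derivative:
  fixes B :: "'e::euclidean_space \<Rightarrow> 'a::euclidean_space \<Rightarrow> 'b::euclidean_space \<Rightarrow> 'v::real_normed_vector"
    and F :: "'f::real_normed_vector \<Rightarrow> 'e"
  assumes S: "open S" "F e \<in> S" and bil: "\<And>y. y \<in> S \<Longrightarrow> bilinear (B y)"
    and dB: "\<And>u v. (\<lambda>y. B y u v) differentiable (at (F e))"
    and F: "(F has_derivative F') (at e)"
    and a: "(a has_derivative a') (at e)" and b: "(b has_derivative b') (at e)"
  shows "((\<lambda>y. B (F y) (a y) (b y)) has_derivative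
    (\<lambda>x. frechet_derivative (\<lambda>y. B y (a e) (b e)) (at (F e)) (F' x)
       + B (F e) (a' x) (b e) + B (F e) (a e) (b' x))) (at e)"
proof -
  define D where "D u v = frechet_derivative (\<lambda>y. B y u v) (at (F e))" for u v
  have D: "((\<lambda>y. B y u v) has_derivative D u v) (at (F e))" for u v
    using dB unfolding D_def by (simp add: frechet_derivative_works[symmetric])
  define G where "G y = (\<Sum>i\<in>Basis. \<Sum>j\<in>Basis. ((a y \<bullet> i) * (b y \<bullet> j)) *\<^sub>R B (F y) i j)" for y
  have DG: "(G has_derivative (\<lambda>x. \<Sum>i\<in>Basis. \<Sum>j\<in>Basis.
      ((a e \<bullet> i) * (b e \<bullet> j)) *\<^sub>R D i j (F' x)
      + ((a e \<bullet> i) * (b' x \<bullet> j) + (a' x \<bullet> i) * (b e \<bullet> j)) *\<^sub>R B (F e) i j)) (at e)"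
    unfolding G_def
    by (intro has_derivative_sum has_derivative_scaleR has_derivative_mult has_derivative_inner_left a b
        has_derivative_compose[OF F D])
  have G: "G y = B (F y) (a y) (b y)" if "F y \<in> S" for y
    unfolding G_def by (rule bilinear_apply_basis[OF bil[OF that], symmetric])
  have "isCont F e" using F has_derivative_continuous by blast
  then have "eventually (\<lambda>y. F y \<in> S) (at e)" using S by (metis continuous_within topological_tendstoD)
  then have "eventually (\<lambda>y. G y = B (F y) (a y) (b y)) (at e)"
    by eventually_elim (rule G)
  then have "((\<lambda>y. B (F y) (a y) (b y)) has_derivative (\<lambda>x. \<Sum>i\<in>Basis. \<Sum>j\<in>Basis.
      ((a e \<bullet> i) * (b e \<bullet> j)) *\<^sub>R D i j (F' x)
      + ((a e \<bullet> i) * (b' x \<bullet> j) + (a' x \<bullet> i) * (b e \<bullet> j)) *\<^sub>R B (F e) i j)) (at e)"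
    by (intro has_derivative_transform_eventually[where f = G and g = "\<lambda>y. B (F y) (a y) (b y)" and x = e and s = UNIV] DG G[OF S(2)]) simp_all
  moreover have "(\<lambda>x. \<Sum>i\<in>Basis. \<Sum>j\<in>Basis. ((a e \<bullet> i) * (b e \<bullet> j)) *\<^sub>R D i j (F' x)
      + ((a e \<bullet> i) * (b' x \<bullet> j) + (a' x \<bullet> i) * (b e \<bullet> j)) *\<^sub>R B (F e) i j)
    = (\<lambda>x. D (a e) (b e) (F' x) + B (F e) (a' x) (b e) + B (F e) (a e) (b' x))"
  proof
    fix x
    have "((\<lambda>y. \<Sum>i\<in>Basis. \<Sum>j\<in>Basis. ((a e \<bullet> i) * (b e \<bullet> j)) *\<^sub>R B y i j) has_derivative
       (\<lambda>z. \<Sum>i\<in>Basis. \<Sum>j\<in>Basis. ((a e \<bullet> i) * (b e \<bullet> j)) *\<^sub>R D i j z)) (at (F e))"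
      by (intro has_derivative_sum has_derivative_scaleR_right D)
    then have "((\<lambda>y. B y (a e) (b e)) has_derivative
       (\<lambda>z. \<Sum>i\<in>Basis. \<Sum>j\<in>Basis. ((a e \<bullet> i) * (b e \<bullet> j)) *\<^sub>R D i j z)) (at (F e))"
      by (rule has_derivative_transform_within_open[OF _ S])
        (use bilinear_apply_basis[OF bil, of _ "a e" "b e"] in simp)
    from has_derivative_unique[OF D this]
    have Dsum: "D (a e) (b e) (F' x) = (\<Sum>i\<in>Basis. \<Sum>j\<in>Basis. ((a e \<bullet> i) * (b e \<bullet> j)) *\<^sub>R D i j (F' x))"
      by (rule fun_cong)
    show "(\<Sum>i\<in>Basis. \<Sum>j\<in>Basis. ((a e \<bullet> i) * (b e \<bullet> j)) *\<^sub>R D i j (F' x)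
      + ((a e \<bullet> i) * (b' x \<bullet> j) + (a' x \<bullet> i) * (b e \<bullet> j)) *\<^sub>R B (F e) i j)
      = D (a e) (b e) (F' x) + B (F e) (a' x) (b e) + B (F e) (a e) (b' x)"
      unfolding Dsum bilinear_apply_basis[OF bil[OF S(2)], of "a' x" "b e"]
        bilinear_apply_basis[OF bil[OF S(2)], of "a e" "b' x"]
      by (simp only: sum.distrib scaleR_add_left ac_simps)
  qed
  ultimately show ?thesis unfolding D_def by simp
qed

lemma smooth_on_bilinear_family:
  fixes B :: "'e::euclidean_space \<Rightarrow> 'a::euclidean_space \<Rightarrow> 'b::euclidean_space \<Rightarrow> 'v::real_normed_vector"
    and F :: "'f::euclidean_space \<Rightarrow> 'e"
  assumes T: "open T" "open S" "F ` T \<subseteq> S" and bil: "\<And>y. y \<in> S \<Longrightarrow> bilinear (B y)"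
    and B: "\<And>u v. smooth_on S (\<lambda>y. B y u v)"
    and F: "smooth_on T F" and a: "smooth_on T a" and b: "smooth_on T b"
  shows "smooth_on T (\<lambda>y. B (F y) (a y) (b y))"
proof (rule smooth_on_cong[OF T(1)])
  show "smooth_on T (\<lambda>y. \<Sum>i\<in>Basis. \<Sum>j\<in>Basis. (a y \<bullet> i) *\<^sub>R (b y \<bullet> j) *\<^sub>R B (F y) i j)"
    by (intro smooth_on_sum smooth_on_scaleR T(1) smooth_on_bounded_linear[OF _ bounded_linear_inner_left] a b
        smooth_on_compose[OF T F B])
  show "(\<Sum>i\<in>Basis. \<Sum>j\<in>Basis. (a y \<bullet> i) *\<^sub>R (b y \<bullet> j) *\<^sub>R B (F y) i j) = B (F y) (a y) (b y)" if "y \<in> T" for y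
    using bilinear_apply_basis[OF bil, of "F y" "a y" "b y"] that T(3) by auto
qed

text \<open>The pulled back connection in charts: F is the map and V the component vector of a field
  along it. For the identity map this is ordinary covariant differentiation.\<close>

definition cov_along ::
  "('e::euclidean_space \<Rightarrow> 'e \<Rightarrow> 'e \<Rightarrow> 'e) \<Rightarrow> ('f::euclidean_space \<Rightarrow> 'e) \<Rightarrow> 'f \<Rightarrow> 'f \<Rightarrow> ('f \<Rightarrow> 'e) \<Rightarrow> 'e" where
  "cov_along \<Gamma> F e x V = frechet_derivative V (at e) x + \<Gamma> (F e) (frechet_derivative F (at e) x) (V e)"

text \<open>The curvature evaluated on coordinate fields; they commute, so there is no bracket
  term.\<close>

definition coord_curvature :: "('e::euclidean_space \<Rightarrow> 'e \<Rightarrow> 'e \<Rightarrow> 'e) \<Rightarrow> 'e \<Rightarrow> 'e \<Rightarrow> 'e \<Rightarrow> 'e \<Rightarrow> 'e" where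
  "coord_curvature \<Gamma> e x y z =
     frechet_derivative (\<lambda>e. \<Gamma> e y z) (at e) x - frechet_derivative (\<lambda>e. \<Gamma> e x z) (at e) y
     + \<Gamma> e x (\<Gamma> e y z) - \<Gamma> e y (\<Gamma> e x z)"

section \<open>Curvature identities in Christoffel symbols\<close>

locale christoffel =
  fixes S :: "'e::euclidean_space set" and \<Gamma> :: "'e \<Rightarrow> 'e \<Rightarrow> 'e \<Rightarrow> 'e"
  assumes open_S: "open S"
    and bilinear_\<Gamma>: "\<And>e. e \<in> S \<Longrightarrow> bilinear (\<Gamma> e)"
    and smooth_\<Gamma>: "\<And>x y. smooth_on S (\<lambda>e. \<Gamma> e x y)"
    and sym_\<Gamma>: "\<And>e x y. e \<in> S \<Longrightarrow> \<Gamma> e x y = \<Gamma> e y x"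
begin

lemma \<Gamma>_linear: "e \<in> S \<Longrightarrow> linear (\<Gamma> e x)" "e \<in> S \<Longrightarrow> linear (\<lambda>x. \<Gamma> e x y)"
  using bilinear_\<Gamma> by (auto simp: bilinear_def)

lemma smooth_on_cov_along:
  assumes "open T" "F ` T \<subseteq> S" "smooth_on T F" "smooth_on T V"
  shows "smooth_on T (\<lambda>e. cov_along \<Gamma> F e x V)"
proof -
  have "smooth_on T (\<lambda>e. \<Gamma> (F e) (frechet_derivative F (at e) x) (V e))"
    by (rule smooth_on_bilinear_family[where B = \<Gamma> and S = S])
      (use assms open_S bilinear_\<Gamma> smooth_\<Gamma> smooth_on_frechet in auto)
  then show ?thesis
    unfolding cov_along_def by (intro smooth_on_add smooth_on_frechet assms)
qed

text \<open>After antisymmetrising in x and y, the second derivatives of F and of V cancel, and so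
  do the terms with one \<Gamma> and one derivative of V, whose sum is symmetric. What remains are
  derivatives of \<Gamma> and products of two \<Gamma>. The identity map gives the intrinsic
  curvature, the immersion gives the ambient curvature on tangent vectors.\<close>

lemma curvature_along:
  fixes F :: "'f::euclidean_space \<Rightarrow> 'e"
  assumes T: "open T" "e \<in> T" "F ` T \<subseteq> S" and F: "smooth_on T F" and V: "smooth_on T V"
  shows "cov_along \<Gamma> F e x (\<lambda>e. cov_along \<Gamma> F e y V) - cov_along \<Gamma> F e y (\<lambda>e. cov_along \<Gamma> F e x V)
    = coord_curvature \<Gamma> (F e) (frechet_derivative F (at e) x) (frechet_derivative F (at e) y) (V e)"
proof -
  have eS: "F e \<in> S" using T by auto
  note l = linear_add[OF \<Gamma>_linear(1)[OF eS]] linear_add[OF \<Gamma>_linear(2)[OF eS]]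
  have D: "frechet_derivative (\<lambda>e. cov_along \<Gamma> F e y V) (at e) x =
     frechet_derivative (\<lambda>e. frechet_derivative V (at e) y) (at e) x
     + (frechet_derivative (\<lambda>w. \<Gamma> w (frechet_derivative F (at e) y) (V e)) (at (F e)) (frechet_derivative F (at e) x)
        + \<Gamma> (F e) (frechet_derivative (\<lambda>e. frechet_derivative F (at e) y) (at e) x) (V e)
        + \<Gamma> (F e) (frechet_derivative F (at e) y) (frechet_derivative V (at e) x))" for x y
  proof -
    have "((\<lambda>e. cov_along \<Gamma> F e y V) has_derivative (\<lambda>x.
     frechet_derivative (\<lambda>e. frechet_derivative V (at e) y) (at e) x
     + (frechet_derivative (\<lambda>w. \<Gamma> w (frechet_derivative F (at e) y) (V e)) (at (F e)) (frechet_derivative F (at e) x)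
        + \<Gamma> (F e) (frechet_derivative (\<lambda>e. frechet_derivative F (at e) y) (at e) x) (V e)
        + \<Gamma> (F e) (frechet_derivative F (at e) y) (frechet_derivative V (at e) x)))) (at e)"
      unfolding cov_along_def
      by (intro has_derivative_add bilinear_family_has_derivative[where B = \<Gamma> and F = F and e = e and S = S] open_S eS bilinear_\<Gamma>
          smooth_on_differentiable[OF smooth_\<Gamma> eS] smooth_on_has_derivative[OF _ T(2)] smooth_on_frechet F V)
    from fun_cong[OF frechet_derivative_at[OF this], of x] show ?thesis by (rule sym)
  qed
  show ?thesis
    unfolding cov_along_def[of _ _ _ _ "\<lambda>e. cov_along \<Gamma> F e _ V"] D
    using smooth_on_symmetric[OF T(1,2) F, of x y] smooth_on_symmetric[OF T(1,2) V, of x y]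
    by (simp add: cov_along_def coord_curvature_def l)
qed

lemma frechet_\<Gamma>_sym:
  assumes "e \<in> S"
  shows "frechet_derivative (\<lambda>e. \<Gamma> e y z) (at e) = frechet_derivative (\<lambda>e. \<Gamma> e z y) (at e)"
  by (rule frechet_derivative_transform_within_open[OF smooth_on_differentiable[OF smooth_\<Gamma> assms] open_S assms])
    (rule sym_\<Gamma>)

lemma coord_curvature_skew: "coord_curvature \<Gamma> e x y z = - coord_curvature \<Gamma> e y x z"
  by (simp add: coord_curvature_def)

lemma coord_curvature_bianchi:
  assumes "e \<in> S"
  shows "coord_curvature \<Gamma> e x y z + coord_curvature \<Gamma> e y z x + coord_curvature \<Gamma> e z x y = 0"
  using frechet_\<Gamma>_sym[OF assms, of x y] frechet_\<Gamma>_sym[OF assms, of y z] frechet_\<Gamma>_sym[OF assms, of z x]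
    sym_\<Gamma>[OF assms, of x y] sym_\<Gamma>[OF assms, of y z] sym_\<Gamma>[OF assms, of z x]
  by (simp add: coord_curvature_def)

end

locale coord_levi_civita = christoffel S \<Gamma> for S :: "'e::euclidean_space set" and \<Gamma> +
  fixes h :: "'e \<Rightarrow> 'e \<Rightarrow> 'e \<Rightarrow> real"
  assumes bilinear_h: "\<And>e. e \<in> S \<Longrightarrow> bilinear (h e)"
    and sym_h: "\<And>e x y. e \<in> S \<Longrightarrow> h e x y = h e y x"
    and smooth_h: "\<And>x y. smooth_on S (\<lambda>e. h e x y)"
    and compat: "\<And>e x y z. e \<in> S \<Longrightarrow>
      frechet_derivative (\<lambda>e. h e x y) (at e) z = h e (\<Gamma> e z x) y + h e x (\<Gamma> e z y)"
begin

lemma h_linear: "e \<in> S \<Longrightarrow> linear (h e x)" "e \<in> S \<Longrightarrow> linear (\<lambda>x. h e x y)"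
  using bilinear_h by (auto simp: bilinear_def)

text \<open>\<open>compat\<close> covers constant components; for varying ones the product rule adds
  exactly the derivative parts of \<open>cov_along\<close>.\<close>

lemma metric_along:
  fixes F :: "'f::euclidean_space \<Rightarrow> 'e"
  assumes e: "F e \<in> S" and F: "F differentiable (at e)" and V: "V differentiable (at e)" and W: "W differentiable (at e)"
  shows "((\<lambda>e. h (F e) (V e) (W e)) has_derivative
    (\<lambda>x. h (F e) (cov_along \<Gamma> F e x V) (W e) + h (F e) (V e) (cov_along \<Gamma> F e x W))) (at e)"
proof -
  have "((\<lambda>e. h (F e) (V e) (W e)) has_derivative
    (\<lambda>x. frechet_derivative (\<lambda>y. h y (V e) (W e)) (at (F e)) (frechet_derivative F (at e) x)
       + h (F e) (frechet_derivative V (at e) x) (W e) + h (F e) (V e) (frechet_derivative W (at e) x))) (at e)"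
    using F V W
    by (intro bilinear_family_has_derivative[where B = h and F = F and e = e and S = S] open_S e bilinear_h smooth_on_differentiable[OF smooth_h e])
      (simp_all add: frechet_derivative_works[symmetric])
  then show ?thesis
    by (simp add: ac_simps compat[OF e] cov_along_def linear_add[OF h_linear(1)[OF e]] linear_add[OF h_linear(2)[OF e]])
qed

text \<open>The second derivative of \<open>h e z w\<close> is computed from compatibility with the
  metric. Its cross terms are symmetric in x and y, so antisymmetrising leaves the curvature acting
  on z plus the curvature acting on w, and this vanishes because second derivatives commute.\<close>

lemma coord_curvature_skew_metric:
  assumes e: "e \<in> S"
  shows "h e (coord_curvature \<Gamma> e x y z) w = - h e z (coord_curvature \<Gamma> e x y w)"
proof -
  define C where "C x V e = cov_along \<Gamma> (\<lambda>x. x) e x V" for x :: 'e and V :: "'e \<Rightarrow> 'e" and e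
  have sm: "smooth_on S (C x (\<lambda>_. z))" for x z
    unfolding C_def
    by (rule smooth_on_cov_along[OF open_S])
      (auto simp: smooth_on_const intro: smooth_on_bounded_linear[OF open_S bounded_linear_ident] smooth_on_ident)
  have dC: "C x (\<lambda>_. z) differentiable (at e)" if "e \<in> S" for x z e
    using smooth_on_differentiable[OF sm that] .
  have D1: "frechet_derivative (\<lambda>e. h e z w) (at e) x = h e (C x (\<lambda>_. z) e) w + h e z (C x (\<lambda>_. w) e)" if "e \<in> S" for e x
    using compat[OF that] by (simp add: C_def cov_along_def)
  have D2: "frechet_derivative (\<lambda>e. frechet_derivative (\<lambda>e. h e z w) (at e) y) (at e) x =
     h e (C x (C y (\<lambda>_. z)) e) w + h e (C y (\<lambda>_. z) e) (C x (\<lambda>_. w) e)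
     + (h e (C x (\<lambda>_. z) e) (C y (\<lambda>_. w) e) + h e z (C x (C y (\<lambda>_. w)) e))" for x y
  proof -
    have "((\<lambda>e. h e (C y (\<lambda>_. z) e) w + h e z (C y (\<lambda>_. w) e)) has_derivative
      (\<lambda>x. h e (C x (C y (\<lambda>_. z)) e) w + h e (C y (\<lambda>_. z) e) (C x (\<lambda>_. w) e)
     + (h e (C x (\<lambda>_. z) e) (C y (\<lambda>_. w) e) + h e z (C x (C y (\<lambda>_. w)) e)))) (at e)"
      unfolding C_def
      by (intro has_derivative_add metric_along[where F = "\<lambda>x. x"] e dC[OF e, unfolded C_def]) auto
    then have "((\<lambda>e. frechet_derivative (\<lambda>e. h e z w) (at e) y) has_derivative
      (\<lambda>x. h e (C x (C y (\<lambda>_. z)) e) w + h e (C y (\<lambda>_. z) e) (C x (\<lambda>_. w) e)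
     + (h e (C x (\<lambda>_. z) e) (C y (\<lambda>_. w) e) + h e z (C x (C y (\<lambda>_. w)) e)))) (at e)"
      by (rule has_derivative_transform_within_open[OF _ open_S e]) (simp add: D1)
    from fun_cong[OF frechet_derivative_at[OF this], of x] show ?thesis by (rule sym)
  qed
  have K: "C x (C y (\<lambda>_. z)) e - C y (C x (\<lambda>_. z)) e = coord_curvature \<Gamma> e x y z" for z
    using curvature_along[OF open_S e, of "\<lambda>x. x" "\<lambda>_. z" x y]
    by (simp add: C_def[abs_def] smooth_on_ident smooth_on_const)
  show ?thesis
    using smooth_on_symmetric[OF open_S e smooth_h[of z w], of x y]
    unfolding D2 K[symmetric] linear_diff[OF h_linear(1)[OF e]] linear_diff[OF h_linear(2)[OF e]]
    by simp
qed

text \<open>The tensor \<open>B\<close> below measures the failure of the induced connection to be the tangential part of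
  the ambient one; paired with tangent vectors it is symmetric in its first two and skew in its
  last two arguments, hence zero.\<close>

theorem gauss_equation_coord:
  fixes F N :: "'f::euclidean_space \<Rightarrow> 'e" and T :: "'f set" and \<Gamma>0 :: "'f \<Rightarrow> 'f \<Rightarrow> 'f \<Rightarrow> 'f"
    and e :: 'f and dF :: "'f \<Rightarrow> 'f \<Rightarrow> 'e" and h0 :: "'f \<Rightarrow> 'f \<Rightarrow> 'f \<Rightarrow> real" and b :: "'f \<Rightarrow> 'f \<Rightarrow> real"
  defines "dF \<equiv> \<lambda>e. frechet_derivative F (at e)"
    and "h0 \<equiv> \<lambda>e x y. h (F e) (dF e x) (dF e y)"
    and "b \<equiv> \<lambda>x y. - h (F e) (cov_along \<Gamma> F e x N) (dF e y)"
  assumes h0: "coord_levi_civita T \<Gamma>0 h0" and F: "F ` T \<subseteq> S" "smooth_on T F"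
    and N: "smooth_on T N" "\<And>e x. e \<in> T \<Longrightarrow> h (F e) (N e) (dF e x) = 0"
    and e: "e \<in> T" and NN: "h (F e) (N e) (N e) = - 1"
    and tang: "\<And>v. h (F e) (N e) v = 0 \<Longrightarrow> v \<in> range (dF e)"
  shows "h0 e (coord_curvature \<Gamma>0 e x y z) u
    = h (F e) (coord_curvature \<Gamma> (F e) (dF e x) (dF e y) (dF e z)) (dF e u)
      - (b y z * b x u - b x z * b y u)" (is ?gauss)
    and "b y z = b z y"
proof -
  interpret M: coord_levi_civita T \<Gamma>0 h0 by (rule h0)
  define C where "C x V e = cov_along \<Gamma> F e x V" for x V e
  define C0 where "C0 x V e = cov_along \<Gamma>0 (\<lambda>x. x) e x V" for x V e
  define E where "E x e = dF e x" for x e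
  have FS: "F e \<in> S" if "e \<in> T" for e using F that by auto
  have dF: "F differentiable (at e)" if "e \<in> T" for e by (rule smooth_on_differentiable[OF F(2) that])
  have smE: "smooth_on T (E x)" for x unfolding E_def dF_def by (rule smooth_on_frechet[OF F(2)])
  have dE: "E x differentiable (at e)" if "e \<in> T" for e x by (rule smooth_on_differentiable[OF smE that])
  have smC: "smooth_on T (C y (E z))" for y z
    unfolding C_def by (rule smooth_on_cov_along[OF M.open_S F smE])
  have dC: "C y (E z) differentiable (at e)" if "e \<in> T" for y z e
    by (rule smooth_on_differentiable[OF smC that])
  have dN: "N differentiable (at e)" if "e \<in> T" for e by (rule smooth_on_differentiable[OF N(1) that])
  have met: "((\<lambda>e. h (F e) (V e) (W e)) has_derivative
      (\<lambda>x. h (F e) (C x V e) (W e) + h (F e) (V e) (C x W e))) (at e)"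
    if "e \<in> T" "V differentiable (at e)" "W differentiable (at e)" for V W e
    unfolding C_def by (rule metric_along[where F = F, OF FS[OF that(1)] dF[OF that(1)] that(2,3)])
  have symC: "C x (E y) e = C y (E x) e" if "e \<in> T" for e x y
    unfolding C_def cov_along_def E_def dF_def
    using smooth_on_symmetric[OF M.open_S that F(2), of x y] sym_\<Gamma>[OF FS[OF that]] by metis
  define B where "B e x y = C x (E y) e - dF e (\<Gamma>0 e x y)" for e x y
  have Bsym: "B e x y = B e y x" if "e \<in> T" for e x y
    unfolding B_def using symC[OF that] M.sym_\<Gamma>[OF that] by metis
  note hdiff = linear_diff[OF h_linear(1)] linear_diff[OF h_linear(2)]
  \<comment> \<open>The derivative of the induced metric is computed twice, by compatibility of the
    ambient connection along F and by that of the intrinsic connection; B is their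
    difference.\<close>
  have Bskew: "h (F e) (B e x y) (dF e z) = - h (F e) (B e x z) (dF e y)" if "e \<in> T" for e x y z
  proof -
    have "frechet_derivative (\<lambda>e. h0 e y z) (at e) x
        = h (F e) (C x (E y) e) (E z e) + h (F e) (E y e) (C x (E z) e)"
      using fun_cong[OF frechet_derivative_at[OF met[OF that dE[OF that] dE[OF that]]], of x y z]
      unfolding h0_def E_def by simp
    then have "h (F e) (C x (E y) e) (dF e z) + h (F e) (dF e y) (C x (E z) e)
       = h (F e) (dF e (\<Gamma>0 e x y)) (dF e z) + h (F e) (dF e y) (dF e (\<Gamma>0 e x z))"
      using M.compat[OF that, of y z x] by (simp add: h0_def E_def)
    then show ?thesis
      unfolding B_def hdiff(2)[OF FS[OF that]] using sym_h[OF FS[OF that]] by (simp add: algebra_simps)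
  qed
  have B0: "h (F e) (B e x y) (dF e z) = 0" if "e \<in> T" for e x y z
    using Bskew[OF that, of x y z] Bskew[OF that, of y z x] Bskew[OF that, of z x y]
      Bsym[OF that, of x y] Bsym[OF that, of y z] Bsym[OF that, of z x] by simp
  have tan: "h (F e) (C y (E z) e) (E u e) = h0 e (\<Gamma>0 e y z) u" if "e \<in> T" for e y z u
    using B0[OF that, of y z u] unfolding B_def hdiff(2)[OF FS[OF that]] by (simp add: h0_def E_def)
  \<comment> \<open>Differentiating the orthogonality of N and \<open>E z\<close> moves the
    derivative from N onto \<open>E z\<close>, so the normal component of B is the second
    fundamental form.\<close>
  have BN: "h (F e) (B e y z) (N e) = b y z" for y z
  proof -
    have "((\<lambda>e. h (F e) (N e) (E z e)) has_derivative (\<lambda>_. 0)) (at e)"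
      by (rule has_derivative_transform_within_open[OF has_derivative_const M.open_S e])
        (simp add: N(2) E_def)
    from fun_cong[OF has_derivative_unique[OF met[OF e dN[OF e] dE[OF e]] this], of y]
    have "h (F e) (C y N e) (E z e) + h (F e) (N e) (C y (E z) e) = 0" .
    then show ?thesis
      unfolding B_def hdiff(2)[OF FS[OF e]] b_def
      using sym_h[OF FS[OF e]] N(2)[OF e] by (simp add: C_def E_def)
  qed
  \<comment> \<open>Because N has square -1, adding \<open>b x u\<close> times N makes B orthogonal
    to N, hence tangent, and B is orthogonal to tangent vectors. The minus sign of the equation of
    Gauss originates here.\<close>
  have BB: "h (F e) (B e y z) (B e x u) = - (b y z * b x u)" for x y z u
  proof -
    have "h (F e) (N e) (B e x u + b x u *\<^sub>R N e) = 0"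
      using BN[of x u] sym_h[OF FS[OF e]] NN
      by (simp add: linear_add[OF h_linear(1)[OF FS[OF e]]] linear_scale[OF h_linear(1)[OF FS[OF e]]])
    from tang[OF this] obtain w where w: "B e x u + b x u *\<^sub>R N e = dF e w" by auto
    then have "h (F e) (B e y z) (B e x u + b x u *\<^sub>R N e) = 0" using B0[OF e] by simp
    then show ?thesis
      using BN[of y z]
      by (simp add: linear_add[OF h_linear(1)[OF FS[OF e]]] linear_scale[OF h_linear(1)[OF FS[OF e]]] mult.commute)
  qed
  have CC: "h (F e) (C y (E z) e) (C x (E u) e) = h0 e (\<Gamma>0 e y z) (\<Gamma>0 e x u) - b y z * b x u" for x y z u
  proof -
    have eq: "C y (E z) e = B e y z + dF e (\<Gamma>0 e y z)" for y z by (simp add: B_def)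
    have "h (F e) (dF e w) (B e y z) = 0" for w y z using B0[OF e] sym_h[OF FS[OF e]] by metis
    then show ?thesis
      unfolding eq using B0[OF e] BB
      by (simp add: linear_add[OF h_linear(1)[OF FS[OF e]]] linear_add[OF h_linear(2)[OF FS[OF e]]] h0_def)
  qed
  \<comment> \<open>The relation \<open>tan\<close> is differentiated once more, on the ambient side
    and on the intrinsic side. The products of first derivatives differ by the term found in
    \<open>CC\<close>.\<close>
  have CCE: "h (F e) (C x (C y (E z)) e) (dF e u) = h0 e (C0 x (C0 y (\<lambda>_. z)) e) u + b y z * b x u" for x y z u
  proof -
    have G: "C0 y (\<lambda>_. z) = (\<lambda>e. \<Gamma>0 e y z)" for y z by (simp add: C0_def[abs_def] cov_along_def)
    have c: "cov_along \<Gamma>0 (\<lambda>x. x) e x (\<lambda>_. u) = \<Gamma>0 e x u" for x by (simp add: cov_along_def)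
    have 1: "((\<lambda>e. h0 e (\<Gamma>0 e y z) u) has_derivative
        (\<lambda>x. h0 e (C0 x (\<lambda>e. \<Gamma>0 e y z) e) u + h0 e (\<Gamma>0 e y z) (\<Gamma>0 e x u))) (at e)"
      using M.metric_along[where F = "\<lambda>x. x" and V = "\<lambda>e. \<Gamma>0 e y z" and W = "\<lambda>_. u" and e = e]
        smooth_on_differentiable[OF M.smooth_\<Gamma> e] e
      by (simp add: C0_def c)
    have 2: "((\<lambda>e. h0 e (\<Gamma>0 e y z) u) has_derivative
        (\<lambda>x. h (F e) (C x (C y (E z)) e) (E u e) + h (F e) (C y (E z) e) (C x (E u) e))) (at e)"
      by (rule has_derivative_transform_within_open[OF met[OF e dC[OF e] dE[OF e]] M.open_S e]) (rule tan)
    have "h0 e (C0 x (\<lambda>e. \<Gamma>0 e y z) e) u + h0 e (\<Gamma>0 e y z) (\<Gamma>0 e x u)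
      = h (F e) (C x (C y (E z)) e) (E u e) + h (F e) (C y (E z) e) (C x (E u) e)"
      by (rule fun_cong[OF has_derivative_unique[OF 1 2], of x])
    then show ?thesis unfolding CC by (simp add: G E_def)
  qed
  have K0: "coord_curvature \<Gamma>0 e x y z = C0 x (C0 y (\<lambda>_. z)) e - C0 y (C0 x (\<lambda>_. z)) e"
    using M.curvature_along[OF M.open_S e, of "\<lambda>x. x" "\<lambda>_. z" x y]
    by (simp add: C0_def[abs_def] smooth_on_ident smooth_on_const)
  \<comment> \<open>The field carried along F is \<open>E z\<close>, the image of the constant field
    z.\<close>
  have K: "coord_curvature \<Gamma> (F e) (dF e x) (dF e y) (dF e z) = C x (C y (E z)) e - C y (C x (E z)) e"
    using curvature_along[OF M.open_S e F smE, of x y z] by (simp add: C_def[abs_def] E_def dF_def)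
  have "h0 e (coord_curvature \<Gamma>0 e x y z) u
      = h0 e (C0 x (C0 y (\<lambda>_. z)) e) u - h0 e (C0 y (C0 x (\<lambda>_. z)) e) u"
    unfolding K0 by (rule linear_diff[OF M.h_linear(2)[OF e]])
  also have "\<dots> = h (F e) (C x (C y (E z)) e) (dF e u) - h (F e) (C y (C x (E z)) e) (dF e u)
      - (b y z * b x u - b x z * b y u)"
    unfolding CCE by simp
  also have "h (F e) (C x (C y (E z)) e) (dF e u) - h (F e) (C y (C x (E z)) e) (dF e u)
     = h (F e) (coord_curvature \<Gamma> (F e) (dF e x) (dF e y) (dF e z)) (dF e u)"
    unfolding K by (rule linear_diff[OF h_linear(2)[OF FS[OF e]], symmetric])
  finally show ?gauss .
  show "b y z = b z y" using BN[of y z] BN[of z y] Bsym[OF e, of y z] by simp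
qed

end

section \<open>Curvature tensors of Kaehler type\<close>

text \<open>A predicate on functions instead of polynomials, so that closure rules recognise any
  expression built from s by sums and products.\<close>

definition poly_function :: "(complex \<Rightarrow> complex) \<Rightarrow> bool" where
  "poly_function f \<longleftrightarrow> (\<exists>p. \<forall>s. f s = poly p s)"

lemma poly_function_intros:
  "poly_function (\<lambda>s. c)" "poly_function (\<lambda>s. s)"
  "poly_function f \<Longrightarrow> poly_function g \<Longrightarrow> poly_function (\<lambda>s. f s + g s)"
  "poly_function f \<Longrightarrow> poly_function g \<Longrightarrow> poly_function (\<lambda>s. f s - g s)"
  "poly_function f \<Longrightarrow> poly_function g \<Longrightarrow> poly_function (\<lambda>s. f s * g s)"
proof -
  show "poly_function (\<lambda>s. c)" unfolding poly_function_def by (rule exI[of _ "[:c:]"]) simp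
  show "poly_function (\<lambda>s. s)" unfolding poly_function_def by (rule exI[of _ "[:0, 1:]"]) simp
  show "poly_function f \<Longrightarrow> poly_function g \<Longrightarrow> poly_function (\<lambda>s. f s + g s)"
    unfolding poly_function_def by (metis poly_add)
  show "poly_function f \<Longrightarrow> poly_function g \<Longrightarrow> poly_function (\<lambda>s. f s - g s)"
    unfolding poly_function_def by (metis poly_diff)
  show "poly_function f \<Longrightarrow> poly_function g \<Longrightarrow> poly_function (\<lambda>s. f s * g s)"
    unfolding poly_function_def by (metis poly_mult)
qed

text \<open>Complex polynomials form an integral domain. Thus f vanishes also at the zeros of g, the
  points about which the product says nothing.\<close>

lemma poly_function_no_zero_divisors:
  assumes "poly_function f" "poly_function g" "\<And>s. f s * g s = 0" "g a \<noteq> 0"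
  shows "f s = 0"
proof -
  obtain p q where p: "\<And>s. f s = poly p s" and q: "\<And>s. g s = poly q s"
    using assms(1,2) unfolding poly_function_def by blast
  have "poly (p * q) = poly 0" using assms(3) p q by auto
  then have "p * q = 0" by (simp add: poly_eq_poly_eq_iff)
  moreover have "q \<noteq> 0" using assms(4) q by auto
  ultimately show ?thesis using p by simp
qed

section \<open>Norden spaces as complex quadratic spaces\<close>

locale norden_space =
  fixes g :: "'v::euclidean_space \<Rightarrow> 'v \<Rightarrow> real" and J :: "'v \<Rightarrow> 'v"
  assumes bilinear_g: "bilinear g" and sym_g: "g x y = g y x"
    and nondeg_g: "(\<And>y. g x y = 0) \<Longrightarrow> x = 0"
    and linear_J: "linear J" and JJ: "J (J x) = - x" and gJJ: "g (J x) (J y) = - g x y"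
begin

text \<open>The sign of the imaginary part makes \<open>G (J x) y\<close> equal to i times
  \<open>G x y\<close>, so that J acts as multiplication by i in both arguments.\<close>

definition G :: "'v \<Rightarrow> 'v \<Rightarrow> complex" where
  "G x y = Complex (g x y) (- g x (J y))"

definition cscale :: "complex \<Rightarrow> 'v \<Rightarrow> 'v" where
  "cscale c x = Re c *\<^sub>R x + Im c *\<^sub>R J x"

lemma g_linear: "linear (g x)" "linear (\<lambda>x. g x y)"
  using bilinear_g by (auto simp: bilinear_def)

lemmas g_simps = linear_add[OF g_linear(1)] linear_add[OF g_linear(2)] linear_scale[OF g_linear(1)]
  linear_scale[OF g_linear(2)] linear_diff[OF g_linear(1)] linear_diff[OF g_linear(2)]
  linear_neg[OF g_linear(1)] linear_neg[OF g_linear(2)] linear_0[OF g_linear(1)] linear_0[OF g_linear(2)]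

lemmas J_simps = linear_add[OF linear_J] linear_scale[OF linear_J] linear_diff[OF linear_J]
  linear_neg[OF linear_J] linear_0[OF linear_J] JJ

lemma gJ: "g (J x) y = g x (J y)"
  using gJJ[of x "J y"] by (simp add: JJ g_simps)

lemma G_sym: "G x y = G y x"
  using gJ[of x y] sym_g[of x y] sym_g[of "J x" y] by (simp add: G_def)

lemma G_add: "G (x + y) z = G x z + G y z" "G z (x + y) = G z x + G z y"
  by (auto simp: G_def g_simps J_simps complex_eq_iff)

lemma G_cscale: "G (cscale c x) y = c * G x y" "G x (cscale c y) = c * G x y"
proof -
  show 1: "G (cscale c x) y = c * G x y" for x y
    by (simp add: G_def cscale_def g_simps J_simps complex_eq_iff gJ)
  show "G x (cscale c y) = c * G x y" using 1[of y x] G_sym by metis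
qed

lemma G_nondegenerate:
  assumes "\<And>y. G x y = 0" shows "x = 0"
proof (rule nondeg_g)
  show "g x y = 0" for y using assms[of y] by (simp add: G_def complex_eq_iff)
qed

lemma G_nonzero_ex:
  assumes "u \<noteq> 0"
  shows "\<exists>v. G v v \<noteq> 0"
proof (rule ccontr)
  assume "\<not> ?thesis"
  then have z: "G v v = 0" for v by auto
  have "G x y = 0" for x y
    using z[of "x + y"] z[of x] z[of y] G_sym[of x y] by (simp add: G_add)
  then show False using G_nondegenerate assms by blast
qed

text \<open>P projects onto the G-orthogonal complement of v. If all \<open>G (P w) (P w)\<close>
  vanished, polarisation and nondegeneracy would give P = 0, and the space would be the complex line
  of v, of real dimension at most 2.\<close>

lemma nondegenerate_pair_ex:
  assumes "DIM('v) > 2"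
  obtains v w where "G v v \<noteq> 0" "G v v * G w w - G v w * G v w \<noteq> 0"
proof -
  obtain u :: 'v where "u \<noteq> 0" using nonempty_Basis nonzero_Basis by blast
  from G_nonzero_ex[OF this] obtain v where v: "G v v \<noteq> 0" by auto
  define P where "P x = x + cscale (- (G x v / G v v)) v" for x
  have Pv: "G (P x) v = 0" for x using v by (simp add: P_def G_add G_cscale)
  have "\<exists>w. G (P w) (P w) \<noteq> 0"
  proof (rule ccontr)
    assume "\<not> ?thesis"
    then have z: "G (P w) (P w) = 0" for w by auto
    \<comment> \<open>Vectors orthogonal to v are fixed by P, so the assumption \<open>z\<close>
      also applies to sums of projections, as polarisation requires.\<close>
    have PP: "P (P x + P y) = P x + P y" for x y
      unfolding P_def[of "P x + P y"] using Pv by (simp add: G_add cscale_def)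
    have "G (P x) (P y) = 0" for x y
      using z[of "P x + P y"] z[of x] z[of y] G_sym[of "P x" "P y"] unfolding PP by (simp add: G_add)
    then have "G (P x) y = 0" for x y
      using Pv[of x] G_add(2)[of "P x" "y" "cscale (- (G y v / G v v)) v"]
      by (metis G_cscale(2) P_def add.right_neutral mult_zero_right)
    then have P0: "P x = 0" for x using G_nondegenerate by blast
    have "x \<in> span {v, J v}" for x
    proof -
      have "x = - cscale (- (G x v / G v v)) v" using P0[of x] unfolding P_def by (simp add: eq_neg_iff_add_eq_0)
      then show ?thesis
        unfolding cscale_def by (metis insertCI span_add span_base span_neg span_scale)
    qed
    then have "span {v, J v} = UNIV" by auto
    then have "DIM('v) \<le> card {v, J v}" by (metis dim_UNIV dim_le_card' finite.emptyI finite.insertI dim_span)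
    also have "\<dots> \<le> 2" by (simp add: card_insert_le_m1)
    finally show False using assms by simp
  qed
  then obtain w where w: "G (P w) (P w) \<noteq> 0" by blast
  have "G v v * G (P w) (P w) - G v (P w) * G v (P w) \<noteq> 0"
    using v w Pv[of w] G_sym[of v "P w"] by simp
  then show ?thesis using that v by blast
qed

end

text \<open>The last axiom says that the curvature operator commutes with J, moved across the
  metric, for which J is self-adjoint. Linearity in the other three arguments follows from the
  symmetries.\<close>

locale kaehler_tensor = norden_space +
  fixes T :: "'a \<Rightarrow> 'a \<Rightarrow> 'a \<Rightarrow> 'a \<Rightarrow> real"
  assumes T_linear4: "linear (T x y z)"
    and T_skew12: "T x y z u = - T y x z u" and T_skew34: "T x y z u = - T x y u z"
    and T_bianchi: "T x y z u + T y z x u + T z x y u = 0"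
    and T_J34: "T x y (J z) u = T x y z (J u)"
begin

text \<open>The octahedron argument: in the four Bianchi identities, one for each argument kept
  last, the skew symmetries make the twelve terms equal in pairs up to sign.\<close>

lemma T_pair: "T x y z u = T z u x y"
proof -
  note b = T_bianchi
  have "T x y z u + T y z x u + T z x y u = 0" "T y z u x + T z u y x + T u y z x = 0"
    "T z u x y + T u x z y + T x z u y = 0" "T u x y z + T x y u z + T y u x z = 0"
    using b by blast+
  then show ?thesis
    using T_skew34[of y z x u] T_skew34[of z x y u] T_skew34[of z u y x] T_skew34[of u y z x]
      T_skew34[of u x z y] T_skew34[of x z u y] T_skew34[of x y u z] T_skew34[of y u x z]
      T_skew12[of x z y u] T_skew12[of u y x z]
      T_skew12[of z x y u] T_skew34[of x z y u] T_skew34[of u y x z] 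
    by (smt (verit) T_skew12 T_skew34)
qed

lemma T_linear: "linear (T x y z)" "linear (\<lambda>z. T x y z u)" "linear (\<lambda>y. T x y z u)" "linear (\<lambda>x. T x y z u)"
proof -
  show "linear (T x y z)" for x y z by (rule T_linear4)
  then show 3: "linear (\<lambda>z. T x y z u)" for x y u
    unfolding T_skew34[of x y _ u] by (rule linear_compose_neg)
  show "linear (\<lambda>y. T x y z u)" unfolding T_pair[of x _ z u] by (rule T_linear4)
  show "linear (\<lambda>x. T x y z u)" unfolding T_pair[of _ y z u] by (rule 3)
qed

lemmas T_add = linear_add[OF T_linear(1)] linear_add[OF T_linear(2)] linear_add[OF T_linear(3)] linear_add[OF T_linear(4)]
lemmas T_scale = linear_scale[OF T_linear(1)] linear_scale[OF T_linear(2)] linear_scale[OF T_linear(3)] linear_scale[OF T_linear(4)]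
lemmas T_neg = linear_neg[OF T_linear(1)] linear_neg[OF T_linear(2)] linear_neg[OF T_linear(3)] linear_neg[OF T_linear(4)]

lemma T_J12: "T (J x) y z u = T x (J y) z u"
  using T_J34 T_pair by metis

text \<open>\<open>\<Delta>\<close> changes sign under the cyclic permutation of its first three arguments, so it vanishes.\<close>

lemma T_J13: "T (J x) y z u = T x y (J z) u"
proof -
  define \<Delta> where "\<Delta> y z x u = T y z (J x) u - T (J y) z x u" for y z x u
  \<comment> \<open>The difference of two Bianchi identities, with J on the fourth and on the third
    argument; the term \<open>T x y (J z) u\<close> is common to both.\<close>
  have r: "\<Delta> y z x u = - \<Delta> z x y u" for x y z u
    using T_bianchi[of x y z "J u"] T_bianchi[of x y "J z" u]
    by (simp add: \<Delta>_def T_J34[symmetric] T_J12)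
  have "\<Delta> x y z u = 0" using r[of x y z u] r[of y z x u] r[of z x y u] by simp
  then show ?thesis by (simp add: \<Delta>_def)
qed

text \<open>The complexification of T, with the sign convention of G, hence complex linear in each
  argument.\<close>

definition TC :: "'a \<Rightarrow> 'a \<Rightarrow> 'a \<Rightarrow> 'a \<Rightarrow> complex" where
  "TC x y z u = Complex (T x y z u) (- T x y z (J u))"

lemma TC_add:
  "TC (x + x') y z u = TC x y z u + TC x' y z u" "TC x (y + y') z u = TC x y z u + TC x y' z u"
  "TC x y (z + z') u = TC x y z u + TC x y z' u" "TC x y z (u + u') = TC x y z u + TC x y z u'"
  by (simp_all add: TC_def T_add J_simps complex_eq_iff)

lemma TC_cscale:
  "TC (cscale c x) y z u = c * TC x y z u" "TC x (cscale c y) z u = c * TC x y z u"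
  "TC x y (cscale c z) u = c * TC x y z u" "TC x y z (cscale c u) = c * TC x y z u"
proof -
  have JJ2: "T (J x) y z u = T x y z (J u)" "T x (J y) z u = T x y z (J u)" for x y z u
    using T_J13 T_J34 T_J12 by metis+
  show "TC (cscale c x) y z u = c * TC x y z u" "TC x (cscale c y) z u = c * TC x y z u"
    "TC x y (cscale c z) u = c * TC x y z u" "TC x y z (cscale c u) = c * TC x y z u"
    by (simp_all add: TC_def cscale_def T_add T_scale T_neg linear_diff[OF T_linear(1)] J_simps complex_eq_iff JJ2 T_J34 algebra_simps)
qed

lemma TC_zero: "TC x x z u = 0" "TC x y z z = 0"
proof -
  have 1: "T x x z u = 0" for x z u using T_skew12[of x x z u] by simp
  have "T x y z (J z) = - T x y z (J z)" using T_J34[of x y z z] T_skew34[of x y z "J z"] by simp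
  then show "TC x x z u = 0" "TC x y z z = 0"
    using 1 T_skew34[of x y z z] by (simp_all add: TC_def complex_eq_iff)
qed

text \<open>Polarising in y and then in x makes T skew in its middle arguments too. Cyclic
  permutations of the first three arguments are even, so the three Bianchi terms coincide and 3 T =
  0.\<close>

lemma vanishes_if_sectional_vanishes:
  assumes z: "\<And>x y. T x y y x = 0"
  shows "T x y z u = 0"
proof -
  have 1: "T x y z x = 0" for x y z
    using z[of x "y + z"] z[of x y] z[of x z] T_pair[of x z y x] T_skew12[of y x x z] T_skew34[of x y x z]
    by (simp add: T_add)
  have 2: "T x y z u = - T x z y u" for x y z u
    using 1[of "x + u" y z] 1[of x y z] 1[of u y z] T_pair[of u y z x] T_skew12[of z x u y] T_skew34[of x z u y]
    by (simp add: T_add)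
  show ?thesis
    using T_bianchi[of x y z u] 2[of x y z u] 2[of y z x u] T_skew12[of x y z u] T_skew12[of x z y u] T_skew12[of y x z u] T_skew12[of z x y u]
    by linarith
qed

text \<open>With respect to the complex symmetric form \<open>G\<close>, a generic complex plane has an orthonormal
  basis, and such a basis spans a totally real section. The remaining planes are reached by
  polynomial continuation.\<close>

lemma vanishes_if_totally_real_vanishes:
  assumes dim: "DIM('a) > 2"
    and van: "\<And>x y. g x (J x) = 0 \<Longrightarrow> g x (J y) = 0 \<Longrightarrow> g y (J y) = 0 \<Longrightarrow> pi1 g x y y x \<noteq> 0 \<Longrightarrow>
      T x y y x = 0 \<and> T x y y (J x) = 0"
  shows "T x y z u = 0"
proof -
  have generic: "TC x y y x = 0" if x: "G x x \<noteq> 0" and d: "G x x * G y y - G x y * G x y \<noteq> 0" for x y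
  proof -
    \<comment> \<open>Gram-Schmidt for G. It preserves the Gram determinant, so
      \<open>G y' y'\<close> is that determinant divided by \<open>G x x\<close> and does not
      vanish.\<close>
    define y' where "y' = y + cscale (- (G x y / G x x)) x"
    have Gxy: "G x y' = 0" using x by (simp add: y'_def G_add G_cscale)
    have "G y' y' = G y' (y + cscale (- (G x y / G x x)) x)" by (simp only: y'_def)
    also have "\<dots> = G y' y" using Gxy G_sym[of x y'] by (simp only: G_add G_cscale) simp
    also have "\<dots> = (G x x * G y y - G x y * G x y) / G x x"
      using x by (simp add: y'_def G_add G_cscale field_simps)
    finally have Gyy: "G y' y' \<noteq> 0" using x d by simp
    \<comment> \<open>Complex square roots normalise both vectors to length 1. The values of G on X
      and Y are then real: the vanishing imaginary parts say that the real span is totally real, and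
      the real parts give \<open>pi1 g X Y Y X\<close> the value 1.\<close>
    define \<alpha> where "\<alpha> = 1 / csqrt (G x x)"
    define \<beta> where "\<beta> = 1 / csqrt (G y' y')"
    have \<alpha>: "\<alpha> * \<alpha> * G x x = 1" "\<alpha> \<noteq> 0"
      using x power2_csqrt[of "G x x"] by (auto simp: \<alpha>_def power2_eq_square field_simps)
    have \<beta>: "\<beta> * \<beta> * G y' y' = 1" "\<beta> \<noteq> 0"
      using Gyy power2_csqrt[of "G y' y'"] by (auto simp: \<beta>_def power2_eq_square field_simps)
    define X where "X = cscale \<alpha> x"
    define Y where "Y = cscale \<beta> y'"
    have "G X X = 1" "G Y Y = 1" "G X Y = 0"
      using \<alpha> \<beta> Gxy by (simp_all add: X_def Y_def G_cscale mult.assoc)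
    then have "g X (J X) = 0" "g X (J Y) = 0" "g Y (J Y) = 0" "pi1 g X Y Y X \<noteq> 0"
      using sym_g[of X Y] by (simp_all add: G_def complex_eq_iff pi1_def)
    then have "TC X Y Y X = 0" using van by (simp add: TC_def complex_eq_iff)
    \<comment> \<open>Normalising multiplied the value by the nonzero factor \<alpha>^2 \<beta>^2,
      and y' differs from y by a complex multiple of x, which \<open>TC\<close> ignores
      here.\<close>
    then have "TC x y' y' x = 0" using \<alpha> \<beta> by (simp add: X_def Y_def TC_cscale)
    then show ?thesis by (simp add: y'_def TC_add TC_cscale TC_zero)
  qed
  obtain v w where v: "G v v \<noteq> 0" and w: "G v v * G w w - G v w * G v w \<noteq> 0"
    using nondegenerate_pair_ex[OF dim] by blast
  have "TC x y y x = 0" for x y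
  proof -
    \<comment> \<open>A complex affine path from the given pair at s = 0 to the generic pair at s =
      1. The curvature along it is a polynomial in s, as is the product of the two genericity
      conditions, and \<open>generic\<close> says that the product of both polynomials is
      zero.\<close>
    define X where "X s = cscale (1 - s) x + cscale s v" for s
    define Y where "Y s = cscale (1 - s) y + cscale s w" for s
    have X01: "X 0 = x" "X 1 = v" "Y 0 = y" "Y 1 = w" by (simp_all add: X_def Y_def cscale_def)
    have "TC (X 0) (Y 0) (Y 0) (X 0) = 0"
    proof (rule poly_function_no_zero_divisors[where f = "\<lambda>s. TC (X s) (Y s) (Y s) (X s)" and a = 1])
      show "poly_function (\<lambda>s. TC (X s) (Y s) (Y s) (X s))"
        unfolding X_def Y_def TC_add TC_cscale by (intro poly_function_intros)
      show "poly_function (\<lambda>s. G (X s) (X s) * (G (X s) (X s) * G (Y s) (Y s) - G (X s) (Y s) * G (X s) (Y s)))"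
        unfolding X_def Y_def G_add G_cscale by (intro poly_function_intros)
      show "TC (X s) (Y s) (Y s) (X s) * (G (X s) (X s) * (G (X s) (X s) * G (Y s) (Y s) - G (X s) (Y s) * G (X s) (Y s))) = 0" for s
        using generic[of "X s" "Y s"] by auto
      show "G (X 1) (X 1) * (G (X 1) (X 1) * G (Y 1) (Y 1) - G (X 1) (Y 1) * G (X 1) (Y 1)) \<noteq> 0"
        using v w X01 by simp
    qed
    then show ?thesis using X01 by simp
  qed
  then have "T x y y x = 0" for x y by (simp add: TC_def complex_eq_iff)
  then show ?thesis by (rule vanishes_if_sectional_vanishes)
qed

text \<open>The right side is itself of Kaehler type. On a totally real plane \<open>pi2\<close> and
  \<open>pi3\<close> vanish at (x,y,y,x), while at (x,y,y,Jx) \<open>pi1\<close> and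
  \<open>pi2\<close> vanish and \<open>pi3\<close> takes the value \<open>pi1 g x y y x\<close>. So
  it has the prescribed curvatures, and D, the difference from T, satisfies the vanishing
  criterion.\<close>

theorem constant_totally_real_curvature_tensor:
  assumes dim: "DIM('a) > 2"
    and const: "\<And>x y. g x (J x) = 0 \<Longrightarrow> g x (J y) = 0 \<Longrightarrow> g y (J y) = 0 \<Longrightarrow> pi1 g x y y x \<noteq> 0 \<Longrightarrow>
      T x y y x = \<nu> * pi1 g x y y x \<and> T x y y (J x) = \<nu>t * pi1 g x y y x"
  shows "T x y z u = \<nu> * (pi1 g x y z u - pi2 g J x y z u) + \<nu>t * pi3 g J x y z u"
proof -
  define D where "D x y z u = T x y z u - (\<nu> * (pi1 g x y z u - pi2 g J x y z u) + \<nu>t * pi3 g J x y z u)" for x y z u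
  interpret D: kaehler_tensor g J D
  proof (rule kaehler_tensor.intro[OF norden_space_axioms kaehler_tensor_axioms.intro])
    fix x y z u
    have "linear (\<lambda>u. \<nu> * (pi1 g x y z u - pi2 g J x y z u) + \<nu>t * pi3 g J x y z u)"
      by (rule linearI) (simp_all add: pi1_def pi2_def pi3_def g_simps J_simps algebra_simps)
    then show "linear (D x y z)"
      unfolding D_def[abs_def] using T_linear4 by (intro linear_compose_sub)
    show "D x y z u = - D y x z u" using T_skew12[of x y z u]
      by (simp add: D_def pi1_def pi2_def pi3_def algebra_simps)
    show "D x y z u = - D x y u z" using T_skew34[of x y z u]
      by (simp add: D_def pi1_def pi2_def pi3_def algebra_simps)
    show "D x y z u + D y z x u + D z x y u = 0" using T_bianchi[of x y z u]
        sym_g[of x y] sym_g[of y z] sym_g[of z x] gJ[of x y] gJ[of y z] gJ[of z x] sym_g[of "J x" y] sym_g[of "J y" z] sym_g[of "J z" x]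
      by (simp add: D_def pi1_def pi2_def pi3_def algebra_simps)
    show "D x y (J z) u = D x y z (J u)" using T_J34[of x y z u]
      by (simp add: D_def pi1_def pi2_def pi3_def g_simps J_simps algebra_simps)
  qed
  have "D x y z u = 0"
  proof (rule D.vanishes_if_totally_real_vanishes[OF dim])
    fix x y assume a: "g x (J x) = 0" "g x (J y) = 0" "g y (J y) = 0" "pi1 g x y y x \<noteq> 0"
    have "g y (J x) = 0" using a(2) gJ[of x y] sym_g[of "J x" y] by simp
    then show "D x y y x = 0 \<and> D x y y (J x) = 0"
      using const[OF a] a by (auto simp: D_def pi1_def pi2_def pi3_def g_simps J_simps algebra_simps)
  qed
  then show ?thesis by (simp add: D_def)
qed

end

section \<open>Contractions\<close>

lemma trace_matrix: "trace (matrix L) = (\<Sum>i\<in>UNIV. L (axis i 1) $ i)"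
  by (simp add: trace_def matrix_def)

lemma trace_matrix_comp_commute:
  fixes f g :: "real ^ 'k \<Rightarrow> real ^ 'k"
  assumes "linear f" "linear g"
  shows "trace (matrix (f \<circ> g)) = trace (matrix (g \<circ> f))"
  unfolding matrix_compose[OF assms(1,2)] matrix_compose[OF assms(2,1)] by (rule trace_mul_sym)

lemma vec_axis_expansion: "(\<Sum>i\<in>UNIV. x $ i *\<^sub>R axis i 1) = (x :: real ^ 'k)"
  using basis_expansion[of x] by (simp add: scalar_mult_eq_scaleR)

lemma linear_axis_expansion:
  fixes x :: "real ^ 'k"
  assumes "linear L"
  shows "(\<Sum>i\<in>UNIV. x $ i *\<^sub>R L (axis i 1)) = L x"
proof -
  have "L x = L (\<Sum>i\<in>UNIV. x $ i *\<^sub>R axis i 1)" by (simp only: vec_axis_expansion)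
  then show ?thesis by (simp only: linear_sum[OF assms] linear_scale[OF assms])
qed

lemma trace_matrix_rank_one:
  fixes \<eta> :: "real ^ 'k \<Rightarrow> real"
  assumes "linear \<eta>"
  shows "trace (matrix (\<lambda>x. \<eta> x *\<^sub>R \<xi>)) = \<eta> \<xi>"
  using linear_axis_expansion[OF assms, of \<xi>] by (simp add: trace_matrix mult.commute)

lemma trace_matrix_uminus: "trace (matrix (\<lambda>x. - L x :: real ^ 'k)) = - trace (matrix L)"
  by (simp add: trace_matrix sum_negf)

lemma trace_matrix_add: "trace (matrix (\<lambda>x. L x + K x :: real ^ 'k)) = trace (matrix L) + trace (matrix K)"
  by (simp add: trace_matrix sum.distrib)

lemma trace_matrix_ident: "trace (matrix (\<lambda>x. x :: real ^ 'k)) = real CARD('k)"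
  by (simp add: trace_matrix)

text \<open>The trace of \<open>\<phi>\<close> vanishes because \<open>\<phi>\<close> is skew with respect to the inner product
  \<open>\<eta> x * \<eta> y + \<phi> x \<bullet> \<phi> y + \<phi>\<^sup>2 x \<bullet> \<phi>\<^sup>2 y\<close>, represented by the operator \<open>S\<close> below.\<close>

lemma trace_almost_contact:
  fixes \<phi> :: "real ^ 'k \<Rightarrow> real ^ 'k"
  assumes lin: "linear \<phi>" "linear \<eta>"
    and \<phi>\<phi>: "\<And>x. \<phi> (\<phi> x) = - x + \<eta> x *\<^sub>R \<xi>" and \<phi>\<xi>: "\<phi> \<xi> = 0" and \<eta>\<phi>: "\<And>x. \<eta> (\<phi> x) = (0::real)"
  shows "trace (matrix \<phi>) = 0"
proof -
  let ?\<phi>2 = "\<lambda>x. \<phi> (\<phi> x)"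
  have lin2: "linear ?\<phi>2" using linear_compose[OF lin(1) lin(1)] by (simp add: o_def)
  \<comment> \<open>\<open>adjoint \<eta> 1\<close> is the vector that represents the functional
    \<eta> in the Euclidean inner product.\<close>
  define S where "S y = \<eta> y *\<^sub>R adjoint \<eta> 1 + adjoint \<phi> (\<phi> y) + adjoint ?\<phi>2 (?\<phi>2 y)" for y
  have linS: "linear S"
    by (rule linearI)
      (simp_all add: S_def linear_add[OF lin(1)] linear_add[OF lin(2)] linear_scale[OF lin(1)] linear_scale[OF lin(2)]
        linear_add[OF adjoint_linear[OF lin(1)]] linear_add[OF adjoint_linear[OF lin2]]
        linear_scale[OF adjoint_linear[OF lin(1)]] linear_scale[OF adjoint_linear[OF lin2]] algebra_simps)
  have S: "x \<bullet> S y = \<eta> x * \<eta> y + \<phi> x \<bullet> \<phi> y + ?\<phi>2 x \<bullet> ?\<phi>2 y" for x y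
    using adjoint_works[OF lin(2), of x 1] adjoint_works[OF lin(1)] adjoint_works[OF lin2]
    by (simp add: S_def inner_add_right)
  \<comment> \<open>The form is definite: if \<eta> y and \<phi>^2 y both vanish, the almost contact
    identity gives y = 0.\<close>
  have "inj S"
  proof (rule linear_injective_0[OF linS, THEN iffD2], intro allI impI)
    fix y assume "S y = 0"
    then have "\<eta> y * \<eta> y + \<phi> y \<bullet> \<phi> y + ?\<phi>2 y \<bullet> ?\<phi>2 y = 0" using S[of y y] by simp
    then have "\<eta> y * \<eta> y = 0" "?\<phi>2 y \<bullet> ?\<phi>2 y = 0"
      by (smt (verit) inner_ge_zero zero_le_square)+
    then show "y = 0" using \<phi>\<phi>[of y] by simp
  qed
  then obtain S' where S': "linear S'" "\<And>x. S' (S x) = x" "\<And>x. S (S' x) = x"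
    using linear_injective_isomorphism[OF linS] by blast
  have \<phi>3: "\<phi> (\<phi> (\<phi> x)) = - \<phi> x" for x using \<phi>\<phi>[of "\<phi> x"] \<eta>\<phi> by simp
  \<comment> \<open>In the inner product of x with \<phi> y the \<eta>-term drops out, and \<phi>^3
    = -\<phi> makes the other two antisymmetric in x and y.\<close>
  have skew: "S (\<phi> y) = - adjoint \<phi> (S y)" for y
  proof -
    have "x \<bullet> (S (\<phi> y) + adjoint \<phi> (S y)) = 0" for x
      by (simp add: inner_add_right adjoint_works[OF lin(1)] S \<eta>\<phi> \<phi>3)
    then have "S (\<phi> y) + adjoint \<phi> (S y) = 0" using inner_eq_zero_iff by blast
    then show ?thesis by (simp add: eq_neg_iff_add_eq_0)
  qed
  have l: "linear (adjoint \<phi>)" "linear (\<lambda>y. - adjoint \<phi> (S y))"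
    using adjoint_linear[OF lin(1)] linear_compose_neg[OF linear_compose[OF linS, of "adjoint \<phi>", unfolded o_def]] by auto
  \<comment> \<open>Hence \<phi> is conjugate to minus its transpose, and its trace equals its own
    negative.\<close>
  have "\<phi> = S' \<circ> (\<lambda>y. - adjoint \<phi> (S y))" using skew S'(2) by (auto simp: fun_eq_iff simp flip: skew)
  then have "trace (matrix \<phi>) = trace (matrix ((\<lambda>y. - adjoint \<phi> (S y)) \<circ> S'))"
    using trace_matrix_comp_commute[OF S'(1) l(2)] by simp
  also have "\<dots> = trace (matrix (\<lambda>y. - adjoint \<phi> y))" using S'(3) by (simp add: o_def)
  also have "\<dots> = - trace (matrix \<phi>)"
    unfolding trace_matrix_uminus matrix_adjoint[OF lin(1)] by (simp add: trace_def transpose_def)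
  finally show ?thesis by simp
qed

text \<open>With P and Q among the identity, \<phi>, \<eta> tensor \<xi> and A, these span every
  tensor in the curvature formula, so a single contraction rule covers all of them.\<close>

definition curvature_product ::
  "('v \<Rightarrow> 'v \<Rightarrow> real) \<Rightarrow> ('v \<Rightarrow> 'v) \<Rightarrow> ('v \<Rightarrow> 'v) \<Rightarrow> 'v \<Rightarrow> 'v \<Rightarrow> 'v \<Rightarrow> 'v \<Rightarrow> real" where
  "curvature_product g P Q x y z u = g y (P z) * g x (Q u) - g x (P z) * g y (Q u)"

lemma scalar_contraction_linear:
  "scalar_contraction B ginv (\<lambda>x y z u. T x y z u + T' x y z u) =
     scalar_contraction B ginv T + scalar_contraction B ginv T'"
  "scalar_contraction B ginv (\<lambda>x y z u. T x y z u - T' x y z u) =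
     scalar_contraction B ginv T - scalar_contraction B ginv T'"
  "scalar_contraction B ginv (\<lambda>x y z u. r * T x y z u) = r * scalar_contraction B ginv T"
  by (simp_all only: scalar_contraction_def sum.distrib sum_subtractf distrib_left right_diff_distrib)
    (simp add: sum_distrib_left mult.left_commute)

section \<open>Contraction against a basis and its dual\<close>

context
  fixes g :: "real ^ 'k \<Rightarrow> real ^ 'k \<Rightarrow> real" and B :: "(real ^ 'k) set" and ginv :: "real ^ 'k \<Rightarrow> real ^ 'k \<Rightarrow> real"
  assumes bil: "bilinear g" and sym: "\<And>x y. g x y = g y x" and B: "basis_with_inverse_metric g B ginv"
begin

definition dual_basis :: "real ^ 'k \<Rightarrow> real ^ 'k" where "dual_basis a = (\<Sum>b\<in>B. ginv a b *\<^sub>R b)"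

lemma finite_basis: "finite B"
  using B by (intro independent_imp_finite) (simp add: basis_with_inverse_metric_def)

lemma dual_basis_apply: "g (dual_basis a) x = (\<Sum>b\<in>B. ginv a b * g b x)"
proof -
  have "linear (\<lambda>y. g y x)" using bil by (simp add: bilinear_def)
  then show ?thesis by (simp add: dual_basis_def linear_sum[OF \<open>linear _\<close>] linear_scale[OF \<open>linear _\<close>])
qed

lemma dual_basis_basis: "a \<in> B \<Longrightarrow> c \<in> B \<Longrightarrow> g (dual_basis a) c = (if a = c then 1 else 0)"
  using B by (simp add: dual_basis_apply basis_with_inverse_metric_def)

lemma dual_basis_expansion: "(\<Sum>a\<in>B. g (dual_basis a) x *\<^sub>R a) = x"
proof -
  have lg: "linear (g z)" for z using bil by (simp add: bilinear_def)
  have l: "linear (\<lambda>x. \<Sum>a\<in>B. g (dual_basis a) x *\<^sub>R a)"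
    by (rule linearI) (simp_all add: linear_add[OF lg] linear_scale[OF lg] algebra_simps sum.distrib scaleR_sum_right)
  have "x \<in> span B" using B by (simp add: basis_with_inverse_metric_def)
  then show ?thesis
  proof (rule linear_eq_on_span[OF l linear_ident, rotated])
    fix c assume c: "c \<in> B"
    have "(\<Sum>a\<in>B. g (dual_basis a) c *\<^sub>R a) = (\<Sum>a\<in>B. if a = c then a else 0)"
      by (rule sum.cong) (use c dual_basis_basis in auto)
    then show "(\<Sum>a\<in>B. g (dual_basis a) c *\<^sub>R a) = c" using c finite_basis by simp
  qed
qed

text \<open>The hypothesis provides a one-sided inverse of the Gram matrix. Its entries are the
  values of g on dual basis vectors, so they inherit the symmetry of g.\<close>

lemma ginv_sym: assumes "a \<in> B" "c \<in> B" shows "ginv a c = ginv c a"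
proof -
  have d: "g (dual_basis a) (dual_basis c) = ginv a c" if "a \<in> B" "c \<in> B" for a c
  proof -
    have "g (dual_basis a) (dual_basis c) = (\<Sum>b\<in>B. ginv a b * (if b = c then 1 else 0))"
      unfolding dual_basis_apply[of a]
      by (intro sum.cong refl arg_cong[where f = "(*) _"], subst sym) (use dual_basis_basis[OF that(2)] in auto)
    also have "\<dots> = (\<Sum>b\<in>B. if b = c then ginv a b else 0)" by (intro sum.cong) auto
    also have "\<dots> = ginv a c" using that finite_basis by simp
    finally show ?thesis .
  qed
  show ?thesis using d assms sym by metis
qed

lemma dual_basis_apply': "c \<in> B \<Longrightarrow> g (dual_basis c) x = (\<Sum>b\<in>B. ginv b c * g b x)"
  unfolding dual_basis_apply by (intro sum.cong refl arg_cong2[where f = "(*)"] ginv_sym)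

lemma trace_dual_basis:
  assumes "linear L"
  shows "trace (matrix L) = (\<Sum>a\<in>B. g (dual_basis a) (L a))"
proof -
  have lg: "linear (g z)" for z using bil by (simp add: bilinear_def)
  have "trace (matrix L) = (\<Sum>i\<in>UNIV. L (\<Sum>a\<in>B. g (dual_basis a) (axis i 1) *\<^sub>R a) $ i)"
    by (simp add: trace_matrix dual_basis_expansion)
  also have "\<dots> = (\<Sum>i\<in>UNIV. \<Sum>a\<in>B. g (dual_basis a) (axis i 1) * L a $ i)"
    by (simp add: linear_sum[OF assms] linear_scale[OF assms])
  also have "\<dots> = (\<Sum>a\<in>B. \<Sum>i\<in>UNIV. L a $ i *\<^sub>R g (dual_basis a) (axis i 1))"
    by (subst sum.swap) (simp add: mult.commute)
  also have "\<dots> = (\<Sum>a\<in>B. g (dual_basis a) (L a))" using linear_axis_expansion[OF lg] by simp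
  finally show ?thesis .
qed

text \<open>In the first summand the index pairs (b,c) and (a,d) separate, giving a product of
  traces. In the second they are chained through P and Q, giving the trace of the
  composition.\<close>

lemma scalar_contraction_product:
  assumes P: "linear P" and Q: "linear Q"
  shows "scalar_contraction B ginv (curvature_product g P Q)
    = trace (matrix P) * trace (matrix Q) - trace (matrix (Q \<circ> P))"
proof -
  have lg: "linear (g z)" for z using bil by (simp add: bilinear_def)
  have "scalar_contraction B ginv (\<lambda>x y z u. g y (P z) * g x (Q u))
     = (\<Sum>a\<in>B. \<Sum>b\<in>B. \<Sum>c\<in>B. \<Sum>d\<in>B. (ginv b c * g b (P c)) * (ginv a d * g a (Q d)))"
    by (simp add: scalar_contraction_def algebra_simps)
  also have "\<dots> = (\<Sum>b\<in>B. \<Sum>c\<in>B. ginv b c * g b (P c)) * (\<Sum>a\<in>B. \<Sum>d\<in>B. ginv a d * g a (Q d))"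
    by (simp add: sum_distrib_left sum_distrib_right mult.commute)
  also have "\<dots> = trace (matrix P) * trace (matrix Q)"
    unfolding trace_dual_basis[OF P] trace_dual_basis[OF Q]
    by (subst (1 2) sum.swap) (simp add: dual_basis_apply')
  finally have 1: "scalar_contraction B ginv (\<lambda>x y z u. g y (P z) * g x (Q u)) = trace (matrix P) * trace (matrix Q)" .
  have "scalar_contraction B ginv (\<lambda>x y z u. g x (P z) * g y (Q u))
     = (\<Sum>a\<in>B. \<Sum>b\<in>B. \<Sum>c\<in>B. \<Sum>d\<in>B. (ginv a d * g a (P c)) * (ginv b c * g b (Q d)))"
    by (simp add: scalar_contraction_def algebra_simps)
  \<comment> \<open>With c and d outermost the sums over a and b factor, each becoming a pairing
    with a dual basis vector.\<close>
  also have "\<dots> = (\<Sum>c\<in>B. \<Sum>d\<in>B. \<Sum>a\<in>B. \<Sum>b\<in>B. (ginv a d * g a (P c)) * (ginv b c * g b (Q d)))"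
    by (subst (2) sum.swap, subst sum.swap, rule sum.cong[OF refl], subst (2) sum.swap, subst sum.swap) simp
  also have "\<dots> = (\<Sum>c\<in>B. \<Sum>d\<in>B. g (dual_basis d) (P c) * g (dual_basis c) (Q d))"
    by (intro sum.cong refl) (simp add: dual_basis_apply' sum_distrib_left sum_distrib_right mult.commute)
  also have "\<dots> = (\<Sum>c\<in>B. g (dual_basis c) (Q (\<Sum>d\<in>B. g (dual_basis d) (P c) *\<^sub>R d)))"
    by (simp add: linear_sum[OF Q] linear_scale[OF Q] linear_sum[OF lg] linear_scale[OF lg])
  also have "\<dots> = trace (matrix (Q \<circ> P))"
    using trace_dual_basis[OF linear_compose[OF P Q]] by (simp add: dual_basis_expansion)
  finally show ?thesis
    using 1 unfolding curvature_product_def[abs_def] scalar_contraction_linear by simp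
qed

end


text \<open>Linear algebra in one tangent space: the geometry enters only through the algebraic
  relations listed as hypotheses.\<close>

theorem hypersurface_curvature_consequences:
  fixes g :: "real ^ 'k \<Rightarrow> real ^ 'k \<Rightarrow> real" and \<phi> A :: "real ^ 'k \<Rightarrow> real ^ 'k"
  assumes card: "CARD('k) = 2 * n + 1"
    and bil: "bilinear g" and sym: "\<And>x y. g x y = g y x"
    and lin: "linear \<phi>" "linear \<eta>" "linear A"
    and \<phi>\<phi>: "\<And>x. \<phi> (\<phi> x) = - x + \<eta> x *\<^sub>R \<xi>" and \<phi>\<xi>: "\<phi> \<xi> = 0"
    and \<eta>\<phi>: "\<And>x. \<eta> (\<phi> x) = 0" and \<eta>\<xi>: "\<eta> \<xi> = 1"
    and g\<phi>: "\<And>x y. g (\<phi> x) y = g x (\<phi> y)" and g\<xi>: "\<And>x. g x \<xi> = \<eta> x"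
    and gA: "\<And>x y. g (A x) y = g x (A y)"
    and R: "\<And>x y z u. R x y z u =
        \<nu> * (pi1 g x y z u - pi2 g \<phi> x y z u - tan t * pi5 g \<phi> \<eta> x y z u)
        + \<nu>t * (pi3 g \<phi> x y z u - tan t * pi4 g \<eta> x y z u)
        - pi1 g (A x) (A y) z u"
  shows "basis_with_inverse_metric g B ginv \<Longrightarrow> scalar_contraction B ginv R =
      4 * (real n)\<^sup>2 * \<nu> - 4 * real n * \<nu>t * tan t - (trace (matrix A))\<^sup>2 + trace (matrix (A \<circ> A))" (is "_ \<Longrightarrow> ?tau")
    and "basis_with_inverse_metric g B ginv \<Longrightarrow> scalar_contraction B ginv (associated \<phi> R) =
      2 * real n * \<nu> * tan t + 2 * real n * (2 * real n - 1) * \<nu>t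
      - trace (matrix A) * trace (matrix (A \<circ> \<phi>)) + trace (matrix (A \<circ> A \<circ> \<phi>))" (is "_ \<Longrightarrow> ?taut")
    and "nondegenerate_basis g \<xi> x \<Longrightarrow> sectional_curvature g R \<xi> x =
      \<nu> - \<nu>t * tan t - (\<nu> * tan t + \<nu>t) * (g x (\<phi> x) / (g x x - (\<eta> x)\<^sup>2))
      - pi1 g (A \<xi>) (A x) x \<xi> / (g x x - (\<eta> x)\<^sup>2)" (is "_ \<Longrightarrow> ?xi")
    and "sectional_curvature g R (\<phi> x) (\<phi> (\<phi> x)) =
      - (pi1 g (A (\<phi> x)) (A (\<phi> (\<phi> x))) (\<phi> (\<phi> x)) (\<phi> x) / pi1 g (\<phi> x) (\<phi> (\<phi> x)) (\<phi> (\<phi> x)) (\<phi> x))" (is ?hol)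
    and "nondegenerate_basis g x y \<Longrightarrow> totally_real_section g \<phi> (span {x, y}) \<Longrightarrow> perp g (span {x, y}) {\<xi>} \<Longrightarrow>
      sectional_curvature g R x y = \<nu> - pi1 g (A x) (A y) y x / pi1 g x y y x" (is "_ \<Longrightarrow> _ \<Longrightarrow> _ \<Longrightarrow> ?treal")
proof -
  let ?c = "curvature_product g"
  let ?I = "\<lambda>x::real ^ 'k. x" and ?H = "\<lambda>x. \<eta> x *\<^sub>R \<xi>"
  have lg: "linear (g z)" "linear (\<lambda>x. g x z)" for z using bil by (auto simp: bilinear_def)
  note g_simps = linear_add[OF lg(1)] linear_add[OF lg(2)] linear_scale[OF lg(1)] linear_scale[OF lg(2)]
    linear_neg[OF lg(1)] linear_neg[OF lg(2)] linear_0[OF lg(1)] linear_0[OF lg(2)]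
  \<comment> \<open>Products of \<eta> become metric values, \<eta> y \<eta> z = g(y, \<eta>(z)
    \<xi>), and self-adjointness moves A to the other argument; every term is then a
    \<open>curvature_product\<close>.\<close>
  have R': "R x y z u = \<nu> * (?c ?I ?I x y z u - ?c \<phi> \<phi> x y z u - tan t * (?c ?H \<phi> x y z u + ?c \<phi> ?H x y z u))
      - \<nu>t * (?c ?I \<phi> x y z u + ?c \<phi> ?I x y z u + tan t * (?c ?H ?I x y z u + ?c ?I ?H x y z u))
      - ?c A A x y z u" for x y z u
    unfolding R pi1_def pi2_def pi3_def pi4_def pi5_def curvature_product_def
    by (simp add: g_simps g\<xi> gA algebra_simps)
  have lH: "linear ?H" by (rule linearI) (simp_all add: linear_add[OF lin(2)] linear_scale[OF lin(2)] algebra_simps)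
  have l2: "linear (\<lambda>x. \<phi> (\<phi> x))" "linear (\<lambda>x. A (\<phi> x))"
    using linear_compose[OF lin(1) lin(1)] linear_compose[OF lin(1) lin(3)] by (simp_all add: o_def)
  have \<phi>3: "\<phi> (\<phi> (\<phi> x)) = - \<phi> x" for x using \<phi>\<phi>[of "\<phi> x"] \<eta>\<phi> by simp
  have tr\<phi>: "trace (matrix \<phi>) = 0" by (rule trace_almost_contact[OF lin(1,2) \<phi>\<phi> \<phi>\<xi> \<eta>\<phi>])
  have trH: "trace (matrix ?H) = 1" using trace_matrix_rank_one[OF lin(2), of \<xi>] \<eta>\<xi> by simp
  have trI: "trace (matrix ?I) = 2 * real n + 1" using card by (simp add: trace_matrix_ident)
  have tr2: "trace (matrix (\<lambda>x. \<phi> (\<phi> x))) = - 2 * real n"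
    unfolding \<phi>\<phi> trace_matrix_add trace_matrix_uminus trI trH by simp
  have tr0: "trace (matrix (\<lambda>x. 0 :: real ^ 'k)) = 0" by (simp add: trace_matrix)
  have trm: "trace (matrix (\<lambda>x. - \<phi> x)) = 0" using tr\<phi> by (simp add: trace_matrix_uminus)
  have \<phi>scale: "\<phi> (c *\<^sub>R \<xi>) = 0" for c using linear_scale[OF lin(1)] \<phi>\<xi> by simp
  note tr = tr\<phi> trH trI tr2 tr0 trm
  \<comment> \<open>The contraction of the A-term in \<open>associated \<phi> R\<close> yields the
    trace of A \<phi> A; cyclicity brings it to the stated form.\<close>
  have trA\<phi>A: "trace (matrix (\<lambda>x. A (\<phi> (A x)))) = trace (matrix (A \<circ> A \<circ> \<phi>))"
    using trace_matrix_comp_commute[OF lin(3) l2(2)] by (simp add: o_def)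
  {
    assume B: "basis_with_inverse_metric g B ginv"
    note con = scalar_contraction_product[OF bil sym B]
    \<comment> \<open>\<open>pi1\<close> contracts to (2n+1)^2 - (2n+1) and \<open>pi2\<close> to
      2n, with difference 4n^2; \<open>pi4\<close> contracts to 4n, \<open>pi3\<close> and
      \<open>pi5\<close> to 0.\<close>
    show ?tau
      unfolding R'[abs_def] scalar_contraction_linear
        con[OF linear_ident linear_ident] con[OF lin(1) lin(1)] con[OF lH lin(1)] con[OF lin(1) lH]
        con[OF linear_ident lin(1)] con[OF lin(1) linear_ident] con[OF lH linear_ident] con[OF linear_ident lH]
        con[OF lin(3) lin(3)]
      by (simp add: o_def tr \<phi>scale \<eta>\<phi> power2_eq_square algebra_simps)
    \<comment> \<open>Composing the last argument with \<phi> kills the products that have \<eta>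
      there. Of the rest, the pair \<open>?H\<close>, \<phi>^2 contracts to -2n, the pair identity,
      \<phi>^2 to -4n^2, and the pair \<phi>, \<phi> to 2n.\<close>
    have R'': "associated \<phi> R x y z u =
      \<nu> * (?c ?I \<phi> x y z u - ?c \<phi> (\<lambda>x. \<phi> (\<phi> x)) x y z u - tan t * ?c ?H (\<lambda>x. \<phi> (\<phi> x)) x y z u)
      - \<nu>t * (?c ?I (\<lambda>x. \<phi> (\<phi> x)) x y z u + ?c \<phi> \<phi> x y z u + tan t * ?c ?H \<phi> x y z u)
      - ?c A (\<lambda>x. A (\<phi> x)) x y z u" for x y z u
      unfolding associated_def R' by (simp add: curvature_product_def \<eta>\<phi> g_simps)
    show ?taut
      unfolding R''[abs_def] scalar_contraction_linear
        con[OF linear_ident lin(1)] con[OF lin(1) l2(1)] con[OF lH l2(1)] con[OF linear_ident l2(1)]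
        con[OF lin(1) lin(1)] con[OF lH lin(1)] con[OF lin(3) l2(2)]
      using trA\<phi>A by (simp add: o_def tr \<phi>3 \<phi>scale \<eta>\<phi> power2_eq_square algebra_simps linear_0[OF lin(1)])
  }
  have g\<xi>': "g \<xi> x = \<eta> x" for x using g\<xi> sym by metis
  {
    assume "nondegenerate_basis g \<xi> x"
    then have nz: "g x x - (\<eta> x)\<^sup>2 \<noteq> 0"
      by (simp add: nondegenerate_basis_def pi1_def g\<xi> g\<xi>' \<eta>\<xi> power2_eq_square)
    have "R \<xi> x x \<xi> = (\<nu> - \<nu>t * tan t) * (g x x - (\<eta> x)\<^sup>2) - (\<nu> * tan t + \<nu>t) * g x (\<phi> x) - pi1 g (A \<xi>) (A x) x \<xi>"
      unfolding R pi2_def pi3_def pi4_def pi5_def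
      by (simp add: pi1_def[of g \<xi>] g\<xi> g\<xi>' \<eta>\<xi> \<phi>\<xi> \<eta>\<phi> g_simps power2_eq_square algebra_simps)
    moreover have "pi1 g \<xi> x x \<xi> = g x x - (\<eta> x)\<^sup>2"
      by (simp add: pi1_def g\<xi> g\<xi>' \<eta>\<xi> power2_eq_square)
    ultimately show ?xi
      using nz by (simp add: sectional_curvature_def diff_divide_distrib)
  }
  show ?hol
  proof -
    define a where "a = \<phi> x"
    define b where "b = \<phi> a"
    have \<eta>ab: "\<eta> a = 0" "\<eta> b = 0" by (simp_all add: a_def b_def \<eta>\<phi>)
    have \<phi>a: "\<phi> a = b" and \<phi>b: "\<phi> b = - a" using \<phi>\<phi>[of a] \<eta>ab by (simp_all add: b_def)
    \<comment> \<open>This relation makes \<open>pi1\<close> and \<open>pi2\<close> equal and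
      \<open>pi3\<close> zero on (a,b,b,a). As \<eta> vanishes on a and b, only the A-term
      survives.\<close>
    have bb: "g b b = - g a a" using g\<phi>[of a b] by (simp add: \<phi>a \<phi>b g_simps)
    have "R a b b a = - pi1 g (A a) (A b) b a"
      unfolding R pi2_def pi3_def pi4_def pi5_def
      by (simp add: pi1_def[of g a] \<phi>a \<phi>b \<eta>ab g_simps bb sym[of b a] algebra_simps)
    then show ?thesis by (simp add: sectional_curvature_def a_def b_def)
  qed
  {
    assume nd: "nondegenerate_basis g x y" and tr: "totally_real_section g \<phi> (span {x, y})"
      and p: "perp g (span {x, y}) {\<xi>}"
    have s: "x \<in> span {x, y}" "y \<in> span {x, y}" by (auto intro: span_base)
    have z: "g x (\<phi> x) = 0" "g x (\<phi> y) = 0" "g y (\<phi> x) = 0" "g y (\<phi> y) = 0" "\<eta> x = 0" "\<eta> y = 0"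
      using tr p s g\<xi> by (auto simp: totally_real_section_def perp_def)
    have "R x y y x = \<nu> * pi1 g x y y x - pi1 g (A x) (A y) y x"
      unfolding R pi2_def pi3_def pi4_def pi5_def by (simp add: z)
    then show ?treal using nd by (simp add: sectional_curvature_def nondegenerate_basis_def diff_divide_distrib)
  }
qed

section \<open>Charts and coordinate fields\<close>

abbreviation transition_deriv ::
  "('a, 'e::euclidean_space) chart \<Rightarrow> ('a, 'e) chart \<Rightarrow> 'a \<Rightarrow> 'e \<Rightarrow> 'e" where
  "transition_deriv c d q \<equiv> frechet_derivative (snd d \<circ> chart_inv c) (at (snd c q))"

definition field_rep ::
  "('a, 'e::euclidean_space) manifold \<Rightarrow> ('a, 'e) chart \<Rightarrow> ('a \<Rightarrow> 'e) \<Rightarrow> 'e \<Rightarrow> 'e" where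
  "field_rep M c Y e = tcoord M c (chart_inv c e) (Y (chart_inv c e))"

locale smooth_mfd =
  fixes M :: "('a, 'e::euclidean_space) manifold"
  assumes smooth_manifold: "smooth_manifold M"
begin

lemma chart_openin: "c \<in> atlas M \<Longrightarrow> openin (mtop M) (fst c)"
  using smooth_manifold by (auto simp: smooth_manifold_def)

lemma chart_homeo: "c \<in> atlas M \<Longrightarrow>
    homeomorphic_map (subtopology (mtop M) (fst c)) (top_of_set (snd c ` fst c)) (snd c)"
  using smooth_manifold by (auto simp: smooth_manifold_def)

lemma chart_subset: "c \<in> atlas M \<Longrightarrow> fst c \<subseteq> topspace (mtop M)"
  using chart_openin openin_subset by blast

lemma chart_inj: "c \<in> atlas M \<Longrightarrow> inj_on (snd c) (fst c)"
  using homeomorphic_imp_injective_map[OF chart_homeo[of c]] chart_subset[of c]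
  by (simp add: topspace_subtopology_subset Int_absorb1)

lemma chart_inv_left [simp]: "c \<in> atlas M \<Longrightarrow> q \<in> fst c \<Longrightarrow> chart_inv c (snd c q) = q"
  unfolding chart_inv_def by (rule inv_into_f_f[OF chart_inj])

lemma chart_image_open:
  assumes "c \<in> atlas M" "openin (mtop M) W"
  shows "open (snd c ` (fst c \<inter> W))"
proof -
  have "openin (top_of_set (snd c ` fst c)) (snd c ` (fst c \<inter> W))"
  proof -
    have "openin (subtopology (mtop M) (fst c)) (fst c \<inter> W)"
      by (rule openin_subtopology_Int2[OF assms(2)])
    then show ?thesis
      using homeomorphic_imp_open_map[OF chart_homeo[OF assms(1)]] unfolding open_map_def by blast
  qed
  moreover have "open (snd c ` fst c)" using smooth_manifold assms(1) by (auto simp: smooth_manifold_def)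
  ultimately show ?thesis using openin_open_eq by blast
qed

lemma chart_image_open': "c \<in> atlas M \<Longrightarrow> open (snd c ` fst c)"
  using chart_image_open[OF _ chart_openin, of c c] by simp

lemma chart_at:
  assumes "p \<in> topspace (mtop M)" shows "chart_at M p \<in> atlas M" "p \<in> fst (chart_at M p)"
proof -
  have "\<exists>c. c \<in> atlas M \<and> p \<in> fst c" using assms smooth_manifold unfolding smooth_manifold_def by blast
  from someI_ex[OF this] show "chart_at M p \<in> atlas M" "p \<in> fst (chart_at M p)"
    by (auto simp: chart_at_def)
qed

lemma chart_at': "c \<in> atlas M \<Longrightarrow> p \<in> fst c \<Longrightarrow> chart_at M p \<in> atlas M"
  "c \<in> atlas M \<Longrightarrow> p \<in> fst c \<Longrightarrow> p \<in> fst (chart_at M p)"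
  using chart_at chart_subset by blast+

lemma transition_smooth: "c \<in> atlas M \<Longrightarrow> d \<in> atlas M \<Longrightarrow>
    smooth_on (snd c ` (fst c \<inter> fst d)) (snd d \<circ> chart_inv c)"
  using smooth_manifold by (auto simp: smooth_manifold_def)

lemma transition_has_derivative:
  assumes "c \<in> atlas M" "d \<in> atlas M" "q \<in> fst c" "q \<in> fst d"
  shows "((snd d \<circ> chart_inv c) has_derivative transition_deriv c d q) (at (snd c q))"
  using assms by (intro smooth_on_has_derivative[OF transition_smooth]) auto

lemma transition_linear:
  "c \<in> atlas M \<Longrightarrow> d \<in> atlas M \<Longrightarrow> q \<in> fst c \<Longrightarrow> q \<in> fst d \<Longrightarrow> linear (transition_deriv c d q)"
  using has_derivative_linear[OF transition_has_derivative] .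

lemma change_of_chart:
  assumes c: "c \<in> atlas M" "d \<in> atlas M" "q \<in> fst c" "q \<in> fst d"
    and f: "((f \<circ> chart_inv d) has_derivative f') (at (snd d q))"
  shows "((f \<circ> chart_inv c) has_derivative (\<lambda>v. f' (transition_deriv c d q v))) (at (snd c q))"
proof (rule has_derivative_transform_within_open)
  have "(snd d \<circ> chart_inv c) (snd c q) = snd d q" using c by simp
  then have f': "((f \<circ> chart_inv d) has_derivative f') (at ((snd d \<circ> chart_inv c) (snd c q)))"
    using f by (simp only:)
  show "((\<lambda>e. (f \<circ> chart_inv d) ((snd d \<circ> chart_inv c) e)) has_derivative (\<lambda>v. f' (transition_deriv c d q v))) (at (snd c q))"
    by (rule has_derivative_compose[where f = "snd d \<circ> chart_inv c" and g = "f \<circ> chart_inv d" and g' = f',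
          OF transition_has_derivative[OF c] f'])
  show "open (snd c ` (fst c \<inter> fst d))" by (rule chart_image_open[OF c(1) chart_openin[OF c(2)]])
  show "snd c q \<in> snd c ` (fst c \<inter> fst d)" using c by auto
  show "(f \<circ> chart_inv d) ((snd d \<circ> chart_inv c) e) = (f \<circ> chart_inv c) e" if "e \<in> snd c ` (fst c \<inter> fst d)" for e
    using that c by auto
qed

lemma transition_chain:
  assumes "c \<in> atlas M" "d \<in> atlas M" "b \<in> atlas M" "q \<in> fst c" "q \<in> fst d" "q \<in> fst b"
  shows "transition_deriv d b q (transition_deriv c d q v) = transition_deriv c b q v"
  using fun_cong[OF frechet_derivative_at[OF change_of_chart[OF assms(1,2,4,5) transition_has_derivative[OF assms(2,3,5,6)]]], of v]
  by simp

lemma transition_self: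
  assumes "c \<in> atlas M" "q \<in> fst c"
  shows "transition_deriv c c q v = v"
proof -
  have "((snd c \<circ> chart_inv c) has_derivative (\<lambda>v. v)) (at (snd c q))"
    by (rule has_derivative_transform_within_open[OF has_derivative_ident chart_image_open'[OF assms(1)]])
      (use assms in auto)
  from fun_cong[OF frechet_derivative_at[OF this], of v] show ?thesis by simp
qed

lemma tcoord_eq: "tcoord M c q v = transition_deriv (chart_at M q) c q v"
  by (simp add: tcoord_def dir_deriv_def)

lemma coord_field_eq: "coord_field M c b q = transition_deriv c (chart_at M q) q b"
  by (simp add: coord_field_def)

lemma tcoord_linear: "c \<in> atlas M \<Longrightarrow> q \<in> fst c \<Longrightarrow> linear (tcoord M c q)"
  unfolding tcoord_eq[abs_def] by (intro transition_linear chart_at')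

lemma coord_field_linear: "c \<in> atlas M \<Longrightarrow> q \<in> fst c \<Longrightarrow> linear (\<lambda>b. coord_field M c b q)"
  unfolding coord_field_eq by (rule transition_linear[OF _ chart_at'(1) _ chart_at'(2)])

lemma tcoord_coord_field:
  assumes "c \<in> atlas M" "d \<in> atlas M" "q \<in> fst c" "q \<in> fst d"
  shows "tcoord M d q (coord_field M c b q) = transition_deriv c d q b"
  unfolding tcoord_eq coord_field_eq
  by (rule transition_chain[OF assms(1) chart_at'(1)[OF assms(1,3)] assms(2,3) chart_at'(2)[OF assms(1,3)] assms(4)])

lemma tcoord_coord_field_self [simp]:
  "c \<in> atlas M \<Longrightarrow> q \<in> fst c \<Longrightarrow> tcoord M c q (coord_field M c b q) = b"
  by (simp add: tcoord_coord_field transition_self)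

lemma coord_field_tcoord [simp]:
  assumes "c \<in> atlas M" "q \<in> fst c"
  shows "coord_field M c (tcoord M c q v) q = v"
  unfolding tcoord_eq coord_field_eq
  using transition_chain[OF chart_at'(1)[OF assms] assms(1) chart_at'(1)[OF assms] chart_at'(2)[OF assms] assms(2) chart_at'(2)[OF assms]]
    transition_self[OF chart_at'[OF assms]] by simp

lemma tcoord_chart_at: "q \<in> topspace (mtop M) \<Longrightarrow> tcoord M (chart_at M q) q v = v"
  unfolding tcoord_eq by (rule transition_self[OF chart_at])

lemma coord_field_chart_at: "q \<in> topspace (mtop M) \<Longrightarrow> coord_field M (chart_at M q) v q = v"
  unfolding coord_field_eq by (rule transition_self[OF chart_at])

text \<open>\<open>dir_deriv\<close> is defined in the chart chosen at q, which may jump with q.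
  This is the passage to one fixed chart, where derivatives at neighbouring points can be
  compared.\<close>

lemma dir_deriv_chart:
  assumes c: "c \<in> atlas M" "q \<in> fst c" and f: "(f \<circ> chart_inv c) differentiable (at (snd c q))"
  shows "dir_deriv M q v f = frechet_derivative (f \<circ> chart_inv c) (at (snd c q)) (tcoord M c q v)"
proof -
  have "((f \<circ> chart_inv (chart_at M q)) has_derivative
     (\<lambda>v. frechet_derivative (f \<circ> chart_inv c) (at (snd c q)) (transition_deriv (chart_at M q) c q v)))
     (at (snd (chart_at M q) q))"
    by (rule change_of_chart[where f = f, OF chart_at'(1)[OF c] c(1) chart_at'(2)[OF c] c(2) iffD1[OF frechet_derivative_works f]])
  from fun_cong[OF frechet_derivative_at[OF this], of v] show ?thesis
    by (simp add: dir_deriv_def tcoord_eq)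
qed

lemma smooth_fun_on_subset:
  "smooth_fun_on M W f \<Longrightarrow> openin (mtop M) V \<Longrightarrow> V \<subseteq> W \<Longrightarrow> smooth_fun_on M V f"
  unfolding smooth_fun_on_def by (meson Int_mono image_mono order_refl smooth_on_subset)

lemma smooth_fun_on_cong:
  assumes f: "smooth_fun_on M W f" and eq: "\<And>q. q \<in> W \<Longrightarrow> f q = f' q"
  shows "smooth_fun_on M W f'"
proof -
  have W: "openin (mtop M) W" using f by (simp add: smooth_fun_on_def)
  have "smooth_on (snd c ` (fst c \<inter> W)) (f' \<circ> chart_inv c)" if c: "c \<in> atlas M" for c
    by (rule smooth_on_cong[OF chart_image_open[OF c W], of "f \<circ> chart_inv c"])
      (use f c eq in \<open>auto simp: smooth_fun_on_def\<close>)
  then show ?thesis using W by (simp add: smooth_fun_on_def)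
qed

lemma smooth_fun_on_const: "openin (mtop M) W \<Longrightarrow> smooth_fun_on M W (\<lambda>q. r)"
  by (simp add: smooth_fun_on_def o_def smooth_on_const)

lemma smooth_fun_on_add:
  assumes "smooth_fun_on M W f" "smooth_fun_on M W f'" shows "smooth_fun_on M W (\<lambda>q. f q + f' q)"
  unfolding smooth_fun_on_def
proof (intro conjI ballI)
  show W: "openin (mtop M) W" using assms by (simp add: smooth_fun_on_def)
  fix c assume c: "c \<in> atlas M"
  note s = assms[unfolded smooth_fun_on_def o_def]
  show "smooth_on (snd c ` (fst c \<inter> W)) ((\<lambda>q. f q + f' q) \<circ> chart_inv c)"
    unfolding o_def by (rule smooth_on_add)
      (use s c chart_image_open[OF c W] in auto)
qed

lemma smooth_fun_on_scaleR:
  assumes "smooth_fun_on M W f" "smooth_fun_on M W f'" shows "smooth_fun_on M W (\<lambda>q. f q *\<^sub>R f' q)"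
  unfolding smooth_fun_on_def
proof (intro conjI ballI)
  show W: "openin (mtop M) W" using assms by (simp add: smooth_fun_on_def)
  fix c assume c: "c \<in> atlas M"
  note s = assms[unfolded smooth_fun_on_def o_def]
  show "smooth_on (snd c ` (fst c \<inter> W)) ((\<lambda>q. f q *\<^sub>R f' q) \<circ> chart_inv c)"
    unfolding o_def by (rule smooth_on_scaleR)
      (use s c chart_image_open[OF c W] in auto)
qed

lemma smooth_fun_on_bounded_linear:
  assumes "smooth_fun_on M W f" and L: "bounded_linear L" shows "smooth_fun_on M W (\<lambda>q. L (f q))"
  unfolding smooth_fun_on_def
proof (intro conjI ballI)
  show W: "openin (mtop M) W" using assms by (simp add: smooth_fun_on_def)
  fix c assume c: "c \<in> atlas M"
  note s = assms[unfolded smooth_fun_on_def o_def]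
  show "smooth_on (snd c ` (fst c \<inter> W)) ((\<lambda>q. L (f q)) \<circ> chart_inv c)"
    unfolding o_def by (rule smooth_on_bounded_linear[OF _ L])
      (use s c chart_image_open[OF c W] in auto)
qed

lemma smooth_fun_on_differentiable:
  assumes "smooth_fun_on M W f" "c \<in> atlas M" "q \<in> fst c" "q \<in> W"
  shows "(f \<circ> chart_inv c) differentiable (at (snd c q))"
  using assms by (intro smooth_on_differentiable[of "snd c ` (fst c \<inter> W)"]) (auto simp: smooth_fun_on_def)

lemma vector_field_on_openin: "vector_field_on M W Y \<Longrightarrow> openin (mtop M) W"
  by (simp add: vector_field_on_def)

lemma vector_field_on_subset:
  "vector_field_on M W Y \<Longrightarrow> openin (mtop M) V \<Longrightarrow> V \<subseteq> W \<Longrightarrow> vector_field_on M V Y"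
  unfolding vector_field_on_def
  by (meson Int_mono chart_openin openin_Int order_refl smooth_fun_on_subset)

lemma vector_field_on_cong:
  "vector_field_on M W Y \<Longrightarrow> (\<And>q. q \<in> W \<Longrightarrow> Y q = Z q) \<Longrightarrow> vector_field_on M W Z"
  unfolding vector_field_on_def
  by (metis (no_types, lifting) IntD1 smooth_fun_on_cong)

lemma vector_field_on_scaleR:
  assumes f: "smooth_fun_on M W f" and Y: "vector_field_on M W Y"
  shows "vector_field_on M W (\<lambda>q. f q *\<^sub>R Y q)"
  unfolding vector_field_on_def
proof (intro conjI ballI)
  show W: "openin (mtop M) W" using Y by (rule vector_field_on_openin)
  fix c assume c: "c \<in> atlas M"
  have "smooth_fun_on M (W \<inter> fst c) (\<lambda>q. f q *\<^sub>R tcoord M c q (Y q))"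
    using f Y c W chart_openin[OF c]
    by (intro smooth_fun_on_scaleR smooth_fun_on_subset[OF f]) (auto simp: vector_field_on_def)
  then show "smooth_fun_on M (W \<inter> fst c) (\<lambda>q. tcoord M c q (f q *\<^sub>R Y q))"
    by (rule smooth_fun_on_cong) (simp add: linear_scale[OF tcoord_linear[OF c]])
qed

lemma vector_field_on_add:
  assumes X: "vector_field_on M W X" and Y: "vector_field_on M W Y"
  shows "vector_field_on M W (\<lambda>q. X q + Y q)"
  unfolding vector_field_on_def
proof (intro conjI ballI)
  show W: "openin (mtop M) W" using Y by (rule vector_field_on_openin)
  fix c assume c: "c \<in> atlas M"
  have "smooth_fun_on M (W \<inter> fst c) (\<lambda>q. tcoord M c q (X q) + tcoord M c q (Y q))"
    using X Y c by (intro smooth_fun_on_add) (auto simp: vector_field_on_def)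
  then show "smooth_fun_on M (W \<inter> fst c) (\<lambda>q. tcoord M c q (X q + Y q))"
    by (rule smooth_fun_on_cong) (simp add: linear_add[OF tcoord_linear[OF c]])
qed

lemma vector_field_on_zero:
  assumes W: "openin (mtop M) W" shows "vector_field_on M W (\<lambda>q. 0)"
  unfolding vector_field_on_def
proof (intro conjI ballI W)
  fix c assume c: "c \<in> atlas M"
  show "smooth_fun_on M (W \<inter> fst c) (\<lambda>q. tcoord M c q 0)"
    by (rule smooth_fun_on_cong[OF smooth_fun_on_const[of _ 0]])
      (use W chart_openin[OF c] linear_0[OF tcoord_linear[OF c]] in auto)
qed

lemma coord_field_vector_field:
  assumes c: "c \<in> atlas M" shows "vector_field_on M (fst c) (coord_field M c b)"
  unfolding vector_field_on_def
proof (intro conjI ballI chart_openin[OF c])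
  fix d assume d: "d \<in> atlas M"
  have "smooth_fun_on M (fst c \<inter> fst d) (\<lambda>q. transition_deriv c d q b)"
    unfolding smooth_fun_on_def
  proof (intro conjI ballI)
    show o: "openin (mtop M) (fst c \<inter> fst d)" using c d chart_openin by blast
    fix a assume a: "a \<in> atlas M"
    have "smooth_on (snd a ` (fst a \<inter> (fst c \<inter> fst d)))
       (\<lambda>e. frechet_derivative (snd d \<circ> chart_inv c) (at ((snd c \<circ> chart_inv a) e)) b)"
      by (rule smooth_on_compose[where T = "snd c ` (fst c \<inter> fst d)" and f = "snd c \<circ> chart_inv a"
            and g = "\<lambda>e. frechet_derivative (snd d \<circ> chart_inv c) (at e) b"])
        (use a c d chart_image_open[OF a o] chart_image_open[OF c chart_openin[OF d]] in
          \<open>auto intro!: smooth_on_frechet transition_smooth smooth_on_subset[OF transition_smooth[OF a c]]\<close>)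
    then show "smooth_on (snd a ` (fst a \<inter> (fst c \<inter> fst d))) ((\<lambda>q. transition_deriv c d q b) \<circ> chart_inv a)"
      by (simp add: o_def)
  qed
  then show "smooth_fun_on M (fst c \<inter> fst d) (\<lambda>q. tcoord M d q (coord_field M c b q))"
    by (rule smooth_fun_on_cong) (simp add: tcoord_coord_field c d)
qed

lemma field_rep_smooth:
  assumes "vector_field_on M W Y" "c \<in> atlas M"
  shows "smooth_on (snd c ` (fst c \<inter> W)) (field_rep M c Y)"
proof -
  have "smooth_on (snd c ` (fst c \<inter> (W \<inter> fst c))) ((\<lambda>q. tcoord M c q (Y q)) \<circ> chart_inv c)"
    using assms by (auto simp: vector_field_on_def smooth_fun_on_def)
  moreover have "fst c \<inter> (W \<inter> fst c) = fst c \<inter> W" by auto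
  ultimately show ?thesis by (simp add: field_rep_def[abs_def] o_def)
qed

lemma field_rep_comp: "field_rep M c Y = (\<lambda>q. tcoord M c q (Y q)) \<circ> chart_inv c"
  by (simp add: fun_eq_iff field_rep_def)

lemma field_expansion:
  assumes "c \<in> atlas M" "q \<in> fst c"
  shows "Y q = (\<Sum>b\<in>Basis. (tcoord M c q (Y q) \<bullet> b) *\<^sub>R coord_field M c b q)"
  using linear_apply_basis[OF coord_field_linear[OF assms], of "tcoord M c q (Y q)"] assms by simp

end

section \<open>Connections in a chart\<close>

definition christoffel_symbol ::
  "('a, 'e::euclidean_space) manifold \<Rightarrow> ('a \<Rightarrow> 'e \<Rightarrow> ('a \<Rightarrow> 'e) \<Rightarrow> 'e) \<Rightarrow> ('a, 'e) chart \<Rightarrow>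
   'e \<Rightarrow> 'e \<Rightarrow> 'e \<Rightarrow> 'e" where
  "christoffel_symbol M nabla c e x y =
     tcoord M c (chart_inv c e) (nabla (chart_inv c e) (coord_field M c x (chart_inv c e)) (coord_field M c y))"

definition metric_rep ::
  "('a, 'e::euclidean_space) manifold \<Rightarrow> ('a \<Rightarrow> 'e \<Rightarrow> 'e \<Rightarrow> real) \<Rightarrow> ('a, 'e) chart \<Rightarrow> 'e \<Rightarrow> 'e \<Rightarrow> 'e \<Rightarrow> real" where
  "metric_rep M g c e x y =
     g (chart_inv c e) (coord_field M c x (chart_inv c e)) (coord_field M c y (chart_inv c e))"

locale mfd_connection = smooth_mfd M for M :: "('a, 'e::euclidean_space) manifold" +
  fixes nabla :: "'a \<Rightarrow> 'e \<Rightarrow> ('a \<Rightarrow> 'e) \<Rightarrow> 'e"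
  assumes affine: "affine_connection M nabla"
begin

lemma nabla_linear: "vector_field_on M W Y \<Longrightarrow> p \<in> W \<Longrightarrow> linear (\<lambda>x. nabla p x Y)"
  using affine unfolding affine_connection_def by blast

lemma nabla_field: "vector_field_on M W Y \<Longrightarrow> vector_field_on M W X \<Longrightarrow>
    vector_field_on M W (\<lambda>q. nabla q (X q) Y)"
  using affine unfolding affine_connection_def by blast

lemma nabla_add: "vector_field_on M W Y \<Longrightarrow> vector_field_on M W Z \<Longrightarrow> p \<in> W \<Longrightarrow>
    nabla p x (\<lambda>q. Y q + Z q) = nabla p x Y + nabla p x Z"
  using affine unfolding affine_connection_def by blast

lemma nabla_leibniz: "vector_field_on M W Y \<Longrightarrow> smooth_fun_on M W f \<Longrightarrow> p \<in> W \<Longrightarrow>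
    nabla p x (\<lambda>q. f q *\<^sub>R Y q) = dir_deriv M p x f *\<^sub>R Y p + f p *\<^sub>R nabla p x Y"
  using affine unfolding affine_connection_def by blast

lemma dir_deriv_locally_const:
  assumes W: "openin (mtop M) W" "p \<in> W" and f: "\<And>q. q \<in> W \<Longrightarrow> f q = r"
  shows "dir_deriv M p x f = 0"
proof -
  have p: "p \<in> topspace (mtop M)" using W openin_subset by blast
  let ?c = "chart_at M p"
  have "((f \<circ> chart_inv ?c) has_derivative (\<lambda>_. 0)) (at (snd ?c p))"
    by (rule has_derivative_transform_within_open[OF has_derivative_const chart_image_open[OF chart_at(1)[OF p] W(1)]])
      (use f W chart_at[OF p] in auto)
  from fun_cong[OF frechet_derivative_at[OF this], of x] show ?thesis by (simp add: dir_deriv_def)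
qed

text \<open>Multiplied by the indicator function of W, the fields Y and Z become the same total
  function. The indicator is smooth on W with zero derivative, so by the Leibniz rule this leaves
  \<open>nabla\<close> at p unchanged.\<close>

lemma nabla_cong:
  assumes Y: "vector_field_on M W Y" and p: "p \<in> W" and eq: "\<And>q. q \<in> W \<Longrightarrow> Y q = Z q"
  shows "nabla p x Y = nabla p x Z"
proof -
  define f :: "'a \<Rightarrow> real" where "f q = (if q \<in> W then 1 else 0)" for q
  have W: "openin (mtop M) W" by (rule vector_field_on_openin[OF Y])
  have f: "smooth_fun_on M W f"
    by (rule smooth_fun_on_cong[OF smooth_fun_on_const[OF W, of 1]]) (simp add: f_def)
  have "nabla p x (\<lambda>q. f q *\<^sub>R V q) = nabla p x V" if "vector_field_on M W V" for V
    using nabla_leibniz[OF that f p] dir_deriv_locally_const[OF W p, of f 1] p by (simp add: f_def)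
  moreover have "(\<lambda>q. f q *\<^sub>R Y q) = (\<lambda>q. f q *\<^sub>R Z q)" using eq by (auto simp: f_def)
  ultimately show ?thesis using Y vector_field_on_cong[OF Y eq] by metis
qed

lemma nabla_sum:
  assumes "finite I" "openin (mtop M) W" "p \<in> W" "\<And>i. i \<in> I \<Longrightarrow> vector_field_on M W (Y i)"
  shows "vector_field_on M W (\<lambda>q. \<Sum>i\<in>I. Y i q) \<and> nabla p x (\<lambda>q. \<Sum>i\<in>I. Y i q) = (\<Sum>i\<in>I. nabla p x (Y i))"
  using assms(1,4)
proof (induction I)
  case empty
  have "nabla p x (\<lambda>q. 0) = nabla p x (\<lambda>q. 0) + nabla p x (\<lambda>q. 0)"
    using nabla_add[OF vector_field_on_zero vector_field_on_zero assms(3), OF assms(2,2)] by simp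
  then show ?case using vector_field_on_zero[OF assms(2)] by simp
next
  case (insert i I)
  then have "vector_field_on M W (Y i)" "vector_field_on M W (\<lambda>q. \<Sum>i\<in>I. Y i q)" by auto
  from vector_field_on_add[OF this] nabla_add[OF this assms(3)] insert show ?case by simp
qed

context
  fixes c assumes c: "c \<in> atlas M"
begin

abbreviation (input) "\<Gamma> \<equiv> christoffel_symbol M nabla c"

lemma christoffel_symbol_at:
  "p \<in> fst c \<Longrightarrow> \<Gamma> (snd c p) x y = tcoord M c p (nabla p (coord_field M c x p) (coord_field M c y))"
  by (simp add: christoffel_symbol_def c)

lemma christoffel_symbol_smooth: "smooth_on (snd c ` fst c) (\<lambda>e. \<Gamma> e x y)"
  using field_rep_smooth[OF nabla_field[OF coord_field_vector_field[OF c] coord_field_vector_field[OF c]] c, of x y]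
  by (simp add: field_rep_def[abs_def] christoffel_symbol_def)

lemma christoffel_symbol_bilinear:
  assumes "e \<in> snd c ` fst c" shows "bilinear (\<Gamma> e)"
  unfolding bilinear_def
proof (intro conjI allI)
  obtain p where p: "p \<in> fst c" "e = snd c p" using assms by auto
  note V = coord_field_vector_field[OF c]
  show "linear (\<lambda>x. \<Gamma> e x y)" for y
  proof -
    have "linear (\<lambda>x. tcoord M c p (nabla p (coord_field M c x p) (coord_field M c y)))"
      using linear_compose[OF linear_compose[OF coord_field_linear[OF c p(1)] nabla_linear[OF V p(1)]] tcoord_linear[OF c p(1)]]
      by (simp add: o_def)
    then show ?thesis by (simp add: p christoffel_symbol_at)
  qed
  show "linear (\<Gamma> e x)" for x
  proof (rule linearI)
    fix y z r
    let ?X = "coord_field M c x p"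
    \<comment> \<open>The coordinate fields add up only on the domain of c, hence the appeal to
      locality.\<close>
    have "nabla p ?X (coord_field M c (y + z)) = nabla p ?X (\<lambda>q. coord_field M c y q + coord_field M c z q)"
      by (rule nabla_cong[OF V p(1)]) (simp add: linear_add[OF coord_field_linear[OF c]])
    also have "\<dots> = nabla p ?X (coord_field M c y) + nabla p ?X (coord_field M c z)"
      by (rule nabla_add[OF V V p(1)])
    finally show "\<Gamma> e x (y + z) = \<Gamma> e x y + \<Gamma> e x z"
      by (simp add: p christoffel_symbol_at linear_add[OF tcoord_linear[OF c p(1)]])
    have "nabla p ?X (coord_field M c (r *\<^sub>R y)) = nabla p ?X (\<lambda>q. r *\<^sub>R coord_field M c y q)"
      by (rule nabla_cong[OF V p(1)]) (simp add: linear_scale[OF coord_field_linear[OF c]])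
    also have "\<dots> = r *\<^sub>R nabla p ?X (coord_field M c y)"
      using nabla_leibniz[OF V smooth_fun_on_const[OF chart_openin[OF c]] p(1)]
        dir_deriv_locally_const[OF chart_openin[OF c] p(1), of "\<lambda>_. r" r] by simp
    finally show "\<Gamma> e x (r *\<^sub>R y) = r *\<^sub>R \<Gamma> e x y"
      by (simp add: p christoffel_symbol_at linear_scale[OF tcoord_linear[OF c p(1)]])
  qed
qed

text \<open>Near p the field is a combination of coordinate fields with smooth coefficients.
  Additivity and the Leibniz rule split its derivative into that of the coefficients and the
  Christoffel part.\<close>

lemma tcoord_nabla:
  assumes Y: "vector_field_on M W Y" and p: "p \<in> W" "p \<in> fst c"
  shows "tcoord M c p (nabla p x Y) =
    frechet_derivative (field_rep M c Y) (at (snd c p)) (tcoord M c p x)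
    + \<Gamma> (snd c p) (tcoord M c p x) (tcoord M c p (Y p))"
proof -
  let ?E = "coord_field M c" and ?e = "snd c p"
  define f where "f b q = tcoord M c q (Y q) \<bullet> b" for b q
  define V where "V = W \<inter> fst c"
  have V: "openin (mtop M) V" "p \<in> V"
    using vector_field_on_openin[OF Y] chart_openin[OF c] p by (auto simp: V_def)
  have Yc: "smooth_fun_on M V (\<lambda>q. tcoord M c q (Y q))" using Y c by (simp add: V_def vector_field_on_def)
  have f: "smooth_fun_on M V (f b)" for b
    unfolding f_def by (rule smooth_fun_on_bounded_linear[OF Yc bounded_linear_inner_left])
  have E: "vector_field_on M V (?E b)" for b
    by (rule vector_field_on_subset[OF coord_field_vector_field[OF c] V(1)]) (simp add: V_def)
  have dY: "field_rep M c Y differentiable (at ?e)"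
    unfolding field_rep_comp by (rule smooth_fun_on_differentiable[OF Yc c p(2) V(2)])
  have df: "dir_deriv M p x (f b) = frechet_derivative (field_rep M c Y) (at ?e) (tcoord M c p x) \<bullet> b" for b
  proof -
    have "f b \<circ> chart_inv c = (\<lambda>e. field_rep M c Y e \<bullet> b)" by (simp add: f_def o_def field_rep_def)
    then show ?thesis
      using dir_deriv_chart[OF c p(2) smooth_fun_on_differentiable[OF f c p(2) V(2)]] frechet_derivative_inner[OF dY]
      by simp
  qed
  have "nabla p x Y = nabla p x (\<lambda>q. \<Sum>b\<in>Basis. f b q *\<^sub>R ?E b q)"
    by (rule nabla_cong[OF vector_field_on_subset[OF Y V(1)] V(2)])
      (auto simp: V_def f_def intro: field_expansion[OF c])
  also have "\<dots> = (\<Sum>b\<in>Basis. nabla p x (\<lambda>q. f b q *\<^sub>R ?E b q))"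
    using nabla_sum[where Y = "\<lambda>b q. f b q *\<^sub>R ?E b q", OF finite_Basis V vector_field_on_scaleR[OF f E]] by simp
  also have "\<dots> = (\<Sum>b\<in>Basis. dir_deriv M p x (f b) *\<^sub>R ?E b p + f b p *\<^sub>R nabla p x (?E b))"
    by (simp add: nabla_leibniz[OF E f V(2)])
  also have "tcoord M c p \<dots> = (\<Sum>b\<in>Basis. dir_deriv M p x (f b) *\<^sub>R b)
      + (\<Sum>b\<in>Basis. f b p *\<^sub>R tcoord M c p (nabla p x (?E b)))"
    by (simp add: linear_sum[OF tcoord_linear[OF c p(2)]] linear_add[OF tcoord_linear[OF c p(2)]]
        linear_scale[OF tcoord_linear[OF c p(2)]] sum.distrib c p(2))
  also have "(\<Sum>b\<in>Basis. dir_deriv M p x (f b) *\<^sub>R b) = frechet_derivative (field_rep M c Y) (at ?e) (tcoord M c p x)"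
    unfolding df by (rule euclidean_representation)
  also have "(\<Sum>b\<in>Basis. f b p *\<^sub>R tcoord M c p (nabla p x (?E b))) = \<Gamma> ?e (tcoord M c p x) (tcoord M c p (Y p))"
  proof -
    have "\<Gamma> ?e (tcoord M c p x) b = tcoord M c p (nabla p x (?E b))" for b
      using p c by (simp add: christoffel_symbol_at)
    moreover have "linear (\<Gamma> ?e (tcoord M c p x))"
      using christoffel_symbol_bilinear[of ?e] p by (simp add: bilinear_def)
    ultimately show ?thesis
      using linear_apply_basis[of "\<Gamma> ?e (tcoord M c p x)" "tcoord M c p (Y p)"] by (simp add: f_def)
  qed
  finally show ?thesis .
qed

end

text \<open>Second derivatives of Z cancel by symmetry, and derivatives of X and Y cancel against
  the bracket. The result depends only on the values at p, which makes the description in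
  \<open>curvature\<close> consistent.\<close>

lemma curvature_expression:
  assumes p: "p \<in> W" and X: "vector_field_on M W X" and Y: "vector_field_on M W Y" and Z: "vector_field_on M W Z"
  shows "nabla p (X p) (\<lambda>q. nabla q (Y q) Z) - nabla p (Y p) (\<lambda>q. nabla q (X q) Z)
      - nabla p (lie_bracket M X Y p) Z
    = coord_curvature (christoffel_symbol M nabla (chart_at M p)) (snd (chart_at M p) p) (X p) (Y p) (Z p)"
proof -
  have pt: "p \<in> topspace (mtop M)" using p vector_field_on_openin[OF X] openin_subset by blast
  define c where "c = chart_at M p"
  define e where "e = snd c p"
  define G where "G = christoffel_symbol M nabla c"
  have c: "c \<in> atlas M" "p \<in> fst c" using chart_at[OF pt] by (simp_all add: c_def)
  have tc: "tcoord M c p v = v" for v using tcoord_chart_at[OF pt] by (simp add: c_def)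
  define T where "T = snd c ` (fst c \<inter> W)"
  have T: "open T" "e \<in> T" using chart_image_open[OF c(1) vector_field_on_openin[OF X]] c p by (auto simp: T_def e_def)
  have TU: "T \<subseteq> snd c ` fst c" by (auto simp: T_def)
  have rep_e: "field_rep M c V e = V p" for V by (simp add: field_rep_def e_def c tc)
  have smooth: "smooth_on T (field_rep M c V)" if "vector_field_on M W V" for V
    unfolding T_def by (rule field_rep_smooth[OF that c(1)])
  note nab = tcoord_nabla[OF c(1) _ p c(2), unfolded tc, folded e_def G_def]
  have Gb: "bilinear (G e')" if "e' \<in> T" for e'
    unfolding G_def using christoffel_symbol_bilinear[OF c(1)] that TU by auto
  have Gs: "smooth_on T (\<lambda>e. G e x y)" for x y
    unfolding G_def by (rule smooth_on_subset[OF christoffel_symbol_smooth[OF c(1)] TU])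
  let ?z = "field_rep M c Z"
  have D: "frechet_derivative (field_rep M c (\<lambda>q. nabla q (V q) Z)) (at e) x
    = frechet_derivative (\<lambda>e. frechet_derivative ?z (at e) (V p)) (at e) x
      + frechet_derivative ?z (at e) (frechet_derivative (field_rep M c V) (at e) x)
      + (frechet_derivative (\<lambda>e. G e (V p) (Z p)) (at e) x
        + G e (frechet_derivative (field_rep M c V) (at e) x) (Z p)
        + G e (V p) (frechet_derivative ?z (at e) x))"
    if V: "vector_field_on M W V" for V x
  proof -
    let ?v = "field_rep M c V"
    have dV: "(?v has_derivative frechet_derivative ?v (at e)) (at e)"
      by (rule smooth_on_has_derivative[OF smooth[OF V] T(2)])
    have dZ: "(?z has_derivative frechet_derivative ?z (at e)) (at e)"
      by (rule smooth_on_has_derivative[OF smooth[OF Z] T(2)])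
    \<comment> \<open>The derivative of \<open>?z\<close> is taken in the varying direction
      \<open>?v e\<close>. The dummy factor r, set to 1 below, turns it into a bilinear family to
      which the product rule applies.\<close>
    define B where "B e v r = r *\<^sub>R frechet_derivative ?z (at e) v" for e v and r :: real
    have Bl: "bilinear (B e')" if "e' \<in> T" for e'
    proof -
      have l: "linear (frechet_derivative ?z (at e'))"
        by (rule linear_frechet_derivative[OF smooth_on_differentiable[OF smooth[OF Z] that]])
      show ?thesis
        unfolding bilinear_def B_def
        by (auto intro!: linearI simp: linear_add[OF l] linear_scale[OF l] algebra_simps)
    qed
    have Bd: "(\<lambda>e. B e v r) differentiable (at e)" for v r
      unfolding B_def
      by (intro differentiable_scaleR differentiable_const smooth_on_differentiable[OF smooth_on_frechet[OF smooth[OF Z]] T(2)])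
    have 2: "((\<lambda>e. B e (?v e) 1) has_derivative
        (\<lambda>x. frechet_derivative (\<lambda>y. B y (?v e) 1) (at e) x + B e (frechet_derivative ?v (at e) x) 1 + B e (?v e) 0)) (at e)"
      by (rule bilinear_family_has_derivative[where B = B and F = "\<lambda>e. e" and a = ?v and b = "\<lambda>_. 1" and S = T,
          OF T(1) T(2) Bl Bd has_derivative_ident dV has_derivative_const])
    have 3: "((\<lambda>e. G e (?v e) (?z e)) has_derivative
        (\<lambda>x. frechet_derivative (\<lambda>y. G y (?v e) (?z e)) (at e) x + G e (frechet_derivative ?v (at e) x) (?z e)
          + G e (?v e) (frechet_derivative ?z (at e) x))) (at e)"
      by (rule bilinear_family_has_derivative[where B = G and F = "\<lambda>e. e" and a = ?v and b = ?z and S = T,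
          OF T(1) T(2) Gb smooth_on_differentiable[OF Gs T(2)] has_derivative_ident dV dZ])
    have eq: "B e' (?v e') 1 + G e' (?v e') (?z e') = field_rep M c (\<lambda>q. nabla q (V q) Z) e'" if "e' \<in> T" for e'
    proof -
      obtain q where q: "q \<in> fst c" "q \<in> W" "e' = snd c q" using \<open>e' \<in> T\<close> by (auto simp: T_def)
      show ?thesis
        using tcoord_nabla[OF c(1) Z q(2,1), of "V q"] q c by (simp add: B_def G_def field_rep_def[of M c _ "snd c q"])
    qed
    from has_derivative_transform_within_open[OF has_derivative_add[OF 2 3] T eq]
    have "frechet_derivative (field_rep M c (\<lambda>q. nabla q (V q) Z)) (at e)
      = (\<lambda>x. frechet_derivative (\<lambda>y. B y (?v e) 1) (at e) x + B e (frechet_derivative ?v (at e) x) 1 + B e (?v e) 0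
          + (frechet_derivative (\<lambda>y. G y (?v e) (?z e)) (at e) x + G e (frechet_derivative ?v (at e) x) (?z e)
          + G e (?v e) (frechet_derivative ?z (at e) x)))"
      by (rule frechet_derivative_at[symmetric])
    then show ?thesis by (simp add: B_def rep_e)
  qed
  have lG: "linear (G e x)" "linear (\<lambda>x. G e x y)" for x y using Gb[OF T(2)] by (auto simp: bilinear_def)
  have lZ: "linear (frechet_derivative ?z (at e))"
    by (rule linear_frechet_derivative[OF smooth_on_differentiable[OF smooth[OF Z] T(2)]])
  have br: "lie_bracket M X Y p
      = frechet_derivative (field_rep M c Y) (at e) (X p) - frechet_derivative (field_rep M c X) (at e) (Y p)"
    by (simp add: lie_bracket_def dir_deriv_def field_rep_comp c_def e_def)
  have "tcoord M c p (nabla p (X p) (\<lambda>q. nabla q (Y q) Z) - nabla p (Y p) (\<lambda>q. nabla q (X q) Z)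
      - nabla p (lie_bracket M X Y p) Z) = coord_curvature G e (X p) (Y p) (Z p)"
    unfolding tc nab[OF nabla_field[OF Z X], unfolded tc] nab[OF nabla_field[OF Z Y], unfolded tc] nab[OF Z, unfolded tc]
      D[OF X] D[OF Y] br linear_diff[OF lG(2)] linear_diff[OF lZ]
    using smooth_on_symmetric[OF T smooth[OF Z], of "X p" "Y p"]
    by (simp add: coord_curvature_def linear_add[OF lG(1)] nab[OF Z, unfolded tc])
  then show ?thesis unfolding tc by (simp add: c_def e_def G_def)
qed

text \<open>The coordinate fields of the chart at p extend any three vectors; they supply the
  uniqueness half of the definite description.\<close>

lemma curvature_coord:
  assumes p: "p \<in> topspace (mtop M)"
  shows "curvature M nabla p x y z
    = coord_curvature (christoffel_symbol M nabla (chart_at M p)) (snd (chart_at M p) p) x y z"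
  unfolding curvature_def
proof (rule the_equality)
  let ?K = "coord_curvature (christoffel_symbol M nabla (chart_at M p)) (snd (chart_at M p) p) x y z"
  let ?c = "chart_at M p"
  show "\<forall>W X Y Z. p \<in> W \<and> vector_field_on M W X \<and> vector_field_on M W Y \<and> vector_field_on M W Z \<and>
     X p = x \<and> Y p = y \<and> Z p = z \<longrightarrow>
     ?K = nabla p (X p) (\<lambda>q. nabla q (Y q) Z) - nabla p (Y p) (\<lambda>q. nabla q (X q) Z)
         - nabla p (lie_bracket M X Y p) Z"
  proof (intro allI impI, elim conjE)
    fix W X Y Z
    assume *: "p \<in> W" "vector_field_on M W X" "vector_field_on M W Y" "vector_field_on M W Z"
      and v: "X p = x" "Y p = y" "Z p = z"
    show "?K = nabla p (X p) (\<lambda>q. nabla q (Y q) Z) - nabla p (Y p) (\<lambda>q. nabla q (X q) Z)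
         - nabla p (lie_bracket M X Y p) Z"
      using curvature_expression[OF *] by (simp only: v)
  qed
  fix w
  assume w: "\<forall>W X Y Z. p \<in> W \<and> vector_field_on M W X \<and> vector_field_on M W Y \<and> vector_field_on M W Z \<and>
     X p = x \<and> Y p = y \<and> Z p = z \<longrightarrow>
     w = nabla p (X p) (\<lambda>q. nabla q (Y q) Z) - nabla p (Y p) (\<lambda>q. nabla q (X q) Z)
         - nabla p (lie_bracket M X Y p) Z"
  note V = coord_field_vector_field[OF chart_at(1)[OF p]] and v = coord_field_chart_at[OF p] and pc = chart_at(2)[OF p]
  have "w = nabla p (coord_field M ?c x p) (\<lambda>q. nabla q (coord_field M ?c y q) (coord_field M ?c z))
     - nabla p (coord_field M ?c y p) (\<lambda>q. nabla q (coord_field M ?c x q) (coord_field M ?c z))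
         - nabla p (lie_bracket M (coord_field M ?c x) (coord_field M ?c y) p) (coord_field M ?c z)"
    by (rule w[rule_format, of "fst ?c"]) (intro conjI V v pc)
  then show "w = ?K" using curvature_expression[OF pc V V V, of x y z] v by simp
qed

lemma curvature_fields:
  assumes p: "p \<in> W" and X: "vector_field_on M W X" and Y: "vector_field_on M W Y" and Z: "vector_field_on M W Z"
  shows "curvature M nabla p (X p) (Y p) (Z p) =
    nabla p (X p) (\<lambda>q. nabla q (Y q) Z) - nabla p (Y p) (\<lambda>q. nabla q (X q) Z) - nabla p (lie_bracket M X Y p) Z"
proof -
  have "p \<in> topspace (mtop M)" using p vector_field_on_openin[OF X] openin_subset by blast
  then show ?thesis using curvature_coord curvature_expression[OF assms] by simp
qed

end

section \<open>Levi-Civita connections and Kaehler manifolds with Norden metric\<close>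

locale mfd_levi_civita = smooth_mfd M for M :: "('a, 'e::euclidean_space) manifold" +
  fixes g :: "'a \<Rightarrow> 'e \<Rightarrow> 'e \<Rightarrow> real" and nabla :: "'a \<Rightarrow> 'e \<Rightarrow> ('a \<Rightarrow> 'e) \<Rightarrow> 'e"
  assumes levi_civita: "levi_civita M g nabla"
begin

sublocale mfd_connection M nabla
  by unfold_locales (use levi_civita in \<open>simp add: levi_civita_def\<close>)

lemma torsion_free: "vector_field_on M W X \<Longrightarrow> vector_field_on M W Y \<Longrightarrow> p \<in> W \<Longrightarrow>
    nabla p (X p) Y - nabla p (Y p) X = lie_bracket M X Y p"
  using levi_civita unfolding levi_civita_def by blast

lemma metric_compatible: "vector_field_on M W X \<Longrightarrow> vector_field_on M W Y \<Longrightarrow> p \<in> W \<Longrightarrow>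
    dir_deriv M p z (\<lambda>q. g q (X q) (Y q)) = g p (nabla p z X) (Y p) + g p (X p) (nabla p z Y)"
  using levi_civita unfolding levi_civita_def by blast

text \<open>The bracket at p is computed in the chart chosen at p, in which these fields are not
  constant. Their components are derivatives of the transition map, so the bracket is an
  antisymmetrised second derivative.\<close>

lemma lie_bracket_coord_field:
  assumes c: "c \<in> atlas M" "p \<in> fst c"
  shows "lie_bracket M (coord_field M c x) (coord_field M c y) p = 0"
proof -
  define d where "d = chart_at M p"
  have d: "d \<in> atlas M" "p \<in> fst d" using chart_at'[OF c] by (simp_all add: d_def)
  define f where "f y q = tcoord M d q (coord_field M c y q)" for y q
  define T where "T = snd c ` (fst c \<inter> fst d)"
  have T: "open T" "snd c p \<in> T" using chart_image_open[OF c(1) chart_openin[OF d(1)]] c d by (auto simp: T_def)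
  have sf: "smooth_fun_on M (fst c \<inter> fst d) (f y)" for y
    using coord_field_vector_field[OF c(1), of y] d by (simp add: vector_field_on_def f_def[abs_def])
  have diff: "(f y \<circ> chart_inv c) differentiable (at (snd c p))" for y
    by (rule smooth_fun_on_differentiable[OF sf c]) (use c d in simp)
  have eq: "(f y \<circ> chart_inv c) e = frechet_derivative (snd d \<circ> chart_inv c) (at e) y" if "e \<in> T" for e y
    using that c d by (auto simp: T_def f_def tcoord_coord_field)
  have D: "dir_deriv M p (coord_field M c x p) (f y)
      = frechet_derivative (\<lambda>e. frechet_derivative (snd d \<circ> chart_inv c) (at e) y) (at (snd c p)) x" for x y
    unfolding dir_deriv_chart[OF c diff]
    using frechet_derivative_transform_within_open[where f = "f y \<circ> chart_inv c"
        and g = "\<lambda>e. frechet_derivative (snd d \<circ> chart_inv c) (at e) y", OF diff T eq]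
    by (simp add: c)
  have sm: "smooth_on T (snd d \<circ> chart_inv c)" unfolding T_def by (rule transition_smooth[OF c(1) d(1)])
  show ?thesis
    unfolding lie_bracket_def d_def[symmetric] f_def[symmetric] D
    using smooth_on_symmetric[OF T sm, of x y] by simp
qed

lemma christoffel_symbol_sym:
  assumes c: "c \<in> atlas M" "e \<in> snd c ` fst c"
  shows "christoffel_symbol M nabla c e x y = christoffel_symbol M nabla c e y x"
proof -
  obtain p where p: "p \<in> fst c" "e = snd c p" using c by auto
  have "nabla p (coord_field M c x p) (coord_field M c y) - nabla p (coord_field M c y p) (coord_field M c x) = 0"
    using torsion_free[OF coord_field_vector_field[OF c(1)] coord_field_vector_field[OF c(1)] p(1)]
      lie_bracket_coord_field[OF c(1) p(1)] by metis
  then show ?thesis by (simp add: p christoffel_symbol_at[OF c(1)])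
qed

text \<open>T may be smaller than the chart image. This serves the induced metric, whose chart
  expression is studied where the immersion maps into a single chart of the ambient
  manifold.\<close>

lemma coord_levi_civitaI:
  assumes c: "c \<in> atlas M" and T: "open T" "T \<subseteq> snd c ` fst c"
    and bil: "\<And>q. q \<in> topspace (mtop M) \<Longrightarrow> bilinear (g q)"
    and sym: "\<And>q x y. q \<in> topspace (mtop M) \<Longrightarrow> g q x y = g q y x"
    and smooth: "\<And>x y. smooth_on T (\<lambda>e. metric_rep M g c e x y)"
  shows "coord_levi_civita T (christoffel_symbol M nabla c) (metric_rep M g c)"
proof (rule coord_levi_civita.intro[OF christoffel.intro coord_levi_civita_axioms.intro])
  show "open T" by (rule T)
  show "smooth_on T (\<lambda>e. christoffel_symbol M nabla c e x y)" for x y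
    by (rule smooth_on_subset[OF christoffel_symbol_smooth[OF c] T(2)])
  show "smooth_on T (\<lambda>e. metric_rep M g c e x y)" for x y by (rule smooth)
  fix e assume e: "e \<in> T"
  then have eU: "e \<in> snd c ` fst c" using T by auto
  then obtain p where p: "p \<in> fst c" "e = snd c p" by auto
  have pt: "p \<in> topspace (mtop M)" using p chart_subset[OF c] by auto
  show "bilinear (christoffel_symbol M nabla c e)" by (rule christoffel_symbol_bilinear[OF c eU])
  show "christoffel_symbol M nabla c e x y = christoffel_symbol M nabla c e y x" for x y
    by (rule christoffel_symbol_sym[OF c eU])
  have h: "metric_rep M g c e x y = g p (coord_field M c x p) (coord_field M c y p)" for x y
    by (simp add: metric_rep_def p c)
  have l: "linear (g p v)" "linear (\<lambda>v. g p v w)" for v w using bil[OF pt] by (auto simp: bilinear_def)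
  show "bilinear (metric_rep M g c e)"
    unfolding bilinear_def h
    using linear_compose[OF coord_field_linear[OF c p(1)] l(1)] linear_compose[OF coord_field_linear[OF c p(1)] l(2)]
    by (simp add: o_def h)
  show "metric_rep M g c e x y = metric_rep M g c e y x" for x y
    unfolding h by (rule sym[OF pt])
  show "frechet_derivative (\<lambda>e. metric_rep M g c e x y) (at e) z =
    metric_rep M g c e (christoffel_symbol M nabla c e z x) y + metric_rep M g c e x (christoffel_symbol M nabla c e z y)" for x y z
  proof -
    let ?f = "\<lambda>r. g r (coord_field M c x r) (coord_field M c y r)"
    have f: "?f \<circ> chart_inv c = (\<lambda>e. metric_rep M g c e x y)" by (simp add: fun_eq_iff metric_rep_def)
    have "(?f \<circ> chart_inv c) differentiable (at (snd c p))"
      unfolding f using smooth_on_differentiable[OF smooth e] by (simp add: p)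
    from dir_deriv_chart[OF c p(1) this, of "coord_field M c z p"]
    have "dir_deriv M p (coord_field M c z p) ?f = frechet_derivative (\<lambda>e. metric_rep M g c e x y) (at e) z"
      unfolding f by (simp add: p c)
    then show ?thesis
      using metric_compatible[OF coord_field_vector_field[OF c] coord_field_vector_field[OF c] p(1), of "coord_field M c z p" x y]
      unfolding h by (simp add: p(2) christoffel_symbol_at[OF c p(1)] c p(1))
  qed
qed

end

text \<open>\<open>pi1 g x y y x\<close> is a Gram determinant. The lemma supplies the
  \<open>plane_basis\<close> condition in the hypothesis of constant totally real
  curvatures.\<close>

lemma independent_pair_if_nondegenerate:
  assumes bil: "bilinear g" and nd: "pi1 g x y y x \<noteq> 0" and sym: "g x y = g y x"
  shows "x \<noteq> y" "independent {x, y}"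
proof -
  have l: "linear (g v)" "linear (\<lambda>v. g v w)" for v w using bil by (auto simp: bilinear_def)
  have n: "x \<notin> span {y}"
  proof
    assume "x \<in> span {y}"
    then obtain k where "x = k *\<^sub>R y" by (auto simp: span_singleton)
    then have "pi1 g x y y x = 0" by (simp add: pi1_def linear_scale[OF l(1)] linear_scale[OF l(2)])
    then show False using nd by simp
  qed
  have "y \<noteq> 0" using nd by (auto simp: pi1_def linear_0[OF l(1)] linear_0[OF l(2)])
  moreover show "x \<noteq> y" using n span_base by blast
  ultimately show "independent {x, y}" using n by (simp add: independent_insert)
qed

locale mfd_kaehler_norden = smooth_mfd M for M :: "('a, 'e::euclidean_space) manifold" +
  fixes J :: "'a \<Rightarrow> 'e \<Rightarrow> 'e" and g :: "'a \<Rightarrow> 'e \<Rightarrow> 'e \<Rightarrow> real" and nabla :: "'a \<Rightarrow> 'e \<Rightarrow> ('a \<Rightarrow> 'e) \<Rightarrow> 'e"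
  assumes kaehler: "kaehler_norden M J g nabla"
begin

sublocale mfd_levi_civita M g nabla
  by unfold_locales (use kaehler in \<open>simp add: kaehler_norden_def\<close>)

lemma pseudo_riemannian: "pseudo_riemannian M g"
  using kaehler by (simp add: kaehler_norden_def)

lemma metric_bilinear: "p \<in> topspace (mtop M) \<Longrightarrow> bilinear (g p)"
  and metric_sym: "p \<in> topspace (mtop M) \<Longrightarrow> g p x y = g p y x"
  using pseudo_riemannian by (auto simp: pseudo_riemannian_def)

lemma norden_space: "p \<in> topspace (mtop M) \<Longrightarrow> norden_space (g p) (J p)"
  using kaehler pseudo_riemannian
  by (intro norden_space.intro) (auto simp: kaehler_norden_def pseudo_riemannian_def)

lemma metric_rep_smooth:
  assumes c: "c \<in> atlas M" shows "smooth_on (snd c ` fst c) (\<lambda>e. metric_rep M g c e x y)"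
proof -
  have "smooth_fun_on M (fst c) (\<lambda>q. g q (coord_field M c x q) (coord_field M c y q))"
    using pseudo_riemannian coord_field_vector_field[OF c] unfolding pseudo_riemannian_def by blast
  then have "smooth_on (snd c ` (fst c \<inter> fst c)) ((\<lambda>q. g q (coord_field M c x q) (coord_field M c y q)) \<circ> chart_inv c)"
    using c unfolding smooth_fun_on_def by blast
  then show ?thesis by (simp add: metric_rep_def o_def)
qed

lemma coord_levi_civita:
  assumes "c \<in> atlas M"
  shows "coord_levi_civita (snd c ` fst c) (christoffel_symbol M nabla c) (metric_rep M g c)"
  by (rule coord_levi_civitaI[OF assms chart_image_open'[OF assms] order_refl metric_bilinear metric_sym metric_rep_smooth[OF assms]])

lemma J_parallel:
  assumes "vector_field_on M W Y"
  shows "vector_field_on M W (\<lambda>q. J q (Y q))" "p \<in> W \<Longrightarrow> nabla p x (\<lambda>q. J q (Y q)) = J p (nabla p x Y)"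
  using kaehler assms by (auto simp: kaehler_norden_def)

text \<open>A parallel J commutes with each covariant derivative in the curvature expression. The
  inner identity holds only on the chart domain, so it passes under the outer derivative by
  locality.\<close>

lemma curvature_J:
  assumes p: "p \<in> topspace (mtop M)"
  shows "curvature M nabla p x y (J p z) = J p (curvature M nabla p x y z)"
proof -
  let ?c = "chart_at M p"
  let ?X = "coord_field M ?c x" and ?Y = "coord_field M ?c y" and ?Z = "coord_field M ?c z"
  note V = coord_field_vector_field[OF chart_at(1)[OF p]] and pc = chart_at(2)[OF p]
  note v = coord_field_chart_at[OF p]
  have N: "nabla p w (\<lambda>q. nabla q (U q) (\<lambda>q. J q (?Z q))) = J p (nabla p w (\<lambda>q. nabla q (U q) ?Z))"
    if U: "vector_field_on M (fst ?c) U" for w U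
  proof -
    have "nabla p w (\<lambda>q. nabla q (U q) (\<lambda>q. J q (?Z q))) = nabla p w (\<lambda>q. J q (nabla q (U q) ?Z))"
      by (rule nabla_cong[OF nabla_field[OF J_parallel(1)[OF V] U] pc]) (rule J_parallel(2)[OF V])
    also have "\<dots> = J p (nabla p w (\<lambda>q. nabla q (U q) ?Z))"
      by (rule J_parallel(2)[OF nabla_field[OF V U] pc])
    finally show ?thesis .
  qed
  have lJ: "linear (J p)" using norden_space[OF p] by (rule norden_space.linear_J)
  show ?thesis
    using curvature_fields[OF pc V V J_parallel(1)[OF V], of x y z] curvature_fields[OF pc V V V, of x y z]
      J_parallel(2)[OF V pc]
    by (simp add: v N[OF V] linear_diff[OF lJ])
qed

lemma kaehler_tensor:
  assumes p: "p \<in> topspace (mtop M)"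
  shows "kaehler_tensor (g p) (J p) (curvature_tensor M g nabla p)"
proof -
  let ?c = "chart_at M p"
  let ?e = "snd ?c p"
  interpret norden_space "g p" "J p" by (rule norden_space[OF p])
  interpret L: coord_levi_civita "snd ?c ` fst ?c" "christoffel_symbol M nabla ?c" "metric_rep M g ?c"
    by (rule coord_levi_civita[OF chart_at(1)[OF p]])
  have e: "?e \<in> snd ?c ` fst ?c" using chart_at(2)[OF p] by auto
  note K = curvature_coord[OF p]
  have h: "metric_rep M g ?c ?e x y = g p x y" for x y
    using chart_at[OF p] coord_field_chart_at[OF p] by (simp add: metric_rep_def)
  show ?thesis
  proof (rule kaehler_tensor.intro[OF norden_space_axioms kaehler_tensor_axioms.intro])
    fix x y z u
    show "linear (curvature_tensor M g nabla p x y z)"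
      unfolding curvature_tensor_def[abs_def] by (rule g_linear)
    show "curvature_tensor M g nabla p x y z u = - curvature_tensor M g nabla p y x z u"
      using L.coord_curvature_skew[of ?e x y z] by (simp add: curvature_tensor_def K g_simps)
    show "curvature_tensor M g nabla p x y z u = - curvature_tensor M g nabla p x y u z"
      using L.coord_curvature_skew_metric[OF e, of x y z u] sym_g
      by (simp add: curvature_tensor_def K h)
    show "curvature_tensor M g nabla p x y z u + curvature_tensor M g nabla p y z x u + curvature_tensor M g nabla p z x y u = 0"
      unfolding curvature_tensor_def K linear_add[OF g_linear(2), symmetric] L.coord_curvature_bianchi[OF e]
      by (simp add: g_simps)
    show "curvature_tensor M g nabla p x y (J p z) u = curvature_tensor M g nabla p x y z (J p u)"
      by (simp add: curvature_tensor_def curvature_J[OF p] gJ)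
  qed
qed

theorem curvature_constant_totally_real:
  assumes p: "p \<in> topspace (mtop M)" and dim: "DIM('e) > 2"
    and const: "constant_totally_real_curvatures M J g nabla \<nu> \<nu>t"
  shows "curvature_tensor M g nabla p x y z u =
    \<nu> p * (pi1 (g p) x y z u - pi2 (g p) (J p) x y z u) + \<nu>t p * pi3 (g p) (J p) x y z u"
proof -
  let ?R = "curvature_tensor M g nabla p"
  interpret kaehler_tensor "g p" "J p" ?R by (rule kaehler_tensor[OF p])
  show ?thesis
  proof (rule constant_totally_real_curvature_tensor[OF dim])
    fix x y assume a: "g p x (J p x) = 0" "g p x (J p y) = 0" "g p y (J p y) = 0" and nd: "pi1 (g p) x y y x \<noteq> 0"
    have yx: "g p y (J p x) = 0" using a(2) gJ[of x y] sym_g[of "J p x" y] by simp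
    have "totally_real_section (g p) (J p) (span {x, y})"
      unfolding totally_real_section_def perp_def
    proof (intro ballI)
      fix v w assume "v \<in> span {x, y}" "w \<in> J p ` span {x, y}"
      then obtain k l k' l' where "v = k *\<^sub>R x + l *\<^sub>R y" "w = J p (k' *\<^sub>R x + l' *\<^sub>R y)"
        by (auto simp: span_insert span_singleton algebra_simps)
      then show "g p v w = 0" by (simp add: g_simps J_simps a yx)
    qed
    moreover have "plane_basis (span {x, y}) x y"
      using independent_pair_if_nondegenerate[OF bilinear_g nd sym_g] by (simp add: plane_basis_def)
    ultimately have "sectional_curvature (g p) ?R x y = \<nu> p" "sectional_curvature (g p) (associated (J p) ?R) x y = \<nu>t p"
      using const p nd unfolding constant_totally_real_curvatures_def nondegenerate_basis_def by blast+
    then show "?R x y y x = \<nu> p * pi1 (g p) x y y x \<and> ?R x y y (J p x) = \<nu>t p * pi1 (g p) x y y x"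
      using nd by (auto simp: sectional_curvature_def associated_def field_simps)
  qed
qed

end

section \<open>Time-like hypersurfaces\<close>

locale timelike_hyp = M': mfd_kaehler_norden M' J g' nabla'
  for M' :: "('a, 'e::euclidean_space) manifold" and J :: "'a \<Rightarrow> 'e \<Rightarrow> 'e"
    and g' :: "'a \<Rightarrow> 'e \<Rightarrow> 'e \<Rightarrow> real" and nabla' :: "'a \<Rightarrow> 'e \<Rightarrow> ('a \<Rightarrow> 'e) \<Rightarrow> 'e" +
  fixes M :: "('b, 'f::euclidean_space) manifold" and \<iota> :: "'b \<Rightarrow> 'a" and N :: "'b \<Rightarrow> 'e"
    and nabla :: "'b \<Rightarrow> 'f \<Rightarrow> ('b \<Rightarrow> 'f) \<Rightarrow> 'f"
  assumes hyp: "timelike_hypersurface M' g' M \<iota> N"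
    and lc: "levi_civita M (induced_metric M' g' M \<iota>) nabla"
begin

sublocale M: mfd_levi_civita M "induced_metric M' g' M \<iota>" nabla
  using hyp lc by unfold_locales (auto simp: timelike_hypersurface_def)

abbreviation "d\<iota> \<equiv> differential M M' \<iota>"

lemma smooth_map_\<iota>: "smooth_map M M' \<iota>"
  using hyp by (simp add: timelike_hypersurface_def)

lemma \<iota>_topspace: "q \<in> topspace (mtop M) \<Longrightarrow> \<iota> q \<in> topspace (mtop M')"
  using smooth_map_\<iota> by (auto simp: smooth_map_def continuous_map_def)

lemma normal:
  assumes "q \<in> topspace (mtop M)"
  shows "inj (d\<iota> q)" "g' (\<iota> q) (N q) (d\<iota> q x) = 0" "g' (\<iota> q) (N q) (N q) = - 1"
  using hyp assms by (auto simp: timelike_hypersurface_def)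

definition \<iota>_rep :: "('b, 'f) chart \<Rightarrow> ('a, 'e) chart \<Rightarrow> 'f \<Rightarrow> 'e" where
  "\<iota>_rep c c' e = snd c' (\<iota> (chart_inv c e))"

definition N_rep :: "('b, 'f) chart \<Rightarrow> ('a, 'e) chart \<Rightarrow> 'f \<Rightarrow> 'e" where
  "N_rep c c' e = tcoord M' c' (\<iota> (chart_inv c e)) (N (chart_inv c e))"

definition rep_dom :: "('b, 'f) chart \<Rightarrow> ('a, 'e) chart \<Rightarrow> 'f set" where
  "rep_dom c c' = snd c ` (fst c \<inter> {q \<in> topspace (mtop M). \<iota> q \<in> fst c'})"

context
  fixes c c' assumes c: "c \<in> atlas M" and c': "c' \<in> atlas M'"
begin

abbreviation (input) "F \<equiv> \<iota>_rep c c'"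
abbreviation (input) "T \<equiv> rep_dom c c'"

lemma rep_dom_iff: "e \<in> T \<longleftrightarrow> (\<exists>q\<in>fst c. e = snd c q \<and> \<iota> q \<in> fst c')"
  unfolding rep_dom_def using M.chart_subset[OF c] by auto

lemma rep_dom_subset: "T \<subseteq> snd c ` fst c"
  by (auto simp: rep_dom_def)

lemma \<iota>_smooth_fun: "smooth_fun_on M {q \<in> topspace (mtop M). \<iota> q \<in> fst c'} (snd c' \<circ> \<iota>)"
  using smooth_map_\<iota> c' by (auto simp: smooth_map_def)

lemma rep_dom_open: "open T"
  unfolding rep_dom_def using \<iota>_smooth_fun by (intro M.chart_image_open[OF c]) (simp add: smooth_fun_on_def)

lemma \<iota>_rep_smooth: "smooth_on T F"
proof -
  have "F = (snd c' \<circ> \<iota>) \<circ> chart_inv c" by (simp add: fun_eq_iff \<iota>_rep_def)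
  then show ?thesis using \<iota>_smooth_fun c by (simp add: smooth_fun_on_def rep_dom_def)
qed

lemma N_rep_smooth: "smooth_on T (N_rep c c')"
proof -
  have "N_rep c c' = (\<lambda>q. tcoord M' c' (\<iota> q) (N q)) \<circ> chart_inv c" by (simp add: fun_eq_iff N_rep_def)
  moreover have "vector_field_along M M' \<iota> N" using hyp by (simp add: timelike_hypersurface_def)
  ultimately show ?thesis using c c' by (simp add: vector_field_along_def smooth_fun_on_def rep_dom_def)
qed

lemma \<iota>_rep_at: "q \<in> fst c \<Longrightarrow> F (snd c q) = snd c' (\<iota> q)"
  by (simp add: \<iota>_rep_def c)

lemma \<iota>_rep_image: "F ` T \<subseteq> snd c' ` fst c'"
  by (auto simp: rep_dom_iff \<iota>_rep_at)

text \<open>\<open>differential\<close> refers to the charts chosen at q and at \<iota> q; to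
  differentiate it in q, both charts must be held fixed.\<close>

lemma differential_coord:
  assumes q: "q \<in> fst c" "\<iota> q \<in> fst c'"
  shows "d\<iota> q v = coord_field M' c' (frechet_derivative F (at (snd c q)) (tcoord M c q v)) (\<iota> q)"
proof -
  define b where "b = chart_at M' (\<iota> q)"
  have b: "b \<in> atlas M'" "\<iota> q \<in> fst b" using M'.chart_at'[OF c' q(2)] by (simp_all add: b_def)
  let ?e = "snd c q"
  have e: "?e \<in> T" using q by (auto simp: rep_dom_iff)
  have "((snd b \<circ> chart_inv c') has_derivative transition_deriv c' b (\<iota> q)) (at (F ?e))"
    using M'.transition_has_derivative[OF c' b(1) q(2) b(2)] q by (simp add: \<iota>_rep_at)
  from has_derivative_compose[where f = F and g = "snd b \<circ> chart_inv c'",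
      OF smooth_on_has_derivative[OF \<iota>_rep_smooth e] this]
  have "((\<lambda>e. (snd b \<circ> chart_inv c') (F e)) has_derivative
      (\<lambda>v. transition_deriv c' b (\<iota> q) (frechet_derivative F (at ?e) v))) (at ?e)" .
  then have D: "(((snd b \<circ> \<iota>) \<circ> chart_inv c) has_derivative
      (\<lambda>v. transition_deriv c' b (\<iota> q) (frechet_derivative F (at ?e) v))) (at ?e)"
    by (rule has_derivative_transform_within_open[OF _ rep_dom_open e])
      (auto simp: rep_dom_iff \<iota>_rep_at c c')
  then have "((snd b \<circ> \<iota>) \<circ> chart_inv c) differentiable (at ?e)" by (auto simp: differentiable_def)
  from M.dir_deriv_chart[OF c q(1) this, of v] show ?thesis
    unfolding differential_def b_def[symmetric] M'.coord_field_eq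
    by (simp add: frechet_derivative_at[OF D, symmetric])
qed

lemma metric_rep_induced:
  assumes e: "e \<in> T"
  shows "metric_rep M (induced_metric M' g' M \<iota>) c e x y =
    metric_rep M' g' c' (F e) (frechet_derivative F (at e) x) (frechet_derivative F (at e) y)"
proof -
  obtain q where q: "q \<in> fst c" "e = snd c q" "\<iota> q \<in> fst c'" using e by (auto simp: rep_dom_iff)
  show ?thesis
    by (simp add: metric_rep_def induced_metric_def q c c' \<iota>_rep_at differential_coord)
qed

end

lemma differential_linear:
  assumes q: "q \<in> topspace (mtop M)" shows "linear (d\<iota> q)"
proof -
  let ?c = "chart_at M q" and ?c' = "chart_at M' (\<iota> q)"
  note c = M.chart_at[OF q] and c' = M'.chart_at[OF \<iota>_topspace[OF q]]
  have e: "snd ?c q \<in> rep_dom ?c ?c'" using c c' by (auto simp: rep_dom_iff)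
  have "d\<iota> q = (\<lambda>v. frechet_derivative (\<iota>_rep ?c ?c') (at (snd ?c q)) v)"
    using differential_coord[OF c(1) c'(1) c(2) c'(2)] M'.coord_field_chart_at[OF \<iota>_topspace[OF q]] M.tcoord_chart_at[OF q]
    by (simp add: fun_eq_iff)
  then show ?thesis
    using linear_frechet_derivative[OF smooth_on_differentiable[OF \<iota>_rep_smooth[OF c(1) c'(1)] e]] by simp
qed

text \<open>N is not orthogonal to itself, so its orthogonal complement is proper. In codimension
  one the injective differential then fills it.\<close>

lemma range_differential:
  assumes q: "q \<in> topspace (mtop M)"
  shows "range (d\<iota> q) = {v. g' (\<iota> q) (N q) v = 0}"
proof (rule subspace_dim_equal)
  have l: "linear (g' (\<iota> q) (N q))"
    using M'.metric_bilinear[OF \<iota>_topspace[OF q]] by (simp add: bilinear_def)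
  show "subspace (range (d\<iota> q))"
    by (rule linear_subspace_image[OF differential_linear[OF q] subspace_UNIV])
  show ker: "subspace {v. g' (\<iota> q) (N q) v = 0}" by (rule linear_subspace_kernel[OF l])
  show "range (d\<iota> q) \<subseteq> {v. g' (\<iota> q) (N q) v = 0}" using normal(2)[OF q] by auto
  have "N q \<notin> {v. g' (\<iota> q) (N q) v = 0}" using normal(3)[OF q] by simp
  then have "span {v. g' (\<iota> q) (N q) v = 0} \<noteq> UNIV" using ker by (metis UNIV_I span_eq_iff)
  then have "dim {v. g' (\<iota> q) (N q) v = 0} < DIM('e)"
    using dim_eq_full dim_subset_UNIV le_neq_implies_less by metis
  moreover have "dim (range (d\<iota> q)) = DIM('f)"
    using dim_image_eq[of "d\<iota> q" UNIV] differential_linear[OF q] normal(1)[OF q] by simp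
  moreover have "DIM('e) = DIM('f) + 1" using hyp by (simp add: timelike_hypersurface_def)
  ultimately show "dim {v. g' (\<iota> q) (N q) v = 0} \<le> dim (range (d\<iota> q))" by simp
qed

lemma d_tangent_part:
  assumes q: "q \<in> topspace (mtop M)" and v: "g' (\<iota> q) (N q) v = 0"
  shows "d\<iota> q (tangent_part M' M \<iota> q v) = v"
proof -
  obtain x where x: "v = d\<iota> q x" using range_differential[OF q] v by auto
  have "tangent_part M' M \<iota> q v = x"
    unfolding tangent_part_def x by (rule the_equality) (auto dest: injD[OF normal(1)[OF q]])
  then show ?thesis using x by simp
qed

context
  fixes p assumes p: "p \<in> topspace (mtop M)"
begin

abbreviation (input) "g \<equiv> induced_metric M' g' M \<iota> p"
abbreviation (input) "A \<equiv> second_fundamental_tensor M' nabla' M \<iota> N p"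

lemma g_eq: "g x y = g' (\<iota> p) (d\<iota> p x) (d\<iota> p y)"
  by (simp add: induced_metric_def)

text \<open>The charts are those chosen at p and at \<iota> p, in which components at the base
  points are the tangent vectors themselves. This turns the coordinate equation of Gauss into the
  invariant one.\<close>

theorem gauss_weingarten:
  shows "curvature_tensor M (induced_metric M' g' M \<iota>) nabla p x y z u =
      curvature_tensor M' g' nabla' (\<iota> p) (d\<iota> p x) (d\<iota> p y) (d\<iota> p z) (d\<iota> p u) - pi1 g (A x) (A y) z u"
    and "g (A x) y = g x (A y)" and "linear A"
proof -
  note p' = \<iota>_topspace[OF p]
  define c where "c = chart_at M p"
  define c' where "c' = chart_at M' (\<iota> p)"
  have c: "c \<in> atlas M" "p \<in> fst c" using M.chart_at[OF p] by (simp_all add: c_def)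
  have c': "c' \<in> atlas M'" "\<iota> p \<in> fst c'" using M'.chart_at[OF p'] by (simp_all add: c'_def)
  note cc = c(1) c'(1)
  define F where "F = \<iota>_rep c c'"
  define T where "T = rep_dom c c'"
  define e where "e = snd c p"
  define \<Gamma> where "\<Gamma> = christoffel_symbol M' nabla' c'"
  define h where "h = metric_rep M' g' c'"
  define Nr where "Nr = N_rep c c'"
  have e: "e \<in> T" using c c' by (auto simp: e_def T_def rep_dom_iff[OF cc])
  have Fe: "F e = snd c' (\<iota> p)" by (simp add: F_def e_def \<iota>_rep_at[OF cc] c)
  have cf: "coord_field M c v p = v" "coord_field M' c' w (\<iota> p) = w" "tcoord M c p v = v" "tcoord M' c' (\<iota> p) w = w" for v w
    using M.coord_field_chart_at[OF p] M'.coord_field_chart_at[OF p'] M.tcoord_chart_at[OF p] M'.tcoord_chart_at[OF p']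
    by (simp_all add: c_def c'_def)
  have DF: "frechet_derivative F (at e) v = d\<iota> p v" for v
    using differential_coord[OF cc c(2) c'(2), of v] by (simp add: cf F_def e_def)
  have hp: "h (F e) v w = g' (\<iota> p) v w" for v w by (simp add: h_def metric_rep_def Fe c' cf)
  have Np: "Nr e = N p" by (simp add: Nr_def N_rep_def e_def c cf)
  interpret L': coord_levi_civita "snd c' ` fst c'" \<Gamma> h
    unfolding \<Gamma>_def h_def by (rule M'.coord_levi_civita[OF c'(1)])
  have T: "open T" "T \<subseteq> snd c ` fst c"
    using rep_dom_open[OF cc] rep_dom_subset[OF cc] by (simp_all add: T_def)
  have F: "F ` T \<subseteq> snd c' ` fst c'" "smooth_on T F"
    using \<iota>_rep_image[OF cc] \<iota>_rep_smooth[OF cc] by (simp_all add: F_def T_def)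
  have Nsm: "smooth_on T Nr" using N_rep_smooth[OF cc] by (simp add: Nr_def T_def)
  let ?h0 = "\<lambda>e x y. h (F e) (frechet_derivative F (at e) x) (frechet_derivative F (at e) y)"
  let ?m0 = "metric_rep M (induced_metric M' g' M \<iota>) c"
  have h0: "?m0 e x y = ?h0 e x y" if "e \<in> T" for e x y
    using metric_rep_induced[OF cc] that by (simp add: h_def F_def T_def)
  have sm_h0: "smooth_on T (\<lambda>e. ?h0 e x y)" for x y
    by (rule smooth_on_bilinear_family[where B = h and F = F and S = "snd c' ` fst c'"])
      (use T F L'.open_S L'.bilinear_h L'.smooth_h smooth_on_frechet in auto)
  have bil: "bilinear (induced_metric M' g' M \<iota> q)" if q: "q \<in> topspace (mtop M)" for q
  proof -
    have "linear (g' (\<iota> q) v)" "linear (\<lambda>v. g' (\<iota> q) v w)" for v w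
      using M'.metric_bilinear[OF \<iota>_topspace[OF q]] by (simp_all add: bilinear_def)
    then show ?thesis
      unfolding bilinear_def induced_metric_def
      using linear_compose[OF differential_linear[OF q]] by (auto simp: o_def)
  qed
  have sym: "induced_metric M' g' M \<iota> q x y = induced_metric M' g' M \<iota> q y x" if "q \<in> topspace (mtop M)" for q x y
    unfolding induced_metric_def by (rule M'.metric_sym[OF \<iota>_topspace[OF that]])
  define \<Gamma>0 where "\<Gamma>0 = christoffel_symbol M nabla c"
  have lc_m0: "coord_levi_civita T \<Gamma>0 ?m0"
    unfolding \<Gamma>0_def
    by (rule M.coord_levi_civitaI[OF c(1) T bil sym smooth_on_cong[OF T(1) sm_h0 h0[symmetric]]])
  \<comment> \<open>The chart expression of the induced metric agrees with the pulled back form only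
    on T, so the locale is transferred to the form that \<open>gauss_equation_coord\<close>
    expects.\<close>
  have lc_h0: "coord_levi_civita T \<Gamma>0 ?h0"
  proof -
    interpret m0: coord_levi_civita T \<Gamma>0 ?m0 by (rule lc_m0)
    have eq: "?h0 e = ?m0 e" if "e \<in> T" for e using h0[OF that] by (simp add: fun_eq_iff)
    show ?thesis
    proof (rule coord_levi_civita.intro[OF m0.christoffel_axioms coord_levi_civita_axioms.intro])
      fix e x y z assume e: "e \<in> T"
      show "bilinear (?h0 e)" unfolding eq[OF e] by (rule m0.bilinear_h[OF e])
      show "?h0 e x y = ?h0 e y x" using m0.sym_h[OF e, of x y] h0[OF e] by simp
      show "frechet_derivative (\<lambda>e. ?h0 e x y) (at e) z = ?h0 e (\<Gamma>0 e z x) y + ?h0 e x (\<Gamma>0 e z y)"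
        using m0.compat[OF e, of x y z] h0[OF e]
          frechet_derivative_transform_within_open[where f = "\<lambda>e. ?h0 e x y" and g = "\<lambda>e. ?m0 e x y",
            OF smooth_on_differentiable[OF sm_h0 e] T(1) e h0[symmetric]]
        by simp
    qed (rule sm_h0)
  qed
  have NF: "h (F e) (Nr e) (frechet_derivative F (at e) x) = 0" and NN: "h (F e) (Nr e) (Nr e) = - 1" if "e \<in> T" for e x
  proof -
    obtain q where q: "q \<in> fst c" "e = snd c q" "\<iota> q \<in> fst c'"
      using \<open>e \<in> T\<close> by (auto simp: T_def rep_dom_iff[OF cc])
    have qt: "q \<in> topspace (mtop M)" using q M.chart_subset[OF c(1)] by auto
    show "h (F e) (Nr e) (frechet_derivative F (at e) x) = 0" "h (F e) (Nr e) (Nr e) = - 1"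
      using normal(2)[OF qt, of "coord_field M c x q"] normal(3)[OF qt]
      by (simp_all add: h_def F_def Nr_def metric_rep_def N_rep_def q c c' \<iota>_rep_at[OF cc] differential_coord[OF cc])
  qed
  have tang: "v \<in> range (frechet_derivative F (at e))" if "h (F e) (Nr e) v = 0" for v
  proof -
    have "frechet_derivative F (at e) = d\<iota> p" using DF by (simp add: fun_eq_iff)
    then show ?thesis using that range_differential[OF p] by (simp add: hp Np)
  qed
  define C where "C x = cov_along \<Gamma> F e x Nr" for x
  have cov: "cov_deriv_along M M' nabla' \<iota> p x N = C x" for x
  proof -
    have dN: "Nr differentiable (at e)" by (rule smooth_on_differentiable[OF Nsm e])
    have D: "dir_deriv M p x (\<lambda>q. tcoord M' c' (\<iota> q) (N q) \<bullet> b) = frechet_derivative Nr (at e) x \<bullet> b" for b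
      unfolding dir_deriv_def c_def[symmetric] e_def[symmetric]
      using frechet_derivative_inner[OF dN, of b x] by (simp add: o_def Nr_def N_rep_def)
    have G: "nabla' (\<iota> p) (d\<iota> p x) (coord_field M' c' b) = \<Gamma> (F e) (d\<iota> p x) b" for b
      using M'.christoffel_symbol_at[OF c'] by (simp add: \<Gamma>_def Fe cf)
    have "linear (\<Gamma> (F e) (d\<iota> p x))" using L'.\<Gamma>_linear F e by auto
    from linear_apply_basis[OF this, of "N p"]
    show ?thesis
      unfolding cov_deriv_along_def Let_def c'_def[symmetric] D G C_def cov_along_def DF Np
      by (simp add: cf sum.distrib euclidean_representation)
  qed
  have Fe_S: "F e \<in> snd c' ` fst c'" using F e by auto
  \<comment> \<open>Differentiating the constant g'(N,N) = -1 shows that the derivative of N is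
    tangent, so that \<open>tangent_part\<close> in the definition of A inverts the
    differential.\<close>
  have CN: "h (F e) (C x) (Nr e) = 0" for x
  proof -
    have "((\<lambda>e. h (F e) (Nr e) (Nr e)) has_derivative (\<lambda>_. 0)) (at e)"
      by (rule has_derivative_transform_within_open[OF has_derivative_const T(1) e]) (simp add: NN)
    from fun_cong[OF has_derivative_unique[OF L'.metric_along[where F = F, OF Fe_S smooth_on_differentiable[OF F(2) e]
          smooth_on_differentiable[OF Nsm e] smooth_on_differentiable[OF Nsm e]] this], of x]
    show ?thesis using L'.sym_h[OF Fe_S] by (simp add: C_def)
  qed
  have dA: "d\<iota> p (A x) = - C x" for x
    unfolding second_fundamental_tensor_def cov
  proof (rule d_tangent_part[OF p])
    show "g' (\<iota> p) (N p) (- C x) = 0"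
      using CN[of x] L'.sym_h[OF Fe_S, of "C x" "Nr e"] linear_neg[OF L'.h_linear(1)[OF Fe_S]]
      by (simp add: hp[symmetric] Np[symmetric])
  qed
  have gA: "g (A x) y = - h (F e) (C x) (frechet_derivative F (at e) y)" for x y
    unfolding g_eq dA DF hp[symmetric] by (rule linear_neg[OF L'.h_linear(2)[OF Fe_S]])
  note gauss = L'.gauss_equation_coord[OF lc_h0 F Nsm NF e NN[OF e] tang, folded C_def gA]
  have gsym: "g x y = g y x" for x y by (rule sym[OF p])
  show "g (A x) y = g x (A y)"
    using gauss(2)[of x y] gA gsym by metis
  show "curvature_tensor M (induced_metric M' g' M \<iota>) nabla p x y z u =
      curvature_tensor M' g' nabla' (\<iota> p) (d\<iota> p x) (d\<iota> p y) (d\<iota> p z) (d\<iota> p u) - pi1 g (A x) (A y) z u"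
    using gauss(1)[of x y z u]
    unfolding curvature_tensor_def M.curvature_coord[OF p] M'.curvature_coord[OF p']
      c_def[symmetric] c'_def[symmetric] \<Gamma>_def[symmetric] \<Gamma>0_def[symmetric] e_def[symmetric] Fe[symmetric]
    by (simp add: DF hp g_eq[symmetric] pi1_def gA)
  show "linear A"
  proof (rule linearI)
    have lC: "C (x + y) = C x + C y" "C (r *\<^sub>R x) = r *\<^sub>R C x" for x y r
    proof -
      have l1: "linear (frechet_derivative Nr (at e))"
        by (rule linear_frechet_derivative[OF smooth_on_differentiable[OF Nsm e]])
      have l2: "linear (\<lambda>v. \<Gamma> (F e) v (Nr e))" by (rule L'.\<Gamma>_linear(2)[OF Fe_S])
      show "C (x + y) = C x + C y" "C (r *\<^sub>R x) = r *\<^sub>R C x"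
        unfolding C_def cov_along_def DF
        by (simp_all add: linear_add[OF l1] linear_scale[OF l1] linear_add[OF differential_linear[OF p]]
            linear_scale[OF differential_linear[OF p]] linear_add[OF l2] linear_scale[OF l2] scaleR_add_right)
    qed
    note d = linear_add[OF differential_linear[OF p]] linear_scale[OF differential_linear[OF p]]
    show "A (x + y) = A x + A y" for x y
      by (rule injD[OF normal(1)[OF p]]) (simp add: dA d lC)
    show "A (r *\<^sub>R x) = r *\<^sub>R A x" for r x
      by (rule injD[OF normal(1)[OF p]]) (simp add: dA d lC)
  qed
qed

end

end

section \<open>The almost contact structure and the curvature formula\<close>

context timelike_hyp
begin

context
  fixes p assumes p: "p \<in> topspace (mtop M)"
begin

abbreviation (input) "t \<equiv> hyp_t J g' \<iota> N p"
abbreviation (input) "\<phi> \<equiv> hyp_phi M' J g' M \<iota> N p"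
abbreviation (input) "\<xi> \<equiv> hyp_xi M' J g' M \<iota> N p"
abbreviation (input) "\<eta> \<equiv> hyp_eta M' J g' M \<iota> N p"
abbreviation (input) "JN \<equiv> J (\<iota> p) (N p)"
abbreviation (input) "g'p \<equiv> g' (\<iota> p)"
abbreviation (input) "gp \<equiv> induced_metric M' g' M \<iota> p"

interpretation ns: norden_space g'p "J (\<iota> p)"
  by (rule M'.norden_space[OF \<iota>_topspace[OF p]])

lemma cos_t: "cos t > 0"
  unfolding hyp_t_def by (intro cos_gt_zero_pi arctan_lbound arctan_ubound)

lemma g'_N: "g'p (N p) (N p) = - 1" "g'p JN JN = 1" "g'p (d\<iota> p x) (N p) = 0" "g'p (N p) (d\<iota> p x) = 0"
    "cos t * g'p (N p) JN = sin t" "cos t * g'p JN (N p) = sin t" 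
proof -
  show 1: "g'p (N p) (N p) = - 1" and 2: "g'p (N p) (d\<iota> p x) = 0" using normal[OF p] by auto
  then show "g'p JN JN = 1" "g'p (d\<iota> p x) (N p) = 0" using ns.gJJ ns.sym_g by auto
  have "tan t = g'p (N p) JN" by (simp add: hyp_t_def tan_arctan)
  then show "cos t * g'p (N p) JN = sin t" using cos_t by (simp add: tan_def field_simps)
  then show "cos t * g'p JN (N p) = sin t" using ns.sym_g by metis
qed

lemma \<eta>_eq: "\<eta> x = cos t * g'p (d\<iota> p x) JN"
  by (simp add: hyp_eta_def)

text \<open>J x has normal pairing g'(x,JN). The correcting vector is scaled so that cos t times its
  pairing with N is -1, by sin^2 + cos^2 = 1; it cancels the normal part exactly.\<close>

lemma d\<phi>: "d\<iota> p (\<phi> x) = J (\<iota> p) (d\<iota> p x) + \<eta> x *\<^sub>R (cos t *\<^sub>R N p - sin t *\<^sub>R JN)"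
  unfolding hyp_phi_def Let_def \<eta>_eq
proof (rule d_tangent_part[OF p])
  have "cos t * g'p (N p) (cos t *\<^sub>R N p - sin t *\<^sub>R JN) = - (cos t * cos t) - sin t * (cos t * g'p (N p) JN)"
    by (simp add: ns.g_simps g'_N(1) algebra_simps)
  also have "\<dots> = - ((sin t)\<^sup>2 + (cos t)\<^sup>2)" unfolding g'_N(5) by (simp add: power2_eq_square)
  finally have "cos t * g'p (N p) (cos t *\<^sub>R N p - sin t *\<^sub>R JN) = - ((sin t)\<^sup>2 + (cos t)\<^sup>2)" .
  then have v: "cos t * g'p (N p) (cos t *\<^sub>R N p - sin t *\<^sub>R JN) = - 1" by simp
  have "g'p (N p) (J (\<iota> p) (d\<iota> p x) + (cos t * g'p (d\<iota> p x) JN) *\<^sub>R (cos t *\<^sub>R N p - sin t *\<^sub>R JN))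
     = g'p (N p) (J (\<iota> p) (d\<iota> p x)) + g'p (d\<iota> p x) JN * (cos t * g'p (N p) (cos t *\<^sub>R N p - sin t *\<^sub>R JN))"
    by (simp add: linear_add[OF ns.g_linear(1)] linear_scale[OF ns.g_linear(1)])
  also have "\<dots> = 0" unfolding v using ns.gJ[of "d\<iota> p x" "N p"] ns.sym_g[of "N p"] by simp
  finally show "g'p (N p) (J (\<iota> p) (d\<iota> p x) + (cos t * g'p (d\<iota> p x) JN) *\<^sub>R (cos t *\<^sub>R N p - sin t *\<^sub>R JN)) = 0" .
qed

lemma d\<xi>: "d\<iota> p \<xi> = sin t *\<^sub>R N p + cos t *\<^sub>R JN"
  unfolding hyp_xi_def Let_def
  by (rule d_tangent_part[OF p]) (use g'_N in \<open>simp add: ns.g_simps\<close>)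

text \<open>Both parts of \<phi> x are orthogonal to JN: the first because x is orthogonal to N, the
  second because cos t g'(N,JN) = sin t.\<close>

lemma \<eta>\<phi>: "\<eta> (\<phi> x) = 0"
proof -
  have "g'p (J (\<iota> p) (d\<iota> p x)) JN = 0" using ns.gJJ g'_N by simp
  moreover have "g'p (cos t *\<^sub>R N p - sin t *\<^sub>R JN) JN = 0" using g'_N by (simp add: ns.g_simps)
  ultimately show ?thesis unfolding \<eta>_eq[of "\<phi> x"] d\<phi>
    by (simp add: linear_add[OF ns.g_linear(2)] linear_scale[OF ns.g_linear(2)])
qed

lemma \<eta>\<xi>: "\<eta> \<xi> = 1"
proof -
  have "\<eta> \<xi> = sin t * (cos t * g'p (N p) JN) + cos t * cos t"
    unfolding \<eta>_eq d\<xi> using g'_N(2) by (simp add: ns.g_simps algebra_simps)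
  also have "\<dots> = (sin t)\<^sup>2 + (cos t)\<^sup>2" unfolding g'_N(5) by (simp add: power2_eq_square)
  finally show ?thesis by simp
qed

text \<open>Since \<eta> vanishes on \<phi> x, the second application of \<phi> is plain J, and J
  maps cos t N - sin t JN to \<xi>.\<close>

lemma \<phi>\<phi>: "\<phi> (\<phi> x) = - x + \<eta> x *\<^sub>R \<xi>"
proof (rule injD[OF normal(1)[OF p]])
  note d = linear_add[OF differential_linear[OF p]] linear_scale[OF differential_linear[OF p]] linear_diff[OF differential_linear[OF p]]
  have "d\<iota> p (\<phi> (\<phi> x)) = J (\<iota> p) (d\<iota> p (\<phi> x))" unfolding d\<phi>[of "\<phi> x"] by (simp add: \<eta>\<phi>)
  also have "\<dots> = - d\<iota> p x + \<eta> x *\<^sub>R (sin t *\<^sub>R N p + cos t *\<^sub>R JN)"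
    unfolding d\<phi> by (simp add: ns.J_simps algebra_simps)
  finally show "d\<iota> p (\<phi> (\<phi> x)) = d\<iota> p (- x + \<eta> x *\<^sub>R \<xi>)" by (simp add: d d\<xi>)
qed

lemma \<phi>\<xi>: "\<phi> \<xi> = 0"
proof (rule injD[OF normal(1)[OF p]])
  show "d\<iota> p (\<phi> \<xi>) = d\<iota> p 0"
    unfolding d\<phi> by (simp add: \<eta>\<xi> d\<xi> ns.J_simps linear_0[OF differential_linear[OF p]])
qed

lemma gp_\<xi>: "gp x \<xi> = \<eta> x"
  by (simp add: g_eq[OF p] d\<xi> \<eta>_eq ns.g_simps g'_N)

text \<open>The N-part of the correction is orthogonal to x; the JN-part contributes sin t g'(x,JN),
  which equals tan t \<eta>(x). Every tan t in the result originates here.\<close>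

lemma g'_J: "g'p (d\<iota> p x) (J (\<iota> p) (d\<iota> p y)) = gp x (\<phi> y) + tan t * \<eta> x * \<eta> y"
proof -
  have "gp x (\<phi> y) = g'p (d\<iota> p x) (J (\<iota> p) (d\<iota> p y)) - \<eta> y * (sin t * g'p (d\<iota> p x) JN)"
    by (simp add: g_eq[OF p] d\<phi> ns.g_simps g'_N)
  moreover have "sin t * g'p (d\<iota> p x) JN = tan t * \<eta> x"
    using cos_t by (simp add: \<eta>_eq tan_def)
  ultimately show ?thesis by (simp add: algebra_simps)
qed

lemma gp_sym: "gp x y = gp y x"
  unfolding g_eq[OF p] by (rule ns.sym_g)

lemma gp_\<phi>: "gp (\<phi> x) y = gp x (\<phi> y)"
proof -
  have "g'p (d\<iota> p x) (J (\<iota> p) (d\<iota> p y)) = g'p (d\<iota> p y) (J (\<iota> p) (d\<iota> p x))"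
    using ns.gJ ns.sym_g by metis
  then show ?thesis unfolding g'_J using gp_sym by simp
qed

lemma bilinear_gp: "bilinear gp"
  unfolding bilinear_def g_eq[OF p]
  using linear_compose[OF differential_linear[OF p] ns.g_linear(1)] linear_compose[OF differential_linear[OF p] ns.g_linear(2)]
  by (simp add: o_def g_eq[OF p])

lemma linear_\<eta>: "linear \<eta>"
  by (rule linearI)
    (simp_all add: \<eta>_eq linear_add[OF differential_linear[OF p]] linear_scale[OF differential_linear[OF p]] ns.g_simps algebra_simps)

lemma linear_\<phi>: "linear \<phi>"
proof (rule linearI)
  note d = linear_add[OF differential_linear[OF p]] linear_scale[OF differential_linear[OF p]]
  show "\<phi> (x + y) = \<phi> x + \<phi> y" for x y
    by (rule injD[OF normal(1)[OF p]])
      (simp add: d d\<phi> ns.J_simps linear_add[OF linear_\<eta>] algebra_simps)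
  show "\<phi> (r *\<^sub>R x) = r *\<^sub>R \<phi> x" for r x
    by (rule injD[OF normal(1)[OF p]])
      (simp add: d d\<phi> ns.J_simps linear_scale[OF linear_\<eta>] algebra_simps)
qed

theorem curvature_hypersurface:
  assumes dim: "DIM('e) > 2" and const: "constant_totally_real_curvatures M' J g' nabla' \<nu>' \<nu>t'"
  shows "curvature_tensor M (induced_metric M' g' M \<iota>) nabla p x y z u =
    \<nu>' (\<iota> p) * (pi1 gp x y z u - pi2 gp \<phi> x y z u - tan t * pi5 gp \<phi> \<eta> x y z u)
    + \<nu>t' (\<iota> p) * (pi3 gp \<phi> x y z u - tan t * pi4 gp \<eta> x y z u) - pi1 gp (A p x) (A p y) z u"
proof -
  let ?x = "d\<iota> p x" and ?y = "d\<iota> p y" and ?z = "d\<iota> p z" and ?u = "d\<iota> p u"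
  have 1: "pi1 g'p ?x ?y ?z ?u = pi1 gp x y z u"
    by (simp add: pi1_def g_eq[OF p])
  \<comment> \<open>The terms in tan^2 t carry the symmetric product of all four values of \<eta>
    and cancel in the difference.\<close>
  have 2: "pi2 g'p (J (\<iota> p)) ?x ?y ?z ?u = pi2 gp \<phi> x y z u + tan t * pi5 gp \<phi> \<eta> x y z u"
    by (simp add: pi2_def pi5_def g'_J algebra_simps)
  have 3: "pi3 g'p (J (\<iota> p)) ?x ?y ?z ?u = pi3 gp \<phi> x y z u - tan t * pi4 gp \<eta> x y z u"
    by (simp add: pi3_def pi4_def g'_J g_eq[OF p, symmetric] algebra_simps)
  show ?thesis
    unfolding gauss_weingarten(1)[OF p] M'.curvature_constant_totally_real[OF \<iota>_topspace[OF p] dim const] 1 2 3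
    by (simp add: algebra_simps)
qed

end

end

theorem proposition2p1:
  fixes M' :: "('a, real ^ 'm) manifold"
    and J :: "'a \<Rightarrow> real ^ 'm \<Rightarrow> real ^ 'm"
    and g' :: "'a \<Rightarrow> real ^ 'm \<Rightarrow> real ^ 'm \<Rightarrow> real"
    and nabla' :: "'a \<Rightarrow> real ^ 'm \<Rightarrow> ('a \<Rightarrow> real ^ 'm) \<Rightarrow> real ^ 'm"
    and \<nu>' \<nu>t' :: "'a \<Rightarrow> real"
    and M :: "('b, real ^ 'k) manifold"
    and \<iota> :: "'b \<Rightarrow> 'a"
    and N :: "'b \<Rightarrow> real ^ 'm"
    and nabla :: "'b \<Rightarrow> real ^ 'k \<Rightarrow> ('b \<Rightarrow> real ^ 'k) \<Rightarrow> real ^ 'k"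
    and n :: nat
    and p :: 'b
    and g :: "real ^ 'k \<Rightarrow> real ^ 'k \<Rightarrow> real"
    and \<phi> A :: "real ^ 'k \<Rightarrow> real ^ 'k"
    and \<xi> :: "real ^ 'k"
    and \<eta> :: "real ^ 'k \<Rightarrow> real"
    and t \<nu> \<nu>t :: real
    and R :: "real ^ 'k \<Rightarrow> real ^ 'k \<Rightarrow> real ^ 'k \<Rightarrow> real ^ 'k \<Rightarrow> real"
  assumes "CARD('m) = 2 * n + 2" and "2 * n + 2 \<ge> 4" and "CARD('k) = 2 * n + 1"
    and "kaehler_norden M' J g' nabla'"
    and "constant_totally_real_curvatures M' J g' nabla' \<nu>' \<nu>t'"
    and "timelike_hypersurface M' g' M \<iota> N"
    and "levi_civita M (induced_metric M' g' M \<iota>) nabla"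
    and "p \<in> topspace (mtop M)"
    and "g = induced_metric M' g' M \<iota> p"
    and "t = hyp_t J g' \<iota> N p"
    and "\<phi> = hyp_phi M' J g' M \<iota> N p"
    and "\<xi> = hyp_xi M' J g' M \<iota> N p"
    and "\<eta> = hyp_eta M' J g' M \<iota> N p"
    and "A = second_fundamental_tensor M' nabla' M \<iota> N p"
    and "R = curvature_tensor M (induced_metric M' g' M \<iota>) nabla p"
    and "\<nu> = \<nu>' (\<iota> p)" and "\<nu>t = \<nu>t' (\<iota> p)"
  shows
    "(\<forall>x y z u. R x y z u =
        \<nu> * (pi1 g x y z u - pi2 g \<phi> x y z u - tan t * pi5 g \<phi> \<eta> x y z u)
        + \<nu>t * (pi3 g \<phi> x y z u - tan t * pi4 g \<eta> x y z u)
        - pi1 g (A x) (A y) z u) \<and>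
     (\<forall>B ginv. basis_with_inverse_metric g B ginv \<longrightarrow>
        scalar_contraction B ginv R =
          4 * (real n)\<^sup>2 * \<nu> - 4 * real n * \<nu>t * tan t
          - (trace (matrix A))\<^sup>2 + trace (matrix (A \<circ> A))) \<and>
     (\<forall>B ginv. basis_with_inverse_metric g B ginv \<longrightarrow>
        scalar_contraction B ginv (associated \<phi> R) =
          2 * real n * \<nu> * tan t + 2 * real n * (2 * real n - 1) * \<nu>t
          - trace (matrix A) * trace (matrix (A \<circ> \<phi>)) + trace (matrix (A \<circ> A \<circ> \<phi>))) \<and>
     (\<forall>\<alpha> x. plane_basis \<alpha> \<xi> x \<and> nondegenerate_basis g \<xi> x \<and> xi_section \<xi> \<alpha> \<longrightarrow>
        sectional_curvature g R \<xi> x =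
          \<nu> - \<nu>t * tan t - (\<nu> * tan t + \<nu>t) * (g x (\<phi> x) / (g x x - (\<eta> x)\<^sup>2))
          - pi1 g (A \<xi>) (A x) x \<xi> / (g x x - (\<eta> x)\<^sup>2)) \<and>
     (\<forall>\<alpha> x. plane_basis \<alpha> (\<phi> x) (\<phi> (\<phi> x)) \<and> nondegenerate_basis g (\<phi> x) (\<phi> (\<phi> x)) \<and>
           holomorphic_section \<phi> \<alpha> \<longrightarrow>
        sectional_curvature g R (\<phi> x) (\<phi> (\<phi> x)) =
          - (pi1 g (A (\<phi> x)) (A (\<phi> (\<phi> x))) (\<phi> (\<phi> x)) (\<phi> x)
             / pi1 g (\<phi> x) (\<phi> (\<phi> x)) (\<phi> (\<phi> x)) (\<phi> x))) \<and>
     (\<forall>\<alpha> x y. plane_basis \<alpha> x y \<and> nondegenerate_basis g x y \<and> totally_real_section g \<phi> \<alpha> \<and>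
           perp g \<alpha> {\<xi>} \<longrightarrow>
        sectional_curvature g R x y =
          \<nu> - pi1 g (A x) (A y) y x / pi1 g x y y x)"
proof -
  interpret timelike_hyp M' J g' nabla' M \<iota> N nabla
    using assms(4,6,7) by unfold_locales (simp_all add: kaehler_norden_def)
  note p = assms(8)
  have dim: "DIM(real ^ 'm) > 2" using assms(1,2) by simp
  have R: "R x y z u =
        \<nu> * (pi1 g x y z u - pi2 g \<phi> x y z u - tan t * pi5 g \<phi> \<eta> x y z u)
        + \<nu>t * (pi3 g \<phi> x y z u - tan t * pi4 g \<eta> x y z u)
        - pi1 g (A x) (A y) z u" for x y z u
    unfolding assms(9-17) by (rule curvature_hypersurface[OF p dim assms(5)])
  note C = hypersurface_curvature_consequences[OF assms(3), of g \<phi> \<eta> A \<xi> R \<nu> t \<nu>t, OF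
      bilinear_gp[OF p, folded assms(9)] gp_sym[OF p, folded assms(9)]
      linear_\<phi>[OF p, folded assms(11)] linear_\<eta>[OF p, folded assms(13)] gauss_weingarten(3)[OF p, folded assms(14)]
      \<phi>\<phi>[OF p, folded assms(11-13)] \<phi>\<xi>[OF p, folded assms(11-13)] \<eta>\<phi>[OF p, folded assms(11-13)]
      \<eta>\<xi>[OF p, folded assms(11-13)] gp_\<phi>[OF p, folded assms(9,11)] gp_\<xi>[OF p, folded assms(9,12,13)]
      gauss_weingarten(2)[OF p, folded assms(9,14)] R]
  \<comment> \<open>Unfolding \<open>plane_basis\<close> replaces \<alpha> by a span, the form in
    which \<open>C\<close> treats totally real sections.\<close>
  show ?thesis
    by (intro conjI allI impI; (elim conjE)?)
      (auto simp only: plane_basis_def intro: R C)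
qed

end
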